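(* Let $a:\mathbb{N}\to\mathbb{C}$ be an arithmetic function satisfying $a(1)=1$ and $|a(n)|\ll n^{-\alpha}$ for some $\alpha>0$. Let $S$ be a set of primes having a natural density $\delta(S)$. Then $$-\sum_{\substack{n\geq 2\\ p(n)\in S}}\frac{(\mu*a)(n)}{\varphi(n)}=\delta(S).$$ In particular, for any integer $m\geq 1$ and any integers $k,\ell\ge 1$ with $(\ell,k)=1$, $$-\sum_{\substack{n\geq 2\\ p(n)\equiv \ell\ (\mathrm{mod}\ k)}}\frac{\mu(n)}{\varphi(n)}=\frac{1}{\varphi(k)}\qquad\text{and}\qquad -\sum_{\substack{n\geq 2\\ p(n)\equiv \ell\ (\mathrm{mod}\ k)}}\frac{c_n(m)}{\varphi(n)}=\frac{1}{\varphi(k)}.$$ Here $p(n)$ is the smallest prime divisor of $n$, $\varphi$ is Euler's totient function, and $c_n(m)=\sum_{1\leq q\leq n,\ (q,n)=1}e^{2\pi i qm/n}$ is the Ramanujan sum.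
   Context: $\mathbb{N}$ is the set of positive integers, $\mu$ is the Möbius function, and $(\mu*a)(n)=\sum_{d\mid n}\mu(d)\,a(n/d)$ is the Dirichlet convolution. The condition $|a(n)|\ll n^{-\alpha}$ means that there is a constant $C$ with $|a(n)|\le C n^{-\alpha}$ for all $n\ge1$. A set $S$ of primes has natural density $\delta(S)$ if the limit $\delta(S):=\lim_{x\to\infty}\pi_S(x)/\pi(x)$ exists, where $\pi_S(x)=\#\{p\in S: p\leq x\}$ and $\pi(x)$ is the number of all primes $p\le x$. Infinite sums over $n$ are understood as limits of the partial sums over $n\le x$ as $x\to\infty$; the claim includes convergence of the sums in this sense. *)

theory Defs
  imports
    Complex_Main
    "HOL-Computational_Algebra.Squarefree"
    "HOL-Number_Theory.Number_Theory"
begin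

text \<open>
  An arithmetic function is a function on \<^typ>\<open>nat\<close>; its value at \<open>0\<close> carries no meaning
  and is never constrained.
\<close>

definition moebius :: "nat \<Rightarrow> int" where
  "moebius n = (if squarefree n then (- 1) ^ card (prime_factors n) else 0)"

definition dirichlet_conv :: "(nat \<Rightarrow> complex) \<Rightarrow> (nat \<Rightarrow> complex) \<Rightarrow> nat \<Rightarrow> complex" where
  "dirichlet_conv f g n = (\<Sum>d | d dvd n. f d * g (n div d))"

text \<open>Meaningful for \<open>n \<ge> 2\<close> only.\<close>

definition least_prime_divisor :: "nat \<Rightarrow> nat" where
  "least_prime_divisor n = (LEAST p. prime p \<and> p dvd n)"

definition ramanujan_sum :: "nat \<Rightarrow> nat \<Rightarrow> complex" where
  "ramanujan_sum n m =
     (\<Sum>q | 1 \<le> q \<and> q \<le> n \<and> coprime q n.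
        exp (2 * complex_of_real pi * \<i> * of_nat q * of_nat m / of_nat n))"

definition prime_count_in :: "nat set \<Rightarrow> real \<Rightarrow> nat" where
  "prime_count_in S x = card {p \<in> S. prime p \<and> real p \<le> x}"

definition has_natural_density :: "nat set \<Rightarrow> real \<Rightarrow> bool" where
  "has_natural_density S \<delta> \<longleftrightarrow>
     ((\<lambda>x. real (prime_count_in S x) / real (prime_count_in UNIV x)) \<longlongrightarrow> \<delta>) at_top"

end

theory Submission
  imports
    "HOL-Complex_Analysis.Complex_Analysis"
    "HOL-Real_Asymp.Real_Asymp"
    Defs
begin

text \<open>
  Write \<open>P p\<close> for the product of the primes up to \<open>p\<close>, so that \<open>t\<close> is coprime to \<open>P p\<close> iff all its prime factors
  exceed \<open>p\<close>. Splitting off the least prime factor gives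
  \<open>- \<Sum>\<^sub>n\<^sub>\<le>\<^sub>N \<mu>(n) / n = \<Sum>\<^sub>p (1 / p) \<Sum>\<^sub>t\<^sub>\<le>\<^sub>N\<^sub>/\<^sub>p \<mu>(t) / t\<close>, with \<open>p(n) \<in> S\<close> on the left and \<open>p \<in> S\<close>,
  \<open>(t, P p) = 1\<close> on the right. If \<open>S\<close> is the set of all primes, the left side tends to \<open>1\<close>, because
  \<open>\<Sum>\<mu>(n) / n = 0\<close> (the prime number theorem, by Newman's contour argument). For general \<open>S\<close> one replaces the
  indicator function of \<open>S\<close> by its deviation from \<open>\<delta>\<close>. The primes \<open>p > N\<^sup>\<epsilon>\<close> contribute little by partial summation
  over \<open>p\<close> for fixed \<open>t\<close>. The primes \<open>p \<le> N\<^sup>\<epsilon>\<close> contribute little by Axer's argument, since replacing \<open>N / n\<close> by its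
  integer part turns the sum into a count of integers without large prime factors, and since the sums of
  \<open>\<mu>(n)\<close> over \<open>p(n) \<in> S\<close> are \<open>o(N)\<close> uniformly in \<open>S\<close>.

  Only the density of \<open>S\<close> in the logarithmic sense \<open>\<Sum>\<^sub>p\<^sub>\<le>\<^sub>N (1\<^sub>S(p) - \<delta>) ln p / p = o(ln N)\<close> enters. For residue
  classes this is Mertens' form of Dirichlet's theorem, which requires \<open>L(1, \<psi>) \<noteq> 0\<close> for the non-principal
  characters \<open>\<psi>\<close> but no prime number theorem in progressions.

  The passage from \<open>\<mu>(n) / n\<close> to \<open>(\<mu> * a)(n) / \<phi>(n)\<close> expands \<open>n / \<phi>(n)\<close> as the sum of \<open>\<mu>(q)\<^sup>2 / \<phi>(q)\<close> over \<open>q\<close>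
  dividing \<open>n\<close> and lets \<open>N\<close> tend to infinity termwise in the sums over \<open>q\<close> and over the argument \<open>e\<close> of \<open>a\<close>, by
  dominated convergence; only \<open>e = q = 1\<close> has a non-zero limit.
\<close>

section \<open>Moebius sums over divisors and Dirichlet series\<close>

text \<open>There is no absolute convergence to rely on: the sum of \<mu>(n)^2 / \<phi>(n) over all
  n diverges. What makes the exchanges of limits legitimate is uniformity: the sum of \<mu>(t) / t
  over t \<le> N coprime to k is at most 1 in modulus for all N and k. It bounds the sums with a
  fixed cofactor m by O(1 + ln m), and the weights 1 / (q \<phi>(q)) and e^(-\<alpha>) / \<phi>(e)
  can afford a logarithm. The threshold N^\<epsilon> is forced from both sides. Below it, the
  integers up to N composed of primes up to N^\<epsilon> number O(\<epsilon> N) + o(N). Above it,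
  the squarefree t composed of primes in [N^\<epsilon>, N] have reciprocals summing to about exp(1 /
  \<epsilon>) at most, a constant once \<epsilon> is fixed, which a deviation o(ln N) divided by ln
  N^\<epsilon> overcomes. Since the set of primes of S below N^\<epsilon> changes with N, the o(N)
  bound in Axer's step must not depend on the set. If L(1, \<psi>) = 0, the sum of \<psi>(n)
  \<Lambda>(n) / n is - ln N + O(1); the 3-4-1 inequality excludes this for complex \<psi>, a
  Lambert series with non-negative coefficients for real \<psi>.\<close>

lemma moebius_1 [simp]: "moebius 1 = 1" "moebius (Suc 0) = 1"
  by (simp_all add: moebius_def)

lemma moebius_0 [simp]: "moebius 0 = 0"
  by (simp add: moebius_def)

lemma abs_moebius_le_1: "\<bar>moebius n\<bar> \<le> 1"
  by (simp add: moebius_def)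

lemma abs_real_moebius_le_1: "\<bar>real_of_int (moebius n)\<bar> \<le> 1"
  using abs_moebius_le_1[of n] by linarith

lemma moebius_mult_coprime:
  assumes "coprime a b"
  shows "moebius (a * b) = moebius a * moebius b"
proof (cases "a = 0 \<or> b = 0")
  case True
  then show ?thesis using assms by auto
next
  case False
  have "prime_factors a \<inter> prime_factors b = {}"
    using assms by (metis coprime_common_divisor disjoint_iff in_prime_factors_iff not_prime_unit)
  moreover have "prime_factors (a * b) = prime_factors a \<union> prime_factors b"
    using False by (simp add: prime_factors_product)
  ultimately have "card (prime_factors (a * b)) = card (prime_factors a) + card (prime_factors b)"
    by (simp add: card_Un_disjoint)
  then show ?thesis using squarefree_mult_coprime[OF assms] squarefree_multD
    by (auto simp: moebius_def power_add)
qed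

lemma moebius_mult_not_coprime:
  assumes "\<not> coprime a b"
  shows "moebius (a * b) = 0"
proof -
  obtain d where d: "d dvd a" "d dvd b" "\<not> is_unit d" using assms by (rule not_coprimeE)
  then have "d ^ 2 dvd a * b" by (simp add: mult_dvd_mono power2_eq_square)
  then show ?thesis using d(3) by (auto simp: moebius_def squarefree_def)
qed

lemma moebius_prime_mult:
  assumes "prime p" "\<not> p dvd d"
  shows "moebius (p * d) = - moebius d"
proof -
  have "coprime p d" using assms by (simp add: prime_imp_coprime)
  moreover have "moebius p = -1"
    using assms(1) by (simp add: moebius_def squarefree_prime prime_prime_factors)
  ultimately show ?thesis by (simp add: moebius_mult_coprime)
qed

text \<open>A prime p dividing j but not k pairs each divisor t prime to p with p t, and \<mu>(p t)
  = - \<mu>(t); multiples of p^2 contribute nothing. If there is no such p, only t = 1 is coprime to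
  k. The case k = 1 is the usual identity; general k detects the integers composed of primes
  dividing k.\<close>

lemma sum_moebius_coprime_divisors:
  fixes j k :: nat
  assumes "j > 0"
  shows "(\<Sum>t | t dvd j \<and> coprime t k. moebius t) =
           (if \<forall>p. prime p \<longrightarrow> p dvd j \<longrightarrow> p dvd k then 1 else 0)"
proof (cases "\<forall>p. prime p \<longrightarrow> p dvd j \<longrightarrow> p dvd k")
  case True
  have "{t. t dvd j \<and> coprime t k} = {1}"
  proof (intro equalityI subsetI)
    fix t assume t: "t \<in> {t. t dvd j \<and> coprime t k}"
    show "t \<in> {1}"
    proof (rule ccontr)
      assume "t \<notin> {1}"
      then obtain p where "prime p" "p dvd t" by (metis prime_factor_nat singletonI)
      with t True show False
        by (metis coprime_common_divisor dvd_trans mem_Collect_eq not_prime_unit)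
    qed
  qed auto
  with True show ?thesis by simp
next
  case False
  then obtain p where p: "prime p" "p dvd j" "\<not> p dvd k" by blast
  define D where "D = {t. t dvd j \<and> coprime t k}"
  have fin: "finite D" unfolding D_def using assms by simp
  have cpk: "coprime p k" using p by (simp add: prime_imp_coprime)
  have "(\<Sum>t\<in>D. moebius t) = (\<Sum>t | t \<in> D \<and> \<not> p dvd t. moebius t) + (\<Sum>t | t \<in> D \<and> p dvd t. moebius t)"
    using fin by (subst sum.union_disjoint [symmetric]) (auto intro!: sum.cong)
  also have "(\<Sum>t | t \<in> D \<and> p dvd t. moebius t) = (\<Sum>t | t \<in> D \<and> p dvd t \<and> \<not> p ^ 2 dvd t. moebius t)"
  proof (rule sum.mono_neutral_right)
    show "\<forall>i\<in>{t \<in> D. p dvd t} - {t \<in> D. p dvd t \<and> \<not> p ^ 2 dvd t}. moebius i = 0"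
      using p by (auto simp: moebius_def squarefree_def)
  qed (use fin in auto)
  also have "\<dots> = (\<Sum>s | s \<in> D \<and> \<not> p dvd s. moebius (p * s))"
  proof (rule sum.reindex_bij_witness[where i = "\<lambda>s. p * s" and j = "\<lambda>t. t div p"])
    fix s assume s: "s \<in> {s. s \<in> D \<and> \<not> p dvd s}"
    then have "coprime p s" using p by (simp add: prime_imp_coprime)
    then have "p * s dvd j" using s p by (simp add: D_def divides_mult)
    then show "p * s \<in> {t. t \<in> D \<and> p dvd t \<and> \<not> p ^ 2 dvd t}"
      using s p cpk by (auto simp: D_def power2_eq_square)
  next
    fix t assume t: "t \<in> {t. t \<in> D \<and> p dvd t \<and> \<not> p ^ 2 dvd t}"
    then obtain s where s: "t = p * s" by auto
    with t p show "t div p \<in> {s. s \<in> D \<and> \<not> p dvd s}"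
      by (auto simp: D_def power2_eq_square intro: dvd_mult_right)
  qed (use p in auto)
  also have "\<dots> = (\<Sum>s | s \<in> D \<and> \<not> p dvd s. - moebius s)"
    using p by (intro sum.cong) (auto simp: moebius_prime_mult)
  finally show ?thesis using False by (simp add: D_def sum_negf)
qed

lemma sum_moebius_divisors:
  fixes j :: nat
  assumes "j > 0"
  shows "(\<Sum>t | t dvd j. moebius t) = (if j = 1 then 1 else 0)"
proof -
  have "(\<forall>p. prime p \<longrightarrow> p dvd j \<longrightarrow> p dvd (1::nat)) \<longleftrightarrow> j = 1"
    by (metis nat_dvd_1_iff_1 not_prime_1 prime_factor_nat)
  then show ?thesis using sum_moebius_coprime_divisors[OF assms, of 1] by simp
qed

text \<open>Every sum over a Dirichlet convolution up to N is opened by this substitution n = d t.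
  The summand is a function of both factors because several later ones do not split into a
  product.\<close>

lemma sum_divisors_swap:
  fixes f :: "nat \<Rightarrow> nat \<Rightarrow> 'a :: comm_monoid_add"
  shows "(\<Sum>n=1..N. \<Sum>d | d dvd n. f d (n div d)) = (\<Sum>d=1..N. \<Sum>t=1..N div d. f d t)"
proof -
  have "(\<Sum>n=1..N. \<Sum>d | d dvd n. f d (n div d)) =
        (\<Sum>(n, d)\<in>(SIGMA n:{1..N}. {d. d dvd n}). f d (n div d))"
    by (rule sum.Sigma) auto
  also have "\<dots> = (\<Sum>(d, t)\<in>(SIGMA d:{1..N}. {1..N div d}). f d t)"
  proof (rule sum.reindex_bij_witness[where i = "\<lambda>(d, t). (d * t, d)" and j = "\<lambda>(n, d). (d, n div d)"])
    fix x assume x: "x \<in> (SIGMA n:{1..N}. {d. d dvd n})"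
    then obtain n d where nd: "x = (n, d)" "1 \<le> n" "n \<le> N" "d dvd n" by auto
    then have "d \<ge> 1" "d \<le> n" "n div d \<ge> 1" "n div d \<le> N div d"
      by (auto simp: dvd_imp_le div_le_mono dvd_pos_nat Suc_le_eq div_greater_zero_iff intro: dvd_pos_nat)
    with nd show "(case x of (n, d) \<Rightarrow> (d, n div d)) \<in> (SIGMA d:{1..N}. {1..N div d})" by auto
  next
    fix x assume x: "x \<in> (SIGMA d:{1..N}. {1..N div d})"
    then obtain d t where dt: "x = (d, t)" "1 \<le> d" "d \<le> N" "1 \<le> t" "t \<le> N div d" by auto
    then have "t * d \<le> N" by (simp add: less_eq_div_iff_mult_less_eq)
    then show "(case x of (d, t) \<Rightarrow> (d * t, d)) \<in> (SIGMA n:{1..N}. {d. d dvd n})"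
      using dt by (auto simp: mult.commute)
  qed auto
  also have "\<dots> = (\<Sum>d=1..N. \<Sum>t=1..N div d. f d t)"
    by (rule sum.Sigma[symmetric]) auto
  finally show ?thesis .
qed

lemma sum_divisors_count:
  fixes f :: "nat \<Rightarrow> 'a :: comm_semiring_1"
  shows "(\<Sum>n=1..N. \<Sum>d | d dvd n. f d) = (\<Sum>d=1..N. f d * of_nat (N div d))"
  using sum_divisors_swap[of "\<lambda>d t. f d" N] by (simp add: mult.commute)

section \<open>Summation by parts\<close>

lemma abel_identity:
  fixes w :: "nat \<Rightarrow> real" and v :: "nat \<Rightarrow> 'a :: real_normed_vector"
  assumes "a \<le> b"
  shows "(\<Sum>n=a..b. w n *\<^sub>R v n) =
           w b *\<^sub>R (\<Sum>n=a..b. v n) + (\<Sum>n=a..<b. (w n - w (Suc n)) *\<^sub>R (\<Sum>i=a..n. v i))"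
  using assms
proof (induction b rule: dec_induct)
  case (step n)
  then show ?case by (simp add: algebra_simps)
qed auto

text \<open>The differences of a decreasing weight telescope, so that together with the last value
  they add up to w a. Vector values allow real sums and character sums alike.\<close>

lemma abel_inequality:
  fixes w :: "nat \<Rightarrow> real" and v :: "nat \<Rightarrow> 'a :: real_normed_vector"
  assumes mono: "\<And>n. a \<le> n \<Longrightarrow> n < b \<Longrightarrow> w (Suc n) \<le> w n"
    and nonneg: "a \<le> b \<Longrightarrow> 0 \<le> w b"
    and V: "\<And>n. a \<le> n \<Longrightarrow> n \<le> b \<Longrightarrow> norm (\<Sum>i=a..n. v i) \<le> B"
    and "a \<le> b"
  shows "norm (\<Sum>n=a..b. w n *\<^sub>R v n) \<le> w a * B"
proof -
  have tele: "(\<Sum>n=a..<b. (w n - w (Suc n))) = w a - w b"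
    using sum_Suc_diff'[of a b "\<lambda>n. - w n"] \<open>a \<le> b\<close> by simp
  have "norm (\<Sum>n=a..b. w n *\<^sub>R v n) \<le>
      norm (w b *\<^sub>R (\<Sum>n=a..b. v n)) + norm (\<Sum>n=a..<b. (w n - w (Suc n)) *\<^sub>R (\<Sum>i=a..n. v i))"
    unfolding abel_identity[OF \<open>a \<le> b\<close>] by (rule norm_triangle_ineq)
  also have "\<dots> \<le> w b * B + (\<Sum>n=a..<b. (w n - w (Suc n)) * B)"
  proof (rule add_mono)
    show "norm (w b *\<^sub>R (\<Sum>n=a..b. v n)) \<le> w b * B"
      using V[of b] nonneg \<open>a \<le> b\<close> by (simp add: mult_left_mono)
    show "norm (\<Sum>n=a..<b. (w n - w (Suc n)) *\<^sub>R (\<Sum>i=a..n. v i)) \<le> (\<Sum>n=a..<b. (w n - w (Suc n)) * B)"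
      using V mono by (intro sum_norm_le) (auto intro!: mult_left_mono)
  qed
  also have "(\<Sum>n=a..<b. (w n - w (Suc n)) * B) = (w a - w b) * B"
    by (simp add: tele flip: sum_distrib_right)
  finally show ?thesis by (simp add: algebra_simps)
qed

text \<open>Absolute convergence on pairs permits regrouping along n = d t. Since
  \<open>has_sum\<close> does not depend on an order of summation, the regrouping is a mere change
  of index set.\<close>

lemma dirichlet_product_has_sum:
  fixes A B :: "nat \<Rightarrow> complex"
  assumes A: "(A has_sum a) {1..}" and B: "(B has_sum b) {1..}"
    and absA: "(\<lambda>n. norm (A n)) summable_on {1..}" and absB: "(\<lambda>n. norm (B n)) summable_on {1..}"
  shows "((\<lambda>n. \<Sum>d | d dvd n. A d * B (n div d)) has_sum (a * b)) {1..}"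
proof -
  let ?F = "\<lambda>(x, y). A x * B y"
  have "(\<lambda>x. norm (?F x)) summable_on ({1..} \<times> {1..})"
  proof (subst Infinite_Sum.abs_summable_on_Sigma_iff, intro conjI ballI)
    fix x :: nat assume "x \<in> {1..}"
    show "(\<lambda>xa. norm (case (x, xa) of (x, y) \<Rightarrow> A x * B y)) summable_on {1..}"
      using absB by (simp add: norm_mult summable_on_cmult_right)
  next
    have "(\<lambda>x. norm (A x) * (\<Sum>\<^sub>\<infinity>y\<in>{1..}. norm (B y))) summable_on {1..}"
      using absA by (simp add: summable_on_cmult_left)
    moreover have "0 \<le> (\<Sum>\<^sub>\<infinity>y\<in>{1..}. norm (B y))" by (simp add: infsum_nonneg)
    ultimately show "(\<lambda>x. norm (\<Sum>\<^sub>\<infinity>y\<in>{1..}. norm (case (x, y) of (x, y) \<Rightarrow> A x * B y))) summable_on {1..}"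
      by (simp add: norm_mult infsum_cmult_right')
  qed
  then have "?F summable_on ({1..} \<times> {1..})" by (rule abs_summable_summable)
  then have 1: "(?F has_sum (a * b)) ({1..} \<times> {1..})"
    using has_sum_cmult_right[OF B] has_sum_cmult_left[OF A]
    by (intro has_sum_SigmaI[where g = "\<lambda>x. A x * b"]) auto
  have "(?F has_sum (a * b)) ({1..} \<times> {1..}) \<longleftrightarrow>
        ((\<lambda>(n, d). A d * B (n div d)) has_sum (a * b)) (Sigma {1..} (\<lambda>n. {d. d dvd n}))"
  proof (rule has_sum_reindex_bij_witness[where j = "\<lambda>(d, t). (d * t, d)" and i = "\<lambda>(n, d). (d, n div d)"])
    fix x :: "nat \<times> nat" assume "x \<in> Sigma {1..} (\<lambda>n. {d. d dvd n})"
    then show "(case x of (n, d) \<Rightarrow> (d, n div d)) \<in> {1..} \<times> {1..}"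
      by (auto simp: Suc_le_eq div_greater_zero_iff dvd_imp_le intro: dvd_pos_nat)
  qed (auto simp: mult.commute)
  with 1 have "((\<lambda>(n, d). A d * B (n div d)) has_sum (a * b)) (Sigma {1..} (\<lambda>n. {d. d dvd n}))" by blast
  then show ?thesis
    by (rule has_sum_SigmaD) (auto intro!: has_sum_finite)
qed

text \<open>Series over nat start at 0, sums over divisors at 1. For Dirichlet series the hypothesis
  at 0 holds because \<open>0 powr z = 0\<close>.\<close>

lemma suminf_has_sum_atLeast_1:
  fixes f :: "nat \<Rightarrow> complex"
  assumes "summable (\<lambda>n. norm (f n))" "f 0 = 0"
  shows "(f has_sum suminf f) {1..}" "(\<lambda>n. norm (f n)) summable_on {1..}"
proof -
  have "(f has_sum suminf f) UNIV"
    using assms(1) norm_summable_imp_has_sum summable_norm_cancel summable_sums by blast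
  then show "(f has_sum suminf f) {1..}"
    by (rule has_sum_cong_neutral[THEN iffD1, rotated -1]) (use assms(2) in \<open>auto simp: not_le\<close>)
  have "(\<lambda>n. norm (f n)) summable_on UNIV"
    using assms(1) by (intro norm_summable_imp_summable_on) auto
  then show "(\<lambda>n. norm (f n)) summable_on {1..}" by (rule summable_on_subset_banach) auto
qed

lemma dirichlet_series_mult:
  fixes a b :: "nat \<Rightarrow> complex"
  assumes "summable (\<lambda>n. norm (a n * of_nat n powr (-s)))" "summable (\<lambda>n. norm (b n * of_nat n powr (-s)))"
  shows "((\<lambda>n. (\<Sum>d | d dvd n. a d * b (n div d)) * of_nat n powr (-s)) has_sum
            (\<Sum>n. a n * of_nat n powr (-s)) * (\<Sum>n. b n * of_nat n powr (-s))) {1..}"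
proof -
  note A = suminf_has_sum_atLeast_1[OF assms(1)] and B = suminf_has_sum_atLeast_1[OF assms(2)]
  have "((\<lambda>n. \<Sum>d | d dvd n. (a d * of_nat d powr (-s)) * (b (n div d) * of_nat (n div d) powr (-s))) has_sum
            (\<Sum>n. a n * of_nat n powr (-s)) * (\<Sum>n. b n * of_nat n powr (-s))) {1..}"
    by (intro dirichlet_product_has_sum A B) auto
  moreover have "(\<Sum>d | d dvd n. (a d * of_nat d powr (-s)) * (b (n div d) * of_nat (n div d) powr (-s))) =
      (\<Sum>d | d dvd n. a d * b (n div d)) * of_nat n powr (-s)" for n
    unfolding sum_distrib_right
  proof (rule sum.cong)
    fix d assume "d \<in> {d. d dvd n}"
    then obtain t where t: "n = d * t" by auto
    show "(a d * of_nat d powr (-s)) * (b (n div d) * of_nat (n div d) powr (-s)) = a d * b (n div d) * of_nat n powr (-s)"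
      using powr_times_real[of "of_nat d" "of_nat t" "-s"] t by (cases "d = 0") (auto)
  qed auto
  ultimately show ?thesis by simp
qed

section \<open>The zeta function to the right of Re s = 0\<close>

text \<open>For n > 0 this is s - 1 times the difference between n^(-s) and the integral of x^(-s)
  over [n, n + 1]. The factor s - 1 removes the pole, and subtracting the integral gains one power
  of n, whence convergence for Re s > 0.\<close>

definition zeta_term :: "nat \<Rightarrow> complex \<Rightarrow> complex" where
  "zeta_term n s = (s - 1) * of_nat n powr (-s) + of_nat (Suc n) powr (1 - s) - of_nat n powr (1 - s)"

text \<open>This is \<open>(s - 1) \<zeta>(s)\<close>; the summand for \<open>n = 0\<close> is \<open>1\<close> because \<open>0 powr z = 0\<close>.\<close>

definition zeta1 :: "complex \<Rightarrow> complex" where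
  "zeta1 s = (\<Sum>n. zeta_term n s)"

lemma zeta_term_0 [simp]: "zeta_term 0 s = 1"
  by (simp add: zeta_term_def)

lemma norm_of_nat_powr: "norm (of_nat n powr s :: complex) = real n powr Re s"
  by (simp add: norm_powr_real_powr)

lemma powr_diff_bound:
  fixes s :: complex
  assumes "0 < a" "a \<le> b" "Re s \<ge> -1"
  shows "norm (of_real b powr (-s) - of_real a powr (-s)) \<le> norm s * a powr (- Re s - 1) * (b - a)"
proof -
  have "norm (of_real b powr (-s) - of_real a powr (-s)) \<le> (norm s * a powr (- Re s - 1)) * norm (of_real b - of_real a :: complex)"
  proof (rule field_differentiable_bound[where S = "closed_segment (of_real a) (of_real b)"])
    fix z :: complex assume "z \<in> closed_segment (of_real a) (of_real b)"
    then have "z \<in> of_real ` closed_segment a b" by (simp add: closed_segment_of_real)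
    then obtain r where r: "z = of_real r" "a \<le> r" "r \<le> b"
      using assms by (auto simp: closed_segment_eq_real_ivl)
    have zr: "z \<notin> \<real>\<^sub>\<le>\<^sub>0" using r assms by auto
    show "((\<lambda>z. z powr (-s)) has_field_derivative (-s) * z powr (-s - 1)) (at z within closed_segment (of_real a) (of_real b))"
      using has_field_derivative_powr[OF zr, of "-s"] by (rule has_field_derivative_at_within)
    have "norm (z powr (-s - 1)) = r powr (- Re s - 1)"
      using r assms by (simp add: norm_powr_real_powr)
    also have "\<dots> \<le> a powr (- Re s - 1)" using r assms by (intro powr_mono2') auto
    finally show "norm ((-s) * z powr (-s - 1)) \<le> norm s * a powr (- Re s - 1)"
      by (simp add: norm_mult mult_left_mono)
  qed auto
  also have "norm (of_real b - of_real a :: complex) = b - a"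
    using assms by (metis abs_of_nonneg diff_ge_0_iff_ge norm_of_real of_real_diff)
  finally show ?thesis .
qed

lemma zeta_term_bound:
  assumes "n > 0" "Re s \<ge> -1"
  shows "norm (zeta_term n s) \<le> norm (s - 1) * norm s * real n powr (- Re s - 1)"
proof -
  let ?a = "of_nat n :: complex"
  \<comment> \<open>\<open>zeta_term n s\<close> is the increment of \<open>?h\<close> over
    [n, n + 1], and the derivative of \<open>?h\<close> vanishes at n; a second mean value estimate,
    for the power function, then supplies the extra factor 1 / n.\<close>
  let ?h = "\<lambda>x. (s - 1) * x * ?a powr (-s) + x powr (1 - s)"
  have "norm (?h (of_nat (Suc n)) - ?h ?a) \<le> (norm (s - 1) * norm s * real n powr (- Re s - 1)) * norm (of_nat (Suc n) - ?a)"
  proof (rule field_differentiable_bound[where S = "closed_segment ?a (of_nat (Suc n))"])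
    fix z :: complex assume "z \<in> closed_segment ?a (of_nat (Suc n))"
    then have "z \<in> of_real ` closed_segment (real n) (real (Suc n))"
      by (metis closed_segment_of_real of_real_of_nat_eq)
    then obtain r :: real where r: "z = of_real r" "n \<le> r" "r \<le> Suc n"
      by (auto simp: closed_segment_eq_real_ivl)
    have zr: "z \<notin> \<real>\<^sub>\<le>\<^sub>0" using r assms by auto
    show "(?h has_field_derivative (s - 1) * (?a powr (-s) - z powr (-s))) (at z within closed_segment ?a (of_nat (Suc n)))"
      using zr by (auto intro!: derivative_eq_intros simp: algebra_simps)
    have "norm (?a powr (-s) - z powr (-s)) \<le> norm s * real n powr (- Re s - 1) * (r - n)"
      using powr_diff_bound[of n r s] r assms by (simp add: norm_minus_commute)
    also have "\<dots> \<le> norm s * real n powr (- Re s - 1) * 1"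
      using r by (intro mult_left_mono) auto
    finally show "norm ((s - 1) * (?a powr (-s) - z powr (-s))) \<le> norm (s - 1) * norm s * real n powr (- Re s - 1)"
      by (simp add: norm_mult mult_left_mono mult.assoc)
  qed auto
  moreover have "?h (of_nat (Suc n)) - ?h ?a = zeta_term n s"
    by (simp add: zeta_term_def algebra_simps)
  ultimately show ?thesis by simp
qed

lemma holomorphic_zeta_term: "zeta_term n holomorphic_on A"
  by (cases "n = 0") (auto simp: zeta_term_def[abs_def] intro!: holomorphic_intros)

lemma holomorphic_zeta1: "zeta1 holomorphic_on {s. Re s > 0}"
proof (rule holomorphic_uniform_sequence[where f = "\<lambda>N s. \<Sum>n<N. zeta_term n s"])
  show "open {s. Re s > 0}" by (simp add: open_halfspace_Re_gt)
  show "(\<lambda>s. \<Sum>n<N. zeta_term n s) holomorphic_on {s. Re s > 0}" for N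
    by (intro holomorphic_intros holomorphic_zeta_term)
  fix x :: complex assume x: "x \<in> {s. Re s > 0}"
  define d where "d = Re x / 2"
  have d: "d > 0" using x by (simp add: d_def)
  define C where "C = norm x + d + 1"
  define M where "M n = C * C * real n powr (- d - 1) + (if n = 0 then 1 else 0)" for n
  have re: "Re s \<ge> d" if "s \<in> cball x d" for s
    using that abs_Re_le_cmod[of "x - s"] by (auto simp: dist_norm d_def)
  have "uniform_limit (cball x d) (\<lambda>N s. \<Sum>n<N. zeta_term n s) (\<lambda>s. \<Sum>n. zeta_term n s) sequentially"
  proof (rule Weierstrass_m_test)
    fix n s assume s: "s \<in> cball x d"
    have ns: "norm s \<le> C" "norm (s - 1) \<le> C"
      using s norm_triangle_ineq2[of s x] norm_triangle_ineq4[of s 1]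
      by (auto simp: C_def dist_norm norm_minus_commute)
    show "norm (zeta_term n s) \<le> M n"
    proof (cases "n = 0")
      case False
      have "norm (zeta_term n s) \<le> norm (s - 1) * norm s * real n powr (- Re s - 1)"
        using False re[OF s] d by (intro zeta_term_bound) auto
      also have "\<dots> \<le> C * C * real n powr (- d - 1)"
        using False re[OF s] ns by (intro mult_mono powr_mono) (auto intro: order_trans[OF norm_ge_zero])
      finally show ?thesis using False by (simp add: M_def)
    qed (auto simp: M_def)
  next
    show "summable M" unfolding M_def
      using d by (intro summable_add summable_mult) (auto simp: summable_real_powr_iff)
  qed
  then show "\<exists>d>0. cball x d \<subseteq> {s. 0 < Re s} \<and>
      uniform_limit (cball x d) (\<lambda>N s. \<Sum>n<N. zeta_term n s) zeta1 sequentially"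
    using d re by (intro exI[of _ d]) (auto simp: zeta1_def[abs_def] less_le_trans)
qed

lemma zeta1_1: "zeta1 1 = 1"
proof -
  have "zeta_term n 1 = (if n = 0 then 1 else 0)" for n
    by (auto simp: zeta_term_def simp del: of_nat_Suc)
  then show ?thesis unfolding zeta1_def using sums_single[of 0 "\<lambda>_. 1 :: complex"] by (simp add: sums_iff)
qed

section \<open>The Dirichlet series of 1, \<mu> and \<Lambda> for Re s > 1\<close>

lemma summable_norm_powr:
  assumes "Re s > 1"
  shows "summable (\<lambda>n. norm (of_nat n powr (-s) :: complex))"
  using assms by (simp add: norm_of_nat_powr summable_real_powr_iff)

lemma zeta1_eq:
  assumes "Re s > 1"
  shows "zeta1 s = (s - 1) * (\<Sum>n. of_nat n powr (-s))"
proof -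
  have "(\<lambda>n. real n powr (1 - Re s)) \<longlonglongrightarrow> 0"
    using assms by real_asymp
  then have "(\<lambda>n. of_nat n powr (1 - s) :: complex) \<longlonglongrightarrow> 0"
    by (subst tendsto_norm_zero_iff[symmetric]) (simp add: norm_of_nat_powr)
  \<comment> \<open>The telescoping starts at n = 0, where the power is 0, so the total is 0; this
    includes the 1 contributed by the summand for n = 0.\<close>
  then have "(\<lambda>n. of_nat (Suc n) powr (1 - s) - of_nat n powr (1 - s) :: complex) sums 0"
    using telescope_sums[of "\<lambda>n. of_nat n powr (1 - s) :: complex" 0] by simp
  moreover have "(\<lambda>n. (s - 1) * of_nat n powr (-s)) sums ((s - 1) * (\<Sum>n. of_nat n powr (-s)))"
    using summable_norm_cancel[OF summable_norm_powr[OF assms]] by (intro sums_mult summable_sums)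
  ultimately have "(\<lambda>n. (s - 1) * of_nat n powr (-s) + (of_nat (Suc n) powr (1 - s) - of_nat n powr (1 - s))) sums
      ((s - 1) * (\<Sum>n. of_nat n powr (-s)) + 0)" by (rule sums_add[rotated])
  then show ?thesis by (auto simp: zeta1_def zeta_term_def add_diff_eq sums_iff)
qed

lemma summable_bounded_dirichlet:
  fixes a :: "nat \<Rightarrow> complex"
  assumes "Re s > 1" "\<And>n. norm (a n) \<le> 1"
  shows "summable (\<lambda>n. norm (a n * of_nat n powr (-s)))"
  using summable_norm_powr[OF assms(1)]
  by (rule summable_comparison_test'[where N = 0])
     (use assms(2) in \<open>auto simp: norm_mult intro!: mult_left_le_one_le\<close>)

text \<open>The series of \<mu> inverts \<zeta>, since the convolution of \<mu> with 1 is the unit.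
  Written without division, the identity gives both the value of the series and the absence of
  zeros.\<close>

lemma moebius_series:
  assumes "Re s > 1"
  shows "zeta1 s * (\<Sum>n. of_int (moebius n) * of_nat n powr (-s)) = s - 1"
proof -
  have 1: "((\<lambda>n. (\<Sum>d | d dvd n. of_int (moebius d) * 1) * of_nat n powr (-s)) has_sum
            (\<Sum>n. of_int (moebius n) * of_nat n powr (-s)) * (\<Sum>n. 1 * of_nat n powr (-s))) {1..}"
    using assms by (intro dirichlet_series_mult summable_bounded_dirichlet)
      (auto simp: norm_of_int abs_real_moebius_le_1)
  have "((\<lambda>n. (\<Sum>d | d dvd n. of_int (moebius d) * 1) * of_nat n powr (-s)) has_sum (1 :: complex)) {1}"
    by (auto simp: has_sum_finite_iff)
  then have "((\<lambda>n. (\<Sum>d | d dvd n. of_int (moebius d) * 1) * of_nat n powr (-s)) has_sum (1 :: complex)) {1..}"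
  proof (rule has_sum_cong_neutral[THEN iffD1, rotated -1])
    fix n :: nat assume "n \<in> {1..} - {1}"
    then have "(\<Sum>d | d dvd n. moebius d) = 0" by (subst sum_moebius_divisors) auto
    then show "(\<Sum>d | d dvd n. of_int (moebius d) * 1) * of_nat n powr (-s) = (0 :: complex)"
      by (simp flip: of_int_sum)
  qed auto
  with 1 have "(\<Sum>n. of_int (moebius n) * of_nat n powr (-s)) * (\<Sum>n. of_nat n powr (-s)) = (1 :: complex)"
    using has_sum_unique by fastforce
  then show ?thesis using zeta1_eq[OF assms] by (simp add: mult_ac)
qed

lemma zeta1_nonzero_gt_1: "Re s > 1 \<Longrightarrow> zeta1 s \<noteq> 0"
  using moebius_series[of s] by auto

lemma summable_ln_powr:
  assumes "c > 1"
  shows "summable (\<lambda>n. ln (real n) * real n powr (-c))"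
proof -
  define e where "e = (c - 1) / 2"
  have e: "e > 0" using assms by (simp add: e_def)
  show ?thesis
  proof (rule summable_comparison_test'[where N = 1])
    have "c - e > 1" using assms by (simp add: e_def field_simps)
    then show "summable (\<lambda>n. (1 / e) * real n powr (e - c))"
      by (intro summable_mult) (simp add: summable_real_powr_iff)
    fix n :: nat assume n: "n \<ge> 1"
    have "ln (real n) * real n powr (-c) \<le> (real n powr e / e) * real n powr (-c)"
      using n e by (intro mult_right_mono ln_powr_bound) auto
    also have "\<dots> = (1 / e) * real n powr (e - c)"
      by (simp add: powr_add[symmetric] field_simps powr_diff powr_minus)
    finally show "norm (ln (real n) * real n powr (-c)) \<le> (1 / e) * real n powr (e - c)"
      using n by simp
  qed
qed

lemma summable_norm_mangoldt:
  assumes "Re s > 1"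
  shows "summable (\<lambda>n. norm (mangoldt n * of_nat n powr (-s) :: complex))"
proof (rule summable_comparison_test'[OF summable_ln_powr[OF assms], where N = 1])
  fix n :: nat assume "n \<ge> 1"
  then show "norm (norm (mangoldt n * of_nat n powr (-s) :: complex)) \<le> ln (real n) * real n powr (- Re s)"
    by (auto simp: norm_mult norm_of_nat_powr abs_mult intro!: mult_right_mono mangoldt_le)
qed

lemma mangoldt_series:
  assumes "Re s > 1"
  shows "(\<Sum>n. mangoldt n * of_nat n powr (-s)) * (\<Sum>n. of_nat n powr (-s)) =
         (\<Sum>n. of_real (ln (real n)) * of_nat n powr (-s) :: complex)"
proof -
  have 1: "((\<lambda>n. (\<Sum>d | d dvd n. mangoldt d * 1) * of_nat n powr (-s)) has_sum
            (\<Sum>n. mangoldt n * of_nat n powr (-s)) * (\<Sum>n. 1 * of_nat n powr (-s))) {1..}"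
    using assms by (intro dirichlet_series_mult summable_bounded_dirichlet summable_norm_mangoldt) auto
  have "summable (\<lambda>n. norm (of_real (ln (real n)) * of_nat n powr (-s) :: complex))"
  proof (rule summable_comparison_test'[OF summable_ln_powr[OF assms], where N = 1])
    fix n :: nat assume "n \<ge> 1"
    then show "norm (norm (of_real (ln (real n)) * of_nat n powr (-s) :: complex)) \<le> ln (real n) * real n powr (- Re s)"
      by (auto simp: norm_mult norm_of_nat_powr)
  qed
  from suminf_has_sum_atLeast_1(1)[OF this] 
  have 2: "((\<lambda>n. of_real (ln (real n)) * of_nat n powr (-s) :: complex) has_sum
        (\<Sum>n. of_real (ln (real n)) * of_nat n powr (-s) :: complex)) {1..}" by simp
  have "((\<lambda>n. (\<Sum>d | d dvd n. mangoldt d * 1) * of_nat n powr (-s)) has_sum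
        (\<Sum>n. of_real (ln (real n)) * of_nat n powr (-s) :: complex)) {1..}"
    by (rule has_sum_cong[THEN iffD1, OF _ 2]) (auto simp: mangoldt_sum)
  with 1 show ?thesis using has_sum_unique by fastforce
qed

lemma zeta_series_deriv:
  assumes "Re s > 1"
  shows "((\<lambda>s. \<Sum>n. of_nat n powr (-s) :: complex) has_field_derivative
           - (\<Sum>n. of_real (ln (real n)) * of_nat n powr (-s))) (at s)"
proof -
  let ?S = "{s. Re s > 1}"
  have "\<exists>g g'. \<forall>x\<in>?S. (\<lambda>n. of_nat n powr (-x) :: complex) sums g x \<and>
      (\<lambda>n. - (of_real (ln (real n)) * of_nat n powr (-x)) :: complex) sums g' x \<and> (g has_field_derivative g' x) (at x)"
  proof (rule series_and_derivative_comparison_complex)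
    show "open ?S" by (simp add: open_halfspace_Re_gt)
    fix n and x :: complex assume "x \<in> ?S"
    show "((\<lambda>x. of_nat n powr (-x) :: complex) has_field_derivative - (of_real (ln (real n)) * of_nat n powr (-x))) (at x)"
    proof (cases "n = 0")
      case False
      then show ?thesis
        using DERIV_chain2[OF has_field_derivative_powr_right DERIV_minus[OF DERIV_ident], of "of_nat n" x UNIV]
        by (simp add: Ln_of_nat)
    qed auto
  next
    fix x :: complex assume x: "x \<in> ?S"
    define d where "d = (Re x - 1) / 2"
    have d: "d > 0" using x by (simp add: d_def)
    have "\<forall>y\<in>ball x d \<inter> ?S. norm (of_nat n powr (-y) :: complex) \<le> norm (of_real (real n powr (-(1+d))) :: complex)" if "n \<ge> 1" for n
    proof
      fix y assume "y \<in> ball x d \<inter> ?S"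
      then have "cmod (x - y) < d" by (simp add: dist_norm)
      then have "Re y \<ge> 1 + d" using abs_le_D1[OF abs_Re_le_cmod[of "x - y"]]
        unfolding minus_complex.sel d_def by (simp add: field_simps)
      then show "norm (of_nat n powr (-y) :: complex) \<le> norm (of_real (real n powr (-(1+d))) :: complex)"
        using that by (simp add: norm_of_nat_powr powr_mono)
    qed
    then have "\<forall>\<^sub>F n in sequentially. \<forall>y\<in>ball x d \<inter> ?S. norm (of_nat n powr (-y) :: complex) \<le> norm (of_real (real n powr (-(1+d))) :: complex)"
      by (rule eventually_sequentiallyI)
    moreover have "summable (\<lambda>n. of_real (real n powr (-(1+d))) :: complex)"
      using d by (intro summable_of_real) (simp add: summable_real_powr_iff)
    ultimately show "\<exists>d h. 0 < d \<and> summable h \<and> range h \<subseteq> \<real>\<^sub>\<ge>\<^sub>0 \<and>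
        (\<forall>\<^sub>F n in sequentially. \<forall>y\<in>ball x d \<inter> ?S. cmod (of_nat n powr (-y)) \<le> cmod (h n))"
      using d by (intro exI[of _ d] exI[of _ "\<lambda>n. of_real (real n powr (-(1+d)))"]) auto
  qed
  then obtain g g' where g: "\<And>x. x \<in> ?S \<Longrightarrow> (\<lambda>n. of_nat n powr (-x) :: complex) sums g x"
      "\<And>x. x \<in> ?S \<Longrightarrow> (\<lambda>n. - (of_real (ln (real n)) * of_nat n powr (-x)) :: complex) sums g' x"
      "\<And>x. x \<in> ?S \<Longrightarrow> (g has_field_derivative g' x) (at x)" by blast
  have s: "s \<in> ?S" using assms by simp
  have "g' s = - (\<Sum>n. of_real (ln (real n)) * of_nat n powr (-s))"
    using sums_minus[OF g(2)[OF s]] by (simp add: sums_iff)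
  moreover have "((\<lambda>s. \<Sum>n. of_nat n powr (-s) :: complex) has_field_derivative g' s) (at s)"
    by (rule has_field_derivative_transform_within_open[OF g(3)[OF s] _ s])
       (use g(1) in \<open>auto simp: sums_iff open_halfspace_Re_gt\<close>)
  ultimately show ?thesis by simp
qed

text \<open>As the convolution of \<Lambda> with 1 is ln, the series times \<zeta> is minus the
  derivative of \<zeta>; the term 1 / (s - 1) appears because \<open>zeta1\<close> carries the
  factor s - 1.\<close>

lemma mangoldt_series_eq:
  assumes "Re s > 1"
  shows "(\<Sum>n. mangoldt n * of_nat n powr (-s)) = 1 / (s - 1) - deriv zeta1 s / zeta1 s"
proof -
  let ?Z = "\<lambda>s. \<Sum>n. of_nat n powr (-s) :: complex" and ?L = "(\<Sum>n. mangoldt n * of_nat n powr (-s)) :: complex"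
  have Z0: "?Z s \<noteq> 0" and s1: "s \<noteq> 1" using zeta1_nonzero_gt_1[OF assms] zeta1_eq[OF assms] by auto
  have "((\<lambda>s. (s - 1) * ?Z s) has_field_derivative (1 * ?Z s + (s - 1) * (- (?L * ?Z s)))) (at s)"
    unfolding mangoldt_series[OF assms]
    using zeta_series_deriv[OF assms] by (auto intro!: derivative_eq_intros)
  then have "(zeta1 has_field_derivative (1 * ?Z s + (s - 1) * (- (?L * ?Z s)))) (at s)"
    by (rule has_field_derivative_transform_within_open[where S = "{s. Re s > 1}"])
       (use assms in \<open>auto simp: zeta1_eq open_halfspace_Re_gt\<close>)
  then have "deriv zeta1 s = ?Z s - (s - 1) * ?L * ?Z s" by (simp add: DERIV_imp_deriv)
  moreover have "(z - a * L * z) / (a * z) = 1 / a - L" if "a \<noteq> 0" "z \<noteq> 0" for a z L :: complex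
    using that by (simp add: field_simps)
  ultimately show ?thesis using Z0 s1 by (simp add: zeta1_eq[OF assms])
qed

section \<open>Non-vanishing of zeta on the line Re s = 1\<close>

text \<open>Near w one has f(u) = (u - w)^m g(u) with g free of zeros, so x times the logarithmic
  derivative tends to the order m as w is approached from the right. A non-zero value somewhere in
  the connected set excludes infinite order.\<close>

lemma logderiv_order_limit:
  assumes f: "f holomorphic_on S" "open S" "connected S" and w: "w \<in> S" and nz: "z0 \<in> S" "f z0 \<noteq> 0"
  obtains m :: nat where "((\<lambda>x::real. of_real x * (deriv f (w + of_real x) / f (w + of_real x))) \<longlongrightarrow> of_nat m) (at_right 0)"
    "f w = 0 \<Longrightarrow> m \<ge> 1" "f w \<noteq> 0 \<Longrightarrow> m = 0"
proof -
  have lim: "((\<lambda>x::real. w + of_real x) \<longlongrightarrow> w) (at_right 0)"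
    by (auto intro!: tendsto_eq_intros)
  have lim0: "((\<lambda>x::real. of_real x :: complex) \<longlongrightarrow> of_real 0) (at_right 0)"
    by (intro tendsto_of_real tendsto_ident_at)
  show ?thesis
  proof (cases "f w = 0")
    case False
    have cont: "isCont f w" "isCont (deriv f) w"
      using f w holomorphic_on_imp_continuous_on[OF f(1)] holomorphic_on_imp_continuous_on[OF holomorphic_deriv[OF f(1,2)]]
      by (auto simp: continuous_on_eq_continuous_at)
    then have "((\<lambda>x::real. of_real x * (deriv f (w + of_real x) / f (w + of_real x))) \<longlongrightarrow> of_real 0 * (deriv f w / f w)) (at_right 0)"
      using False by (intro tendsto_mult lim0 tendsto_divide isCont_tendsto_compose[OF cont(1) lim] isCont_tendsto_compose[OF cont(2) lim])
    then show ?thesis using that[of 0] False by simp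
  next
    case True
    have nc: "\<not> f constant_on S"
    proof
      assume "f constant_on S"
      then obtain y where y: "\<forall>x\<in>S. f x = y" unfolding constant_on_def by (rule exE)
      show False using bspec[OF y w] bspec[OF y nz(1)] nz(2) True by simp
    qed
    obtain g r n where g: "0 < (n::nat)" "0 < r" "ball w r \<subseteq> S" "g holomorphic_on ball w r"
        "\<And>u. u \<in> ball w r \<Longrightarrow> f u = (u - w) ^ n * g u" "\<And>u. u \<in> ball w r \<Longrightarrow> g u \<noteq> 0"
      by (rule holomorphic_factor_zero_nonconstant[OF f w True nc]) (rule that; assumption)
    have cont: "isCont g w" "isCont (deriv g) w"
      using g(2) holomorphic_on_imp_continuous_on[OF g(4)] holomorphic_on_imp_continuous_on[OF holomorphic_deriv[OF g(4) open_ball]]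
      by (auto simp: continuous_on_eq_continuous_at)
    have "((\<lambda>x::real. of_nat n + of_real x * (deriv g (w + of_real x) / g (w + of_real x))) \<longlongrightarrow> of_nat n + of_real 0 * (deriv g w / g w)) (at_right 0)"
      using g(2) by (intro tendsto_add tendsto_const tendsto_mult lim0 tendsto_divide
          isCont_tendsto_compose[OF cont(1) lim] isCont_tendsto_compose[OF cont(2) lim] g(6)) simp
    moreover have "\<forall>\<^sub>F x::real in at_right 0. of_nat n + of_real x * (deriv g (w + of_real x) / g (w + of_real x)) =
        of_real x * (deriv f (w + of_real x) / f (w + of_real x))"
    proof -
      have "\<forall>\<^sub>F x::real in at_right 0. x \<in> {0<..<r}" using g(2) by (rule eventually_at_right_real)
      then show ?thesis
      proof eventually_elim
        case (elim x)
        let ?u = "w + of_real x"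
        have u: "?u \<in> ball w r" using elim by (simp add: dist_norm)
        have dg: "(g has_field_derivative deriv g ?u) (at ?u)"
          using g(4) u by (meson holomorphic_derivI open_ball)
        have "((\<lambda>u. (u - w) ^ n * g u) has_field_derivative
               (of_nat n * (?u - w) ^ (n - 1) * g ?u + (?u - w) ^ n * deriv g ?u)) (at ?u)"
          using dg by (auto intro!: derivative_eq_intros)
        then have "(f has_field_derivative (of_nat n * (?u - w) ^ (n - 1) * g ?u + (?u - w) ^ n * deriv g ?u)) (at ?u)"
          by (rule has_field_derivative_transform_within_open[OF _ open_ball u]) (simp add: g(5))
        then have D: "deriv f ?u = of_nat n * of_real x ^ (n - 1) * g ?u + of_real x ^ n * deriv g ?u"
          by (simp add: DERIV_imp_deriv)
        have F: "f ?u = of_real x ^ n * g ?u" using g(5)[OF u] by simp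
        have xn: "of_real x ^ n = of_real x * (of_real x ^ (n - 1) :: complex)"
          using g(1) by (cases n) auto
        have "c + X * (b / a) = X * ((c * Y * a + X * Y * b) / (X * Y * a))" if "X \<noteq> 0" "Y \<noteq> 0" "a \<noteq> 0" for X Y a b c :: complex
          using that by (simp add: field_simps)
        from this[of "of_real x" "of_real x ^ (n - 1)" "g ?u"] show ?case
          using elim g(6)[OF u] unfolding D F xn by simp
      qed
    qed
    ultimately have "((\<lambda>x::real. of_real x * (deriv f (w + of_real x) / f (w + of_real x))) \<longlongrightarrow> of_nat n + of_real 0 * (deriv g w / g w)) (at_right 0)"
      by (rule Lim_transform_eventually)
    then show ?thesis using that[of n] g(1) True by simp
  qed
qed

lemma Re_complex_of_real_mult: "Re (of_real x * z) = x * Re z"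
  by simp

lemma three_four_one: "0 \<le> 3 + 4 * cos x + cos (2 * x :: real)"
proof -
  have "3 + 4 * cos x + cos (2 * x) = 2 * (1 + cos x)\<^sup>2"
    using cos_double_cos[of x] by (simp add: power2_eq_square algebra_simps)
  then show ?thesis by simp
qed

text \<open>The real part of n^(-(1 + iu + x)) is n^(-1-x) cos(u ln n), so \<Lambda>(n) \<ge> 0 is
  multiplied by 3 + 4 cos \<theta> + cos 2\<theta> with \<theta> = t ln n.\<close>

lemma mangoldt_series_3_4_1:
  fixes x t :: real
  assumes "x > 0"
  defines "L \<equiv> \<lambda>s. (\<Sum>n. mangoldt n * of_nat n powr (-s)) :: complex"
  shows "0 \<le> Re (3 * L (1 + of_real x) + 4 * L (1 + \<i> * of_real t + of_real x) + L (1 + \<i> * of_real (2 * t) + of_real x))"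
proof -
  have s: "(\<lambda>n. mangoldt n * of_nat n powr (-(1 + \<i> * of_real u + of_real x))) sums L (1 + \<i> * of_real u + of_real x)" for u :: real
    unfolding L_def using assms
    by (intro summable_sums summable_norm_cancel[OF summable_norm_mangoldt]) auto
  have "(\<lambda>n. 3 * (mangoldt n * of_nat n powr (-(1 + \<i> * of_real 0 + of_real x))) +
         4 * (mangoldt n * of_nat n powr (-(1 + \<i> * of_real t + of_real x))) +
         mangoldt n * of_nat n powr (-(1 + \<i> * of_real (2 * t) + of_real x)))
     sums (3 * L (1 + \<i> * of_real 0 + of_real x) + 4 * L (1 + \<i> * of_real t + of_real x) + L (1 + \<i> * of_real (2 * t) + of_real x))"
    by (intro sums_add sums_mult s)
  from sums_Re[OF this]
  have S: "(\<lambda>n. Re (3 * (mangoldt n * of_nat n powr (-(1 + \<i> * of_real 0 + of_real x))) +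
         4 * (mangoldt n * of_nat n powr (-(1 + \<i> * of_real t + of_real x))) +
         mangoldt n * of_nat n powr (-(1 + \<i> * of_real (2 * t) + of_real x))))
     sums Re (3 * L (1 + \<i> * of_real 0 + of_real x) + 4 * L (1 + \<i> * of_real t + of_real x) + L (1 + \<i> * of_real (2 * t) + of_real x))" .
  have P: "Re (mangoldt n * of_nat n powr (-(1 + \<i> * of_real u + of_real x))) =
        mangoldt n * (exp (- (1 + x) * ln n) * cos (u * ln n))" for n u
  proof (cases "n = 0")
    case False
    have eq: "mangoldt n * of_nat n powr (-(1 + \<i> * of_real u + of_real x)) =
          of_real (mangoldt n) * exp (Complex (- (1 + x) * ln n) (- u * ln n))"
      using False by (simp add: powr_def Ln_of_nat complex_eq_iff Re_exp Im_exp algebra_simps)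
    show ?thesis unfolding eq Re_complex_of_real_mult by (simp add: Re_exp)
  qed auto
  have "0 \<le> Re (3 * L (1 + \<i> * of_real 0 + of_real x) + 4 * L (1 + \<i> * of_real t + of_real x) + L (1 + \<i> * of_real (2 * t) + of_real x))"
  proof (rule sums_le[OF _ sums_zero S])
    fix n
    have "0 \<le> mangoldt n * exp (- (1 + x) * ln n) * (3 + 4 * cos (t * ln n) + cos (2 * (t * ln n)))"
      using three_four_one[of "t * ln n"] mangoldt_nonneg[of n] by (intro mult_nonneg_nonneg) auto
    also have "\<dots> = Re (3 * (mangoldt n * of_nat n powr (-(1 + \<i> * of_real 0 + of_real x))) +
         4 * (mangoldt n * of_nat n powr (-(1 + \<i> * of_real t + of_real x))) +
         mangoldt n * of_nat n powr (-(1 + \<i> * of_real (2 * t) + of_real x)))"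
    proof -
      have "Re (3 * a + 4 * b + c) = 3 * Re a + 4 * Re b + Re c" for a b c :: complex by simp
      then show ?thesis unfolding P by (simp only: P) (simp add: algebra_simps)
    qed
    finally show "0 \<le> Re (3 * (mangoldt n * of_nat n powr (-(1 + \<i> * of_real 0 + of_real x))) +
         4 * (mangoldt n * of_nat n powr (-(1 + \<i> * of_real t + of_real x))) +
         mangoldt n * of_nat n powr (-(1 + \<i> * of_real (2 * t) + of_real x)))" .
  qed
  then show ?thesis by simp
qed

text \<open>Multiply the 3-4-1 inequality by x and let x tend to 0 from the right. The pole at 1
  contributes 3, a zero of order m1 at s contributes -4 m1, the order m2 at 1 + 2it contributes -
  m2, and 3 - 4 m1 - m2 \<ge> 0 is impossible for m1 \<ge> 1.\<close>

lemma zeta1_nonzero_line: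
  assumes "Re s = 1"
  shows "zeta1 s \<noteq> 0"
proof
  assume zero: "zeta1 s = 0"
  define t where "t = Im s"
  have s: "s = 1 + \<i> * of_real t" using assms by (simp add: complex_eq_iff t_def)
  have t: "t \<noteq> 0" using zero s zeta1_1 by auto
  let ?S = "{s. Re s > 0}" and ?L = "\<lambda>s. (\<Sum>n. mangoldt n * of_nat n powr (-s)) :: complex"
  have S: "open ?S" "connected ?S" "1 \<in> ?S" "zeta1 1 \<noteq> 0"
    by (auto simp: open_halfspace_Re_gt convex_halfspace_Re_gt convex_connected zeta1_1)
  note ord = logderiv_order_limit[OF holomorphic_zeta1 S(1,2) _ S(3,4)]
  obtain m0 where m0: "((\<lambda>x::real. of_real x * (deriv zeta1 (1 + of_real x) / zeta1 (1 + of_real x))) \<longlongrightarrow> of_nat m0) (at_right 0)"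
    "m0 = 0" using ord[of 1] S by auto
  obtain m1 where m1: "((\<lambda>x::real. of_real x * (deriv zeta1 (s + of_real x) / zeta1 (s + of_real x))) \<longlongrightarrow> of_nat m1) (at_right 0)"
    "m1 \<ge> 1" using ord[of s] zero s by auto
  define s2 where "s2 = 1 + \<i> * of_real (2 * t)"
  obtain m2 where m2: "((\<lambda>x::real. of_real x * (deriv zeta1 (s2 + of_real x) / zeta1 (s2 + of_real x))) \<longlongrightarrow> of_nat m2) (at_right 0)"
    using ord[of s2] by (auto simp: s2_def)
  have pos: "\<forall>\<^sub>F x::real in at_right 0. x > 0" by (simp add: eventually_at_right_less)
  \<comment> \<open>The limit c records the pole of \<zeta>: it is 1 for w = 1 and 0 at the other
    points of the line.\<close>
  have L: "((\<lambda>x::real. of_real x * ?L (w + of_real x)) \<longlongrightarrow> c - of_nat m) (at_right 0)"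
    if lim: "((\<lambda>x::real. of_real x * (deriv zeta1 (w + of_real x) / zeta1 (w + of_real x))) \<longlongrightarrow> of_nat m) (at_right 0)"
    and w: "Re w = 1" and c: "((\<lambda>x::real. of_real x / (w + of_real x - 1)) \<longlongrightarrow> c) (at_right 0)" for w c m
  proof -
    have "((\<lambda>x::real. of_real x / (w + of_real x - 1) - of_real x * (deriv zeta1 (w + of_real x) / zeta1 (w + of_real x))) \<longlongrightarrow> c - of_nat m) (at_right 0)"
      by (intro tendsto_diff lim c)
    moreover have "\<forall>\<^sub>F x::real in at_right 0. of_real x / (w + of_real x - 1) - of_real x * (deriv zeta1 (w + of_real x) / zeta1 (w + of_real x))
        = of_real x * ?L (w + of_real x)"
      using pos
    proof eventually_elim
      case (elim x)
      have "?L (w + of_real x) = 1 / (w + of_real x - 1) - deriv zeta1 (w + of_real x) / zeta1 (w + of_real x)"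
        using w elim by (intro mangoldt_series_eq) auto
      then show ?case by (simp only: right_diff_distrib times_divide_eq_right mult_1_right)
    qed
    ultimately show ?thesis by (rule Lim_transform_eventually)
  qed
  have "((\<lambda>x::real. of_real x / (1 + of_real x - 1) :: complex) \<longlongrightarrow> 1) (at_right 0)"
  proof (rule tendsto_eventually)
    show "\<forall>\<^sub>F x::real in at_right 0. of_real x / (1 + of_real x - 1) = (1 :: complex)"
      using pos by eventually_elim auto
  qed
  from L[OF m0(1) _ this] have L0: "((\<lambda>x::real. of_real x * ?L (1 + of_real x)) \<longlongrightarrow> 1) (at_right 0)"
    using m0(2) by simp
  have c0: "((\<lambda>x::real. of_real x / (1 + \<i> * of_real u + of_real x - 1) :: complex) \<longlongrightarrow> 0) (at_right 0)" if "u \<noteq> 0" for u :: real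
    using that by (auto intro!: tendsto_eq_intros)
  have L1: "((\<lambda>x::real. of_real x * ?L (s + of_real x)) \<longlongrightarrow> - of_nat m1) (at_right 0)"
    using L[OF m1(1), of 0] c0[OF t] assms s by simp
  have L2: "((\<lambda>x::real. of_real x * ?L (s2 + of_real x)) \<longlongrightarrow> - of_nat m2) (at_right 0)"
    using L[OF m2(1), of 0] c0[of "2 * t"] t by (simp add: s2_def)
  have "((\<lambda>x::real. Re (3 * (of_real x * ?L (1 + of_real x)) + 4 * (of_real x * ?L (s + of_real x)) + of_real x * ?L (s2 + of_real x)))
      \<longlongrightarrow> Re (3 * 1 + 4 * (- of_nat m1) + - of_nat m2)) (at_right 0)"
    by (intro tendsto_intros L0 L1 L2)
  moreover have "\<forall>\<^sub>F x::real in at_right 0. 0 \<le> Re (3 * (of_real x * ?L (1 + of_real x)) + 4 * (of_real x * ?L (s + of_real x)) + of_real x * ?L (s2 + of_real x))"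
    using pos
  proof eventually_elim
    case elim: (elim x)
    have *: "3 * (of_real x * ?L (1 + of_real x)) + 4 * (of_real x * ?L (s + of_real x)) + of_real x * ?L (s2 + of_real x) =
       of_real x * (3 * ?L (1 + of_real x) + 4 * ?L (1 + \<i> * of_real t + of_real x) + ?L (1 + \<i> * of_real (2 * t) + of_real x))"
      by (simp only: s s2_def ring_distribs mult_ac)
    then have "0 \<le> x * Re (3 * ?L (1 + of_real x) + 4 * ?L (1 + \<i> * of_real t + of_real x) + ?L (1 + \<i> * of_real (2 * t) + of_real x))"
      using mangoldt_series_3_4_1[OF elim, of t] elim by (intro mult_nonneg_nonneg) auto
    then show ?case unfolding * by (simp only: Re_complex_of_real_mult)
  qed
  ultimately have "0 \<le> Re (3 * 1 + 4 * (- of_nat m1) + - of_nat m2)"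
    by (rule tendsto_lowerbound) auto
  then show False using m1(2) by simp
qed

lemma zeta1_nonzero:
  assumes "Re s \<ge> 1"
  shows "zeta1 s \<noteq> 0"
  using assms zeta1_nonzero_gt_1[of s] zeta1_nonzero_line[of s] by linarith

section \<open>The sum of moebius n / n\<close>

lemma powr_mean_value:
  assumes "n > 0" "u \<noteq> 0"
  obtains z where "real n < z" "z < real (Suc n)" "(real (Suc n) powr u - real n powr u) / u = z powr (u - 1)"
proof -
  have "\<exists>z>real n. z < real (Suc n) \<and> real (Suc n) powr u / u - real n powr u / u = (real (Suc n) - real n) * z powr (u - 1)"
    using assms by (intro MVT2) (auto intro!: derivative_eq_intros simp: powr_diff)
  then show ?thesis using that by (auto simp: diff_divide_distrib)
qed

lemma powr_diff_ge:
  assumes "n > 0" "u \<noteq> 0" "u \<le> 1"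
  shows "real (Suc n) powr (u - 1) \<le> (real (Suc n) powr u - real n powr u) / u"
proof -
  obtain z where "real n < z" "z < real (Suc n)" "(real (Suc n) powr u - real n powr u) / u = z powr (u - 1)"
    using powr_mean_value assms by blast
  then show ?thesis using assms by (auto intro!: powr_mono2')
qed

lemma powr_diff_ge':
  assumes "n > 0" "u \<ge> 1"
  shows "real n powr (u - 1) \<le> (real (Suc n) powr u - real n powr u) / u"
proof -
  obtain z where "real n < z" "z < real (Suc n)" "(real (Suc n) powr u - real n powr u) / u = z powr (u - 1)"
    using powr_mean_value[of n u] assms by auto
  then show ?thesis using assms by (auto intro!: powr_mono2)
qed

text \<open>For u \<le> 1 the summand decreases and the integral alone bounds the sum; for u > 1 it
  increases and the last term is added.\<close>

lemma sum_powr_le: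
  assumes "u > 0" "N \<ge> 1"
  shows "(\<Sum>n=1..N. real n powr (u - 1)) \<le> real N powr u / u + real N powr (u - 1)"
proof (cases "u \<le> 1")
  case True
  have "(\<Sum>n=1..N. real n powr (u - 1)) \<le> real N powr u / u"
    using \<open>N \<ge> 1\<close>
  proof (induction N rule: dec_induct)
    case base
    then show ?case using True assms by simp
  next
    case (step n)
    then show ?case using powr_diff_ge[of n u] True assms by (simp add: diff_divide_distrib)
  qed
  then show ?thesis by (simp add: add_increasing2)
next
  case False
  show ?thesis using \<open>N \<ge> 1\<close>
  proof (induction N rule: dec_induct)
    case base
    then show ?case using assms by simp
  next
    case (step n)
    then show ?case using powr_diff_ge'[of n u] False by (simp add: diff_divide_distrib)
  qed
qed

lemma sum_powr_tail_le:
  assumes "x > 0" "N \<ge> 1" "M \<ge> N"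
  shows "(\<Sum>n=Suc N..M. real n powr (- 1 - x)) \<le> (real N powr (-x) - real M powr (-x)) / x"
  using \<open>M \<ge> N\<close>
proof (induction M rule: dec_induct)
  case (step n)
  have "real (Suc n) powr (- 1 - x) \<le> (real n powr (-x) - real (Suc n) powr (-x)) / x"
  proof -
    have e: "- 1 - x = - x - 1" by simp
    show ?thesis unfolding e using powr_diff_ge[of n "-x"] step.hyps assms by (simp add: field_simps)
  qed
  with step show ?case by (simp add: diff_divide_distrib)
qed auto

text \<open>Comparison with the integral of x^(-1 - Re z). The factor 1 / Re z blows up at the
  imaginary axis; the kernel on the circle has to cancel it.\<close>

lemma dirichlet_tail_bound:
  fixes a :: "nat \<Rightarrow> complex"
  assumes a: "\<And>n. norm (a n) \<le> 1" and x: "Re z > 0" and N: "N \<ge> 1"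
  shows "norm ((\<Sum>n. a n * of_nat n powr (-(1 + z))) - (\<Sum>n=1..N. a n * of_nat n powr (-(1 + z)))) \<le> real N powr (- Re z) / Re z"
proof -
  let ?f = "\<lambda>n. a n * of_nat n powr (-(1 + z))"
  have "?f sums (\<Sum>n. ?f n)"
    using x a by (intro summable_sums summable_norm_cancel[OF summable_bounded_dirichlet]) auto
  then have lim: "(\<lambda>M. (\<Sum>n\<le>M. ?f n) - (\<Sum>n=1..N. ?f n)) \<longlonglongrightarrow> (\<Sum>n. ?f n) - (\<Sum>n=1..N. ?f n)"
    by (intro tendsto_diff tendsto_const) (simp add: sums_def_le)
  have "norm ((\<Sum>n\<le>M. ?f n) - (\<Sum>n=1..N. ?f n)) \<le> real N powr (- Re z) / Re z" if "M \<ge> N" for M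
  proof -
    have "(\<Sum>n\<le>M. ?f n) = (\<Sum>n=1..M. ?f n)"
      by (intro sum.mono_neutral_right) (auto simp: not_le)
    also have "\<dots> = (\<Sum>n=1..N. ?f n) + (\<Sum>n=Suc N..M. ?f n)"
      using that N by (subst sum.union_disjoint[symmetric]) (auto intro!: sum.cong)
    finally have "(\<Sum>n\<le>M. ?f n) - (\<Sum>n=1..N. ?f n) = (\<Sum>n=Suc N..M. ?f n)" by simp
    also have "norm \<dots> \<le> (\<Sum>n=Suc N..M. real n powr (- 1 - Re z))"
    proof (rule sum_norm_le)
      fix n
      have "norm (a n) * real n powr (- 1 - Re z) \<le> 1 * real n powr (- 1 - Re z)"
        by (intro mult_right_mono a) auto
      then show "norm (?f n) \<le> real n powr (- 1 - Re z)" by (simp add: norm_mult norm_of_nat_powr)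
    qed
    also have "\<dots> \<le> (real N powr (- Re z) - real M powr (- Re z)) / Re z"
      using x N that by (intro sum_powr_tail_le) auto
    also have "\<dots> \<le> real N powr (- Re z) / Re z"
      using x by (simp add: divide_right_mono)
    finally show ?thesis .
  qed
  then show ?thesis
    by (intro tendsto_upperbound[OF tendsto_norm[OF lim]]) (auto simp: eventually_sequentially)
qed

text \<open>The exponential is N^z, of modulus N^(Re z). Since a may lie on the imaginary axis,
  where nothing decays, the segment is cut at the parameter \<eta>: the first piece has length
  O(\<eta>), and on the second Re z \<le> \<eta> Re b < 0.\<close>

lemma contour_integral_linepath_exp_tendsto_0:
  fixes a b :: complex
  assumes g: "continuous_on (closed_segment a b) g" and a: "Re a \<le> 0" and b: "Re b < 0"
  shows "(\<lambda>N::nat. contour_integral (linepath a b) (\<lambda>z. g z * exp (of_real (ln N) * z))) \<longlonglongrightarrow> 0"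
proof -
  have "compact (g ` closed_segment a b)" using g by (rule compact_continuous_image) auto
  then obtain M where M: "M > 0" "\<And>z. z \<in> closed_segment a b \<Longrightarrow> norm (g z) \<le> M"
    by (auto dest!: compact_imp_bounded simp: bounded_pos)
  define L where "L = M * norm (b - a) + 1"
  have L: "L \<ge> 1" using M by (simp add: L_def)
  have main: "norm (contour_integral (linepath a b) (\<lambda>z. g z * exp (of_real (ln N) * z))) \<le> L * \<eta> + L * N powr (\<eta> * Re b)"
    if \<eta>: "0 < \<eta>" "\<eta> \<le> 1" and N: "N \<ge> 1" for \<eta> :: real and N :: nat
  proof -
    let ?f = "\<lambda>z. g z * exp (of_real (ln N) * z)"
    define c where "c = linepath a b \<eta>"
    have c: "c \<in> closed_segment a b"
      using \<eta> by (auto simp: c_def linepath_image_01[symmetric])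
    have Rec: "Re c \<le> \<eta> * Re b"
      using a \<eta> by (simp add: c_def linepath_def mult_nonneg_nonpos)
    have sub: "closed_segment a c \<subseteq> closed_segment a b" "closed_segment c b \<subseteq> closed_segment a b"
      using c by (auto simp: subset_closed_segment)
    have contf: "continuous_on (closed_segment a b) ?f" by (intro continuous_intros g)
    have norm_exp: "norm (exp (of_real (ln N) * z)) = N powr Re z" for z
      using N by (simp add: powr_def)
    have "norm (contour_integral (linepath a c) ?f) \<le> M * norm (c - a)"
    proof (rule contour_integral_bound_linepath)
      show "?f contour_integrable_on linepath a c"
        using contf sub by (intro contour_integrable_continuous_linepath) (auto intro: continuous_on_subset)
      fix z assume z: "z \<in> closed_segment a c"
      then obtain u where u: "0 \<le> u" "u \<le> 1" "z = (1 - u) *\<^sub>R a + u *\<^sub>R c" by (auto simp: in_segment)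
      have "Re c \<le> 0" using Rec b \<eta> by (smt (verit) mult_nonneg_nonpos)
      then have "Re z \<le> 0" using u a by (auto intro!: add_nonpos_nonpos mult_nonneg_nonpos)
      then have "N powr Re z \<le> N powr 0" using N by (intro powr_mono) auto
      then have "norm (?f z) \<le> M * 1"
        unfolding norm_mult norm_exp using M z sub N by (intro mult_mono) auto
      then show "norm (?f z) \<le> M" by simp
    qed (use M in auto)
    also have "norm (c - a) = \<eta> * norm (b - a)"
    proof -
      have "c - a = \<eta> *\<^sub>R (b - a)" by (simp add: c_def linepath_def algebra_simps)
      then show ?thesis using \<eta> by simp
    qed
    finally have 1: "norm (contour_integral (linepath a c) ?f) \<le> L * \<eta>"
      using \<eta> by (simp add: L_def algebra_simps)
    have "norm (contour_integral (linepath c b) ?f) \<le> (M * N powr (\<eta> * Re b)) * norm (b - c)"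
    proof (rule contour_integral_bound_linepath)
      show "?f contour_integrable_on linepath c b"
        using contf sub by (intro contour_integrable_continuous_linepath) (auto intro: continuous_on_subset)
      fix z assume z: "z \<in> closed_segment c b"
      then obtain u where u: "0 \<le> u" "u \<le> 1" "z = (1 - u) *\<^sub>R c + u *\<^sub>R b" by (auto simp: in_segment)
      have Reb: "Re b \<le> \<eta> * Re b" using b \<eta> by (smt (verit) mult_le_cancel_right1)
      have "Re z \<le> (1 - u) * (\<eta> * Re b) + u * (\<eta> * Re b)"
        using u Rec Reb by (auto intro!: add_mono mult_left_mono)
      also have "\<dots> = \<eta> * Re b" by (simp add: algebra_simps)
      finally have "N powr Re z \<le> N powr (\<eta> * Re b)" using N by (intro powr_mono) auto
      then show "norm (?f z) \<le> M * N powr (\<eta> * Re b)"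
        unfolding norm_mult norm_exp using M z sub by (intro mult_mono) auto
    qed (use M in auto)
    also have "\<dots> \<le> (M * N powr (\<eta> * Re b)) * norm (b - a)"
    proof -
      have "b - c = (1 - \<eta>) *\<^sub>R (b - a)" by (simp add: c_def linepath_def algebra_simps)
      then have "norm (b - c) \<le> norm (b - a)" using \<eta> by (simp add: mult_left_le_one_le)
      then show ?thesis using M by (intro mult_left_mono) auto
    qed
    also have "\<dots> \<le> L * N powr (\<eta> * Re b)" by (simp add: L_def algebra_simps)
    finally have 2: "norm (contour_integral (linepath c b) ?f) \<le> L * N powr (\<eta> * Re b)" .
    have "contour_integral (linepath a b) ?f = contour_integral (linepath a c) ?f + contour_integral (linepath c b) ?f"
      by (rule contour_integral_split_linepath[OF contf c])
    then show ?thesis using norm_triangle_mono[OF 1 2] by simp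
  qed
  show ?thesis
  proof (rule tendstoI)
    fix e :: real assume e: "e > 0"
    define \<eta> where "\<eta> = min 1 (e / (2 * L))"
    have \<eta>: "0 < \<eta>" "\<eta> \<le> 1" "L * \<eta> \<le> e / 2" using e L by (auto simp: \<eta>_def min_def field_simps)
    have "\<eta> * Re b < 0" using \<eta> b by (simp add: mult_pos_neg)
    then have "(\<lambda>N::nat. L * N powr (\<eta> * Re b)) \<longlonglongrightarrow> 0" by real_asymp
    then have "\<forall>\<^sub>F N::nat in sequentially. L * N powr (\<eta> * Re b) < e / 2"
      using e by (intro order_tendstoD(2)) auto
    then show "\<forall>\<^sub>F N::nat in sequentially. dist (contour_integral (linepath a b) (\<lambda>z. g z * exp (of_real (ln N) * z))) 0 < e"
      using eventually_ge_at_top[of 1]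
    proof eventually_elim
      case (elim N)
      then show ?case using main[OF \<eta>(1,2) elim(2)] \<eta>(3) by simp
    qed
  qed
qed

text \<open>The segment from 1 - iR to 1 + iR is compact and free of zeros, hence so is an
  e-neighbourhood of it; to the right the half-plane Re s \<ge> 1 takes over. The cap 1/2 keeps 1 +
  z inside Re s > 0.\<close>

lemma zeta1_nonzero_strip:
  assumes "R > 0"
  obtains \<delta> where "0 < \<delta>" "\<delta> < 1" "\<And>z. Re z > - \<delta> \<Longrightarrow> \<bar>Im z\<bar> < R \<Longrightarrow> zeta1 (1 + z) \<noteq> 0"
proof -
  define K where "K = (\<lambda>y. \<i> * complex_of_real y) ` {-R..R}"
  define T where "T = {z. Re z > -1}"
  have "compact K" unfolding K_def by (intro compact_continuous_image continuous_intros) auto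
  have "(\<lambda>z. zeta1 (1 + z)) holomorphic_on T"
    by (rule holomorphic_on_compose_gen[OF _ holomorphic_zeta1, unfolded o_def])
       (auto simp: T_def intro!: holomorphic_intros)
  then have "continuous_on T (\<lambda>z. zeta1 (1 + z))" by (rule holomorphic_on_imp_continuous_on)
  moreover have oT: "open T" by (simp add: T_def open_halfspace_Re_gt)
  ultimately have "open (T \<inter> (\<lambda>z. zeta1 (1 + z)) -` (- {0}))"
    by (intro continuous_open_preimage) auto
  moreover have "K \<subseteq> T \<inter> (\<lambda>z. zeta1 (1 + z)) -` (- {0})"
    by (auto simp: K_def T_def zeta1_nonzero)
  ultimately obtain e where e: "e > 0" "(\<Union>x\<in>K. ball x e) \<subseteq> T \<inter> (\<lambda>z. zeta1 (1 + z)) -` (- {0})"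
    using compact_subset_open_imp_ball_epsilon_subset[OF \<open>compact K\<close>] by metis
  show ?thesis
  proof (rule that[of "min e (1/2)"])
    fix z assume z: "Re z > - min e (1/2)" "\<bar>Im z\<bar> < R"
    show "zeta1 (1 + z) \<noteq> 0"
    proof (cases "Re z \<ge> 0")
      case True
      then show ?thesis by (intro zeta1_nonzero) auto
    next
      case False
      have "\<i> * complex_of_real (Im z) - z = of_real (- Re z)" by (simp add: complex_eq_iff)
      then have "dist (\<i> * complex_of_real (Im z)) z < e" using False z by (simp add: dist_norm)
      moreover have "\<i> * complex_of_real (Im z) \<in> K" using z by (auto simp: K_def intro!: image_eqI[of _ _ "Im z"])
      ultimately have "z \<in> (\<Union>x\<in>K. ball x e)" by (intro UN_I) (auto simp: mem_ball)
      then show ?thesis using subsetD[OF e(2)] by blast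
    qed
  qed (use e in auto)
qed

text \<open>On the circle, z times its conjugate is R^2, so 1 / z + z / R^2 is a multiple of a real
  part. The resulting factor Re z cancels the singular factor at the imaginary axis in both the tail
  estimate and the partial sum estimate.\<close>

lemma newman_kernel:
  assumes "norm z = R" "R > 0"
  shows "(1 + z\<^sup>2 / of_real R ^ 2) / z = of_real (2 * Re z / R\<^sup>2)"
proof -
  have z: "z \<noteq> 0" using assms by auto
  have "z * cnj z = of_real R ^ 2" using assms complex_norm_square[of z] by simp
  then have "1 + z\<^sup>2 / of_real R ^ 2 = z * (cnj z + z) / of_real R ^ 2"
    using assms by (simp add: field_simps power2_eq_square)
  also have "cnj z + z = of_real (2 * Re z)" by (simp add: complex_eq_iff)
  finally show ?thesis using z by simp
qed

text \<open>Each arc contributes i times its angle. The circle is cut at iR and -iR because its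
  right and left halves are estimated differently.\<close>

lemma winding_number_two_arcs:
  assumes "R > 0"
  shows "winding_number (part_circlepath 0 R (-(pi/2)) (pi/2) +++ part_circlepath 0 R (pi/2) (3*pi/2)) 0 = 1"
proof -
  have ci: "((\<lambda>w. 1 / (w - 0)) has_contour_integral (\<i> * of_real (b - a))) (part_circlepath 0 R a b)" if "a < b" for a b
  proof -
    have "((\<lambda>t. \<i>) has_integral (\<i> * of_real (b - a))) {a..b}"
      using has_integral_const_real[of \<i> a b] that by (simp add: scaleR_conv_of_real mult.commute)
    moreover have eq: "1 / (0 + of_real R * cis t - 0) * of_real R * \<i> * cis t = \<i>" for t
      using assms by (simp add: cis_neq_zero)
    ultimately show ?thesis unfolding has_contour_integral_part_circlepath_iff[OF that] eq by simp
  qed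
  have "((\<lambda>w. 1 / (w - 0)) has_contour_integral (\<i> * of_real (pi/2 - (-(pi/2))) + \<i> * of_real (3*pi/2 - pi/2)))
     (part_circlepath 0 R (-(pi/2)) (pi/2) +++ part_circlepath 0 R (pi/2) (3*pi/2))"
    by (intro has_contour_integral_join ci) auto
  moreover have "\<i> * of_real (pi/2 - (-(pi/2))) + \<i> * of_real (3*pi/2 - pi/2) = 2 * of_real pi * \<i>"
    by (simp add: complex_eq_iff)
  ultimately have "contour_integral (part_circlepath 0 R (-(pi/2)) (pi/2) +++ part_circlepath 0 R (pi/2) (3*pi/2)) (\<lambda>w. 1 / (w - 0)) = 2 * of_real pi * \<i>"
    by (metis contour_integral_unique)
  moreover have "0 \<notin> path_image (part_circlepath 0 R (-(pi/2)) (pi/2) +++ part_circlepath 0 R (pi/2) (3*pi/2))"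
    using assms path_image_join_subset in_path_image_part_circlepath[of 0 0 R] by (fastforce simp: )
  ultimately show ?thesis by (subst winding_number_valid_path) (auto intro!: valid_path_join)
qed

text \<open>Newman's contour argument for \<open>1 / \<zeta>(1 + z)\<close>, which vanishes at \<open>0\<close>: the circle of radius \<open>R\<close> is used for
  the entire partial sums, and its left half is pushed to a rectangle in the zero-free region for the full series, where
  the factor \<open>N\<^sup>z\<close> makes the integral tend to \<open>0\<close>.\<close>

lemma moebius_partial_sum_bound:
  assumes R: "R > 0"
  shows "\<forall>\<^sub>F N in sequentially. norm (\<Sum>n=1..N. of_int (moebius n) / of_nat n :: complex) \<le> 4 / R"
proof -
  define c1 where "c1 = part_circlepath 0 R (-(pi/2)) (pi/2)"
  define c2 where "c2 = part_circlepath 0 R (pi/2) (3*pi/2)"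
  define a where "a n = complex_of_int (moebius n)" for n
  have a_le: "norm (a n) \<le> 1" for n by (simp add: a_def norm_of_int abs_real_moebius_le_1)
  define S where "S N z = (\<Sum>n=1..N. a n * of_nat n powr (-(1 + z)))" for N z
  define E where "E N z = exp (of_real (ln (real N)) * z)" for N :: nat and z :: complex
  define k where "k z = 1 + z\<^sup>2 / of_real R ^ 2" for z :: complex
  \<comment> \<open>The series of \<mu> at 1 + z is z H(z), so division by z leaves a function
    holomorphic at 0, and \<open>h\<close> integrates to 0 around a closed contour. The partial sum,
    by contrast, leaves the residue \<open>S N 0\<close>.\<close>
  define H where "H z = 1 / zeta1 (1 + z)" for z
  have k0: "k 0 = 1" and E0: "E N 0 = 1" for N by (auto simp: k_def E_def)
  have norm_E: "norm (E N z) = N powr Re z" if "N \<ge> 1" for N z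
    using that by (simp add: powr_def E_def)
  obtain \<delta> where \<delta>: "0 < \<delta>" "\<delta> < 1" "\<And>z. Re z > - \<delta> \<Longrightarrow> \<bar>Im z\<bar> < R + 1 \<Longrightarrow> zeta1 (1 + z) \<noteq> 0"
    using zeta1_nonzero_strip[of "R + 1"] R by auto
  define U where "U = {z. Re z > - \<delta>} \<inter> {z. Im z < R + 1} \<inter> {z. Im z > - (R + 1)}"
  have U: "convex U" unfolding U_def
    by (intro convex_Int convex_halfspace_Re_gt convex_halfspace_Im_gt convex_halfspace_Im_lt)
  have hH: "H holomorphic_on U"
  proof -
    have "(\<lambda>z. zeta1 (1 + z)) holomorphic_on U"
      by (rule holomorphic_on_compose_gen[OF _ holomorphic_zeta1, unfolded o_def])
         (use \<delta> in \<open>auto simp: U_def intro!: holomorphic_intros\<close>)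
    then show ?thesis unfolding H_def[abs_def] using \<delta> by (intro holomorphic_intros) (auto simp: U_def)
  qed
  have hS: "S N holomorphic_on A" for N A unfolding S_def[abs_def]
    by (intro holomorphic_intros) auto
  have hE: "E N holomorphic_on A" for N A unfolding E_def[abs_def] by (intro holomorphic_intros)
  have hk: "k holomorphic_on A" for A unfolding k_def[abs_def] using R by (intro holomorphic_intros) auto
  \<comment> \<open>The left side of the rectangle with corners p, q, q', p' runs strictly inside
    the zero-free strip.\<close>
  define d where "d = \<delta> / 2"
  have d: "0 < d" "d < \<delta>" using \<delta> by (auto simp: d_def)
  define p where "p = Complex 0 R"
  define q where "q = Complex (- d) R"
  define q' where "q' = Complex (- d) (- R)"
  define p' where "p' = Complex 0 (- R)"
  have sub: "closed_segment p q \<subseteq> U" "closed_segment q q' \<subseteq> U" "closed_segment q' p' \<subseteq> U"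
  proof -
    have "p \<in> U" "q \<in> U" "q' \<in> U" "p' \<in> U"
      using d R \<delta> by (auto simp: p_def q_def p'_def q'_def U_def)
    then show "closed_segment p q \<subseteq> U" "closed_segment q q' \<subseteq> U" "closed_segment q' p' \<subseteq> U"
      by (simp_all add: closed_segment_subset U)
  qed
  have im1: "norm z = R \<and> Re z \<ge> 0" if zc: "z \<in> path_image c1" for z
  proof -
    obtain t where t: "z = of_real R * exp (\<i> * of_real t)" "-(pi/2) \<le> t" "t \<le> pi/2"
      using zc R by (auto simp: c1_def path_image_part_circlepath)
    then have "cos t \<ge> 0" by (intro cos_ge_zero) auto
    then show ?thesis using t R by (simp add: Re_exp norm_mult)
  qed
  have im2: "norm z = R \<and> Re z \<le> 0" if zc: "z \<in> path_image c2" for z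
  proof -
    obtain t where t: "z = of_real R * exp (\<i> * of_real t)" "pi/2 \<le> t" "t \<le> 3*pi/2"
      using zc R by (auto simp: c2_def path_image_part_circlepath)
    have "cos (t - pi) \<ge> 0" using t by (intro cos_ge_zero) auto
    then have "cos t \<le> 0" by (simp add: cos_diff)
    then show ?thesis using t R by (simp add: Re_exp norm_mult mult_nonneg_nonpos)
  qed
  have subc1: "path_image c1 \<subseteq> U"
  proof
    fix z assume "z \<in> path_image c1"
    then show "z \<in> U" using im1[of z] abs_Im_le_cmod[of z] R \<delta> by (auto simp: U_def)
  qed
  have ends: "pathstart c1 = p'" "pathfinish c1 = p" "pathstart c2 = p" "pathfinish c2 = p'"
  proof -
    have e: "exp (\<i> * of_real x) = Complex (cos x) (sin x)" for x :: real
      by (simp add: complex_eq_iff Re_exp Im_exp)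
    have "3 * pi / 2 = 3 / 2 * pi" by simp
    then have "cos (3 * pi / 2) = 0" "sin (3 * pi / 2) = -1" by (simp_all only: cos_3over2_pi sin_3over2_pi)
    then show "pathstart c1 = p'" "pathfinish c1 = p" "pathstart c2 = p" "pathfinish c2 = p'"
      unfolding c1_def c2_def pathstart_part_circlepath pathfinish_part_circlepath e
      by (auto simp: p_def p'_def complex_eq_iff)
  qed
  have vp: "valid_path c1" "valid_path c2" by (auto simp: c1_def c2_def)
  have nz: "z \<noteq> 0" if "z \<in> path_image c1 \<union> path_image c2" for z
    using that im1 im2 R by force
  define f where "f N z = S N z * E N z * k z" for N z
  define h where "h N z = H z * k z * E N z" for N z
  have f_int: "(\<lambda>w. f N w / w) contour_integrable_on c1" "(\<lambda>w. f N w / w) contour_integrable_on c2" for N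
  proof -
    have "continuous_on A (f N)" for A
      unfolding f_def[abs_def] by (intro holomorphic_on_imp_continuous_on holomorphic_intros hS hE hk)
    then show "(\<lambda>w. f N w / w) contour_integrable_on c1" "(\<lambda>w. f N w / w) contour_integrable_on c2"
      using nz by (auto simp: c1_def c2_def intro!: contour_integrable_continuous_part_circlepath continuous_intros)
  qed
  have hh: "h N holomorphic_on U" for N
    unfolding h_def[abs_def] by (intro holomorphic_intros hH hE hk)
  note hcont = holomorphic_on_imp_continuous_on[OF hh]
  have h_int: "h N contour_integrable_on c1" for N
    unfolding c1_def using subc1 continuous_on_subset[OF hcont]
    by (intro contour_integrable_continuous_part_circlepath) (auto simp: c1_def)
  \<comment> \<open>The partial sum is entire, so the full circle is available; it picks out the
    value at 0, where N^z and the kernel \<open>k\<close> are 1.\<close>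
  have circle: "contour_integral c1 (\<lambda>w. f N w / w) + contour_integral c2 (\<lambda>w. f N w / w) = 2 * of_real pi * \<i> * S N 0" for N
  proof -
    have "((\<lambda>w. f N w / (w - 0)) has_contour_integral (of_real (2 * pi) * \<i> * winding_number (c1 +++ c2) 0 * f N 0)) (c1 +++ c2)"
    proof (rule Cauchy_integral_formula_convex_simple[of UNIV])
      show "f N holomorphic_on UNIV" unfolding f_def[abs_def] by (intro holomorphic_intros hS hE hk)
      show "path_image (c1 +++ c2) \<subseteq> UNIV - {0}" using nz ends by (auto simp: path_image_join)
    qed (use ends vp in \<open>auto intro!: valid_path_join\<close>)
    then have "contour_integral (c1 +++ c2) (\<lambda>w. f N w / w) = 2 * of_real pi * \<i> * S N 0"
      using winding_number_two_arcs[OF R] by (simp add: contour_integral_unique c1_def c2_def f_def k0 E0)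
    then show ?thesis using vp f_int ends by (simp add: contour_integral_join)
  qed
  define left where "left = linepath p q +++ linepath q q' +++ linepath q' p'"
  have lin: "h N contour_integrable_on linepath p q" "h N contour_integrable_on linepath q q'"
     "h N contour_integrable_on linepath q' p'" for N
    using sub continuous_on_subset[OF hcont] by (auto intro!: contour_integrable_continuous_linepath)
  have cauchy: "contour_integral c1 (h N) + (contour_integral (linepath p q) (h N) +
        (contour_integral (linepath q q') (h N) + contour_integral (linepath q' p') (h N))) = 0" for N
  proof -
    have "(h N has_contour_integral 0) (c1 +++ left)"
    proof (rule Cauchy_theorem_convex_simple[OF hh U])
      show "path_image (c1 +++ left) \<subseteq> U" using ends subc1 sub by (auto simp: left_def path_image_join)
    qed (use ends vp in \<open>auto intro!: valid_path_join simp: left_def\<close>)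
    then have "contour_integral (c1 +++ left) (h N) = 0" by (rule contour_integral_unique)
    then show ?thesis using vp h_int lin ends unfolding left_def
      by (simp add: contour_integral_join contour_integrable_join valid_path_join)
  qed
  \<comment> \<open>Tail N^(-Re z) / Re z, factor N^(Re z) and kernel 2 Re z / R^2 multiply to 2 /
    R^2, and the arc has length pi R. The end points p and p', where Re z = 0 and the tail bound
    fails, are exempted.\<close>
  have B1: "norm (contour_integral c1 (\<lambda>w. f N w / w - h N w)) \<le> 2 * pi / R" if N: "N \<ge> 1" for N
  proof -
    have "norm (contour_integral (part_circlepath 0 R (-(pi/2)) (pi/2)) (\<lambda>w. f N w / w - h N w)) \<le> (2 / R\<^sup>2) * R * (pi/2 - (-(pi/2)))"
    proof (rule contour_integral_bound_part_circlepath_strong[where k = "{p, p'}"])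
      show "(\<lambda>w. f N w / w - h N w) contour_integrable_on part_circlepath 0 R (-(pi/2)) (pi/2)"
        using contour_integrable_diff[OF f_int(1) h_int] by (simp add: c1_def)
      fix z assume z: "z \<in> path_image (part_circlepath 0 R (-(pi/2)) (pi/2)) - {p, p'}"
      then have z1: "norm z = R" "Re z \<ge> 0" using im1 by (auto simp: c1_def)
      have Rez: "Re z > 0"
      proof (rule ccontr)
        assume "\<not> Re z > 0"
        then have "Re z = 0" using z1 by simp
        moreover from this have "\<bar>Im z\<bar> = R" using z1(1) by (simp add: cmod_def)
        ultimately have "z = p \<or> z = p'" by (auto simp: p_def p'_def complex_eq_iff abs_if split: if_splits)
        then show False using z by auto
      qed
      have z0: "z \<noteq> 0" using Rez by auto
      have series: "(\<Sum>n. a n * of_nat n powr (-(1 + z))) = z * H z"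
        using moebius_series[of "1 + z"] zeta1_nonzero[of "1 + z"] Rez by (simp add: a_def H_def field_simps)
      have "f N z / z - h N z = (S N z - z * H z) * E N z * (k z / z)"
        using z0 by (simp add: f_def h_def field_simps)
      also have "norm \<dots> = norm (z * H z - S N z) * real N powr Re z * (2 * Re z / R\<^sup>2)"
      proof -
        have "norm (k z / z) = 2 * Re z / R\<^sup>2"
          unfolding k_def newman_kernel[OF z1(1) R] norm_of_real using Rez by simp
        then show ?thesis by (simp only: norm_mult norm_E[OF N] norm_minus_commute)
      qed
      also have "\<dots> \<le> (real N powr (- Re z) / Re z) * real N powr Re z * (2 * Re z / R\<^sup>2)"
        using dirichlet_tail_bound[of a z N, OF a_le Rez N] Rez unfolding series S_def
        by (intro mult_right_mono) auto
      also have "\<dots> = 2 / R\<^sup>2"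
        using Rez N by (simp add: powr_minus field_simps)
      finally show "norm (f N z / z - h N z) \<le> 2 / R\<^sup>2" .
    qed (use R in auto)
    also have "(2 / R\<^sup>2) * R * (pi/2 - (-(pi/2))) = 2 * pi / R" using R by (simp add: power2_eq_square field_simps)
    finally show ?thesis by (simp add: c1_def)
  qed
  \<comment> \<open>Here the partial sum itself is bounded, by N^u / u + N^(u - 1) with u = - Re z.
    Against N^(-u) 2 u / R^2 the first term again gives 2 / R^2, and the second a term that vanishes
    as N grows.\<close>
  have B2: "norm (contour_integral c2 (\<lambda>w. f N w / w)) \<le> 2 * pi / R + 2 * pi / N" if N: "N \<ge> 1" for N
  proof -
    have "norm (contour_integral (part_circlepath 0 R (pi/2) (3*pi/2)) (\<lambda>w. f N w / w)) \<le> (2 / R\<^sup>2 + 2 / (N * R)) * R * (3*pi/2 - pi/2)"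
    proof (rule contour_integral_bound_part_circlepath_strong[where k = "{}"])
      show "(\<lambda>w. f N w / w) contour_integrable_on part_circlepath 0 R (pi/2) (3*pi/2)"
        using f_int(2) by (simp add: c2_def)
      fix z assume z: "z \<in> path_image (part_circlepath 0 R (pi/2) (3*pi/2)) - {}"
      then have z1: "norm z = R" "Re z \<le> 0" using im2 by (auto simp: c2_def)
      define u where "u = - Re z"
      have u: "u \<ge> 0" "u \<le> R" using z1 abs_Re_le_cmod[of z] by (auto simp: u_def)
      have nk: "norm (k z / z) = 2 * u / R\<^sup>2"
        unfolding k_def newman_kernel[OF z1(1) R] norm_of_real using z1 by (simp add: u_def)
      have eq: "norm (f N z / z) = norm (S N z) * real N powr (- u) * (2 * u / R\<^sup>2)"
      proof -
        have "f N z / z = S N z * E N z * (k z / z)" by (simp add: f_def)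
        then show ?thesis by (simp only: norm_mult norm_E[OF N] nk) (simp add: u_def)
      qed
      show "norm (f N z / z) \<le> 2 / R\<^sup>2 + 2 / (N * R)"
      proof (cases "u = 0")
        case True
        then have "norm (f N z / z) = 0" unfolding eq by simp
        moreover have "0 \<le> 2 / R\<^sup>2 + 2 / (N * R)" using R by simp
        ultimately show ?thesis by linarith
      next
        case False
        have "norm (S N z) \<le> (\<Sum>n=1..N. real n powr (u - 1))"
          unfolding S_def
        proof (rule sum_norm_le)
          fix n
          have "norm (a n) * real n powr (u - 1) \<le> 1 * real n powr (u - 1)"
            by (intro mult_right_mono a_le) auto
          moreover have "Re (-(1 + z)) = u - 1" by (simp add: u_def)
          ultimately show "norm (a n * of_nat n powr (-(1 + z))) \<le> real n powr (u - 1)"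
            unfolding norm_mult norm_of_nat_powr by (simp only: mult_1_left)
        qed
        also have "\<dots> \<le> real N powr u / u + real N powr (u - 1)"
          using u False N by (intro sum_powr_le) auto
        finally have "norm (f N z / z) \<le> (real N powr u / u + real N powr (u - 1)) * real N powr (- u) * (2 * u / R\<^sup>2)"
          unfolding eq using u by (intro mult_right_mono) auto
        also have "\<dots> = 2 / R\<^sup>2 + 2 * u / (N * R\<^sup>2)"
          using u False N R by (simp add: powr_minus powr_diff field_simps)
        also have "2 * u / (N * R\<^sup>2) \<le> 2 * R / (N * R\<^sup>2)"
          using u N R by (intro divide_right_mono) auto
        also have "2 * R / (N * R\<^sup>2) = 2 / (N * R)" using R by (simp add: power2_eq_square)
        finally show ?thesis by simp
      qed
    qed (use R in auto)
    also have "(2 / R\<^sup>2 + 2 / (N * R)) * R * (3*pi/2 - pi/2) = 2 * pi / R + 2 * pi / N"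
      using R N by (simp add: power2_eq_square field_simps)
    finally show ?thesis by (simp add: c2_def)
  qed
  have lim: "(\<lambda>N. norm (contour_integral (linepath p q) (h N)) + (norm (contour_integral (linepath q q') (h N)) +
      norm (contour_integral (linepath q' p') (h N)))) \<longlonglongrightarrow> 0"
  proof -
    have cont: "continuous_on A (\<lambda>z. H z * k z)" if "A \<subseteq> U" for A
      using that by (intro continuous_on_subset[OF holomorphic_on_imp_continuous_on[OF holomorphic_on_mult[OF hH hk]]])
    have 1: "(\<lambda>N. contour_integral (linepath p q) (h N)) \<longlonglongrightarrow> 0"
      unfolding h_def[abs_def] E_def
      using d by (intro contour_integral_linepath_exp_tendsto_0 cont sub) (auto simp: p_def q_def)
    have 2: "(\<lambda>N. contour_integral (linepath q q') (h N)) \<longlonglongrightarrow> 0"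
      unfolding h_def[abs_def] E_def
      using d by (intro contour_integral_linepath_exp_tendsto_0 cont sub) (auto simp: q'_def q_def)
    have "(\<lambda>N. contour_integral (linepath p' q') (h N)) \<longlonglongrightarrow> 0"
      unfolding h_def[abs_def] E_def
      using d sub by (intro contour_integral_linepath_exp_tendsto_0 cont) (auto simp: p'_def q'_def closed_segment_commute)
    moreover have "contour_integral (linepath q' p') (h N) = - contour_integral (linepath p' q') (h N)" for N
      using sub continuous_on_subset[OF hcont] by (intro contour_integral_reverse_linepath) auto
    ultimately have 3: "(\<lambda>N. contour_integral (linepath q' p') (h N)) \<longlonglongrightarrow> 0"
      using tendsto_minus[of _ "0 :: complex"] by fastforce
    show ?thesis using tendsto_add[OF tendsto_norm[OF 1] tendsto_add[OF tendsto_norm[OF 2] tendsto_norm[OF 3]]] by simp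
  qed
  have "(\<lambda>N. (norm (contour_integral (linepath p q) (h N)) + (norm (contour_integral (linepath q q') (h N)) +
      norm (contour_integral (linepath q' p') (h N)))) + 2 * pi / real N) \<longlonglongrightarrow> 0 + 0"
    by (intro tendsto_add lim) real_asymp
  \<comment> \<open>The two arcs give 4 pi / R; everything else is eventually below another 4 pi /
    R, and division by 2 pi turns the total into 4 / R.\<close>
  then have "\<forall>\<^sub>F N in sequentially. (norm (contour_integral (linepath p q) (h N)) + (norm (contour_integral (linepath q q') (h N)) +
      norm (contour_integral (linepath q' p') (h N)))) + 2 * pi / real N < 4 * pi / R"
    using R by (intro order_tendstoD(2)[where y = "0 + 0"]) auto
  then show ?thesis using eventually_ge_at_top[of 1]
  proof eventually_elim
    case (elim N)
    have diff: "contour_integral c1 (\<lambda>w. f N w / w - h N w) = contour_integral c1 (\<lambda>w. f N w / w) - contour_integral c1 (h N)"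
      by (rule contour_integral_diff[OF f_int(1) h_int])
    then have "2 * of_real pi * \<i> * S N 0 = contour_integral c1 (\<lambda>w. f N w / w - h N w) + contour_integral c2 (\<lambda>w. f N w / w)
       - (contour_integral (linepath p q) (h N) + (contour_integral (linepath q q') (h N) + contour_integral (linepath q' p') (h N)))"
    proof -
      have aux: "P = I + C - L" if "I = A - B" "A + C = P" "B + L = 0" for P I C L A B :: complex
      proof -
        have "L = - B" using that(3) by (simp add: eq_neg_iff_add_eq_0 add.commute)
        then show ?thesis using that(1,2) by simp
      qed
      show ?thesis by (rule aux[OF diff circle cauchy])
    qed
    then have "norm (2 * of_real pi * \<i> * S N 0) \<le> norm (contour_integral c1 (\<lambda>w. f N w / w - h N w)) + norm (contour_integral c2 (\<lambda>w. f N w / w))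
       + (norm (contour_integral (linepath p q) (h N)) + (norm (contour_integral (linepath q q') (h N)) + norm (contour_integral (linepath q' p') (h N))))"
      by (simp only:) (rule order_trans[OF norm_triangle_ineq4 add_mono[OF norm_triangle_ineq
            order_trans[OF norm_triangle_ineq add_left_mono[OF norm_triangle_ineq]]]])
    also have "\<dots> \<le> 2 * pi / R + 2 * pi / R + 4 * pi / R"
      using B1[OF elim(2)] B2[OF elim(2)] elim(1) by linarith
    finally have "norm (S N 0) * (2 * pi) \<le> 4 / R * (2 * pi)" by (simp add: norm_mult mult_ac)
    then have "norm (S N 0) \<le> 4 / R" by (rule mult_right_le_imp_le) auto
    moreover have "S N 0 = (\<Sum>n=1..N. of_int (moebius n) / of_nat n)"
      unfolding S_def a_def by (intro sum.cong) (auto simp: powr_minus field_simps)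
    ultimately show ?case by simp
  qed
qed

theorem moebius_sum_tendsto_0: "(\<lambda>N. \<Sum>n=1..N. real_of_int (moebius n) / real n) \<longlonglongrightarrow> 0"
proof (rule tendstoI)
  fix e :: real assume e: "e > 0"
  have "\<forall>\<^sub>F N in sequentially. norm (\<Sum>n=1..N. of_int (moebius n) / of_nat n :: complex) \<le> 4 / (8 / e)"
    using e by (intro moebius_partial_sum_bound) auto
  then show "\<forall>\<^sub>F N in sequentially. dist (\<Sum>n=1..N. real_of_int (moebius n) / real n) 0 < e"
  proof eventually_elim
    case (elim N)
    have "(\<Sum>n=1..N. of_int (moebius n) / of_nat n :: complex) = of_real (\<Sum>n=1..N. real_of_int (moebius n) / real n)"
      by simp
    then show ?case using elim e by (simp only: norm_of_real) simp
  qed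
qed

section \<open>Moebius sums over integers coprime to k\<close>

definition moebius_sum :: "nat \<Rightarrow> nat \<Rightarrow> real" where
  "moebius_sum k N = (\<Sum>t | t \<in> {1..N} \<and> coprime t k. real_of_int (moebius t))"

definition moebius_log_sum :: "nat \<Rightarrow> nat \<Rightarrow> real" where
  "moebius_log_sum k N = (\<Sum>t | t \<in> {1..N} \<and> coprime t k. real_of_int (moebius t) / real t)"

text \<open>Counting multiples turns the sum into one over j \<le> N of the Moebius sum over the
  divisors of j coprime to k, which is an indicator. That the result is a non-negative count is used
  as much as its value.\<close>

lemma moebius_div_sum_count:
  "(\<Sum>t | t \<in> {1..N} \<and> coprime t k. real_of_int (moebius t) * real (N div t)) =
     real (card {j \<in> {1..N}. \<forall>p. prime p \<longrightarrow> p dvd j \<longrightarrow> p dvd k})"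
proof -
  have "(\<Sum>t | t \<in> {1..N} \<and> coprime t k. real_of_int (moebius t) * real (N div t)) =
        (\<Sum>t=1..N. (if coprime t k then real_of_int (moebius t) else 0) * real (N div t))"
    by (rule sum.mono_neutral_cong_left) auto
  also have "\<dots> = (\<Sum>n=1..N. \<Sum>d | d dvd n. if coprime d k then real_of_int (moebius d) else 0)"
    by (rule sum_divisors_count[symmetric])
  also have "\<dots> = (\<Sum>n=1..N. if \<forall>p. prime p \<longrightarrow> p dvd n \<longrightarrow> p dvd k then 1 else 0)"
  proof (rule sum.cong)
    fix n assume "n \<in> {1..N}"
    then have n: "n > 0" by simp
    have "(\<Sum>d | d dvd n. if coprime d k then real_of_int (moebius d) else 0) =
          (\<Sum>d | d dvd n \<and> coprime d k. real_of_int (moebius d))"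
      using n by (intro sum.mono_neutral_cong_right) auto
    also have "\<dots> = real_of_int (\<Sum>d | d dvd n \<and> coprime d k. moebius d)" by simp
    also have "\<dots> = (if \<forall>p. prime p \<longrightarrow> p dvd n \<longrightarrow> p dvd k then 1 else 0)"
      by (subst sum_moebius_coprime_divisors[OF n]) auto
    finally show "(\<Sum>d | d dvd n. if coprime d k then real_of_int (moebius d) else 0) =
        (if \<forall>p. prime p \<longrightarrow> p dvd n \<longrightarrow> p dvd k then 1 else 0)" .
  qed auto
  also have "\<dots> = (\<Sum>n | n \<in> {1..N} \<and> (\<forall>p. prime p \<longrightarrow> p dvd n \<longrightarrow> p dvd k). 1)"
    by (rule sum.mono_neutral_cong_right) auto
  finally show ?thesis by simp
qed

lemma real_nat_div: "real (N div t) = real N / real t - real (N mod t) / real t"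
proof (cases "t = 0")
  case False
  have "real (N div t) * real t + real (N mod t) = real N"
    by (metis div_mult_mod_eq of_nat_add of_nat_mult)
  then show ?thesis using False by (simp add: field_simps)
qed simp

text \<open>N times the sum is the number of integers whose prime factors all divide k, plus a
  fractional part for each t > 1 coprime to k. The two index sets are disjoint in {1..N}, so no
  constant is lost. Uniformity in k is what later allows k to run through products of
  primes.\<close>

lemma abs_moebius_log_sum_le_1: "\<bar>moebius_log_sum k N\<bar> \<le> 1"
proof (cases "N = 0")
  case True
  then show ?thesis by (simp add: moebius_log_sum_def)
next
  case False
  let ?T = "{t. t \<in> {1..N} \<and> coprime t k}"
  define J where "J = {j \<in> {1..N}. \<forall>p. prime p \<longrightarrow> p dvd j \<longrightarrow> p dvd k}"
  have "real N * moebius_log_sum k N = (\<Sum>t\<in>?T. real_of_int (moebius t) * real (N div t)) +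
          (\<Sum>t\<in>?T. real_of_int (moebius t) * (real (N mod t) / real t))"
    unfolding moebius_log_sum_def real_nat_div sum_distrib_left sum.distrib[symmetric]
    by (intro sum.cong) (auto simp: algebra_simps)
  also have "(\<Sum>t\<in>?T. real_of_int (moebius t) * real (N div t)) = real (card J)"
    unfolding J_def by (rule moebius_div_sum_count)
  finally have eq: "real N * moebius_log_sum k N = real (card J) + (\<Sum>t\<in>?T. real_of_int (moebius t) * (real (N mod t) / real t))" .
  have "(\<Sum>t\<in>?T. real_of_int (moebius t) * (real (N mod t) / real t)) =
        (\<Sum>t\<in>?T - {1}. real_of_int (moebius t) * (real (N mod t) / real t))"
    by (rule sum.mono_neutral_right) auto
  also have "\<bar>\<dots>\<bar> \<le> (\<Sum>t\<in>?T - {1}. 1)"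
  proof (rule order_trans[OF sum_abs sum_mono])
    fix t assume "t \<in> ?T - {1}"
    then have "real (N mod t) / real t \<le> 1" by (simp add: mod_less_divisor order_less_imp_le)
    then show "\<bar>real_of_int (moebius t) * (real (N mod t) / real t)\<bar> \<le> 1"
      using abs_real_moebius_le_1[of t] unfolding abs_mult abs_divide abs_of_nat
      by (intro mult_le_one) auto
  qed
  finally have 1: "\<bar>\<Sum>t\<in>?T. real_of_int (moebius t) * (real (N mod t) / real t)\<bar> \<le> real (card (?T - {1}))" by simp
  have disj: "J \<inter> (?T - {1}) = {}"
  proof -
    have False if t: "t \<in> J" "t \<in> ?T" "t \<noteq> 1" for t
    proof -
      obtain p where "prime p" "p dvd t" using t(3) by (metis prime_factor_nat)
      with t show False unfolding J_def
        using coprime_common_divisor[of t k p] by auto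
    qed
    then show ?thesis by blast
  qed
  have "card J + card (?T - {1}) = card (J \<union> (?T - {1}))"
    using disj by (intro card_Un_disjoint[symmetric]) (auto simp: J_def)
  also have "\<dots> \<le> card {1..N}" by (intro card_mono) (auto simp: J_def)
  finally have "real (card J) + real (card (?T - {1})) \<le> real N" by simp
  with 1 eq have "\<bar>real N * moebius_log_sum k N\<bar> \<le> real N" by linarith
  then show ?thesis using False by (simp add: abs_mult)
qed

lemma filterlim_div_at_top:
  fixes p :: nat
  assumes p: "p > 0"
  shows "filterlim (\<lambda>N. N div p) at_top sequentially"
  unfolding filterlim_at_top eventually_sequentially
proof
  fix Z show "\<exists>M. \<forall>N\<ge>M. Z \<le> N div p"
    using p by (intro exI[of _ "Z * p"]) (auto simp: less_eq_div_iff_mult_less_eq)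
qed

text \<open>The limit superior of |f| is at most half of itself. The iteration uses 3/4 in place of
  1/2, the spare quarter absorbing g.\<close>

lemma tendsto_0_of_recursion:
  fixes f g :: "nat \<Rightarrow> real"
  assumes bound: "\<And>N. \<bar>f N\<bar> \<le> B" and g: "g \<longlonglongrightarrow> 0" and p: "p > 0" and c: "\<bar>c\<bar> \<le> 1/2"
    and rec: "\<And>N. f N = g N + c * f (N div p)"
  shows "f \<longlonglongrightarrow> 0"
proof -
  have B: "B + 1 > 0" using bound[of 0] by linarith
  have ev: "\<forall>\<^sub>F N in sequentially. \<bar>f N\<bar> \<le> (B + 1) * (3/4) ^ j" for j
  proof (induction j)
    case 0
    have "\<bar>f N\<bar> \<le> B + 1" for N using bound[of N] by linarith
    then show ?case by simp
  next
    case (Suc j)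
    have "\<forall>\<^sub>F N in sequentially. \<bar>g N\<bar> < (B + 1) * (3/4) ^ j / 4"
      using g[THEN tendsto_rabs_zero] B by (intro order_tendstoD(2)[of _ 0]) auto
    moreover note lim = filterlim_div_at_top[OF p]
    have "\<forall>\<^sub>F N in sequentially. \<bar>f (N div p)\<bar> \<le> (B + 1) * (3/4) ^ j"
      using Suc.IH lim by (rule eventually_compose_filterlim)
    ultimately show ?case
    proof eventually_elim
      case (elim N)
      have "\<bar>f N\<bar> \<le> \<bar>g N\<bar> + \<bar>c\<bar> * \<bar>f (N div p)\<bar>"
        unfolding rec[of N] by (metis abs_mult abs_triangle_ineq)
      also have "\<bar>c\<bar> * \<bar>f (N div p)\<bar> \<le> 1/2 * ((B + 1) * (3/4) ^ j)"
        using c elim by (intro mult_mono) auto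
      finally show ?case using elim by simp
    qed
  qed
  show ?thesis
  proof (rule tendstoI)
    fix e :: real assume e: "e > 0"
    obtain j where "(3/4 :: real) ^ j < e / (B + 1)"
      using real_arch_pow_inv[of "e / (B + 1)" "3/4"] e B by auto
    then have j: "(B + 1) * (3/4) ^ j < e" using B by (simp add: field_simps)
    show "\<forall>\<^sub>F N in sequentially. dist (f N) 0 < e"
      using ev[of j] by eventually_elim (use j in auto)
  qed
qed

text \<open>Among the t coprime to k, those divisible by p exactly once are p s with s coprime to p
  k; the remaining multiples of p are not squarefree.\<close>

lemma moebius_log_sum_prime_mult:
  assumes p: "prime p" "\<not> p dvd k"
  shows "moebius_log_sum (p * k) N = moebius_log_sum k N + (1 / real p) * moebius_log_sum (p * k) (N div p)"
proof -
  let ?f = "\<lambda>t. real_of_int (moebius t) / real t"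
  have cop: "coprime t (p * k) \<longleftrightarrow> \<not> p dvd t \<and> coprime t k" for t
    using prime_imp_coprime[OF p(1), of t] coprime_common_divisor[of t p p] p(1) coprime_mult_right_iff[of t p k]
    by (auto simp: coprime_commute)
  have "moebius_log_sum k N = (\<Sum>t | t \<in> {1..N} \<and> coprime t k \<and> \<not> p dvd t. ?f t) + (\<Sum>t | t \<in> {1..N} \<and> coprime t k \<and> p dvd t. ?f t)"
    unfolding moebius_log_sum_def by (subst sum.union_disjoint[symmetric]) (auto intro!: sum.cong)
  also have "(\<Sum>t | t \<in> {1..N} \<and> coprime t k \<and> \<not> p dvd t. ?f t) = moebius_log_sum (p * k) N"
    unfolding moebius_log_sum_def cop by (intro sum.cong) auto
  also have "(\<Sum>t | t \<in> {1..N} \<and> coprime t k \<and> p dvd t. ?f t) = (\<Sum>t | t \<in> {1..N} \<and> coprime t k \<and> p dvd t \<and> \<not> p ^ 2 dvd t. ?f t)"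
  proof (rule sum.mono_neutral_right)
    show "\<forall>i\<in>{t \<in> {1..N}. coprime t k \<and> p dvd t} - {t \<in> {1..N}. coprime t k \<and> p dvd t \<and> \<not> p ^ 2 dvd t}. ?f i = 0"
      using p by (auto simp: moebius_def squarefree_def)
  qed auto
  also have "\<dots> = (\<Sum>s | s \<in> {1..N div p} \<and> coprime s (p * k). - (1 / real p) * ?f s)"
  proof (rule sum.reindex_bij_witness[where i = "\<lambda>s. p * s" and j = "\<lambda>t. t div p"])
    fix t assume t: "t \<in> {t. t \<in> {1..N} \<and> coprime t k \<and> p dvd t \<and> \<not> p ^ 2 dvd t}"
    then obtain s where s: "t = p * s" by auto
    with t p show "t div p \<in> {s. s \<in> {1..N div p} \<and> coprime s (p * k)}"
      unfolding cop by (auto simp: power2_eq_square less_eq_div_iff_mult_less_eq prime_gt_0_nat mult.commute Suc_le_eq)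
    have "\<not> p dvd s" using t s by (auto simp: power2_eq_square)
    then show "- (1 / real p) * ?f (t div p) = ?f t"
      using p s by (simp add: moebius_prime_mult)
  next
    fix s assume s: "s \<in> {s. s \<in> {1..N div p} \<and> coprime s (p * k)}"
    with p have "p * s \<le> N" "\<not> p dvd s" "coprime s k" unfolding cop
      by (auto simp: less_eq_div_iff_mult_less_eq prime_gt_0_nat mult.commute)
    then show "p * s \<in> {t. t \<in> {1..N} \<and> coprime t k \<and> p dvd t \<and> \<not> p ^ 2 dvd t}"
      using s p by (auto simp: power2_eq_square prime_imp_coprime Suc_le_eq prime_gt_0_nat)
  qed (use p in \<open>auto simp: prime_gt_0_nat\<close>)
  also have "\<dots> = - (1 / real p) * moebius_log_sum (p * k) (N div p)"
    unfolding moebius_log_sum_def by (rule sum_distrib_left[symmetric])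
  finally show ?thesis by simp
qed

text \<open>Induction on the primes of k, from the prime number theorem at k = 1. A new prime p
  brings in the recursion with c = 1 / p \<le> 1 / 2; a prime already present changes
  nothing.\<close>

theorem moebius_log_sum_tendsto_0:
  assumes "k > 0"
  shows "moebius_log_sum k \<longlonglongrightarrow> 0"
  using assms
proof (induction k rule: prime_divisors_induct)
  case (unit k)
  then have "moebius_log_sum k N = (\<Sum>n=1..N. real_of_int (moebius n) / real n)" for N
    unfolding moebius_log_sum_def by (intro sum.cong) auto
  then show ?case using moebius_sum_tendsto_0 by presburger
next
  case (factor p k)
  then have k: "moebius_log_sum k \<longlonglongrightarrow> 0" by auto
  show ?case
  proof (cases "p dvd k")
    case True
    then have "coprime t k \<Longrightarrow> coprime t p" for t
      by (rule coprime_divisors[OF dvd_refl])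
    then have "coprime t (p * k) \<longleftrightarrow> coprime t k" for t
      by (metis coprime_mult_right_iff)
    then have "moebius_log_sum (p * k) = moebius_log_sum k" by (simp add: moebius_log_sum_def fun_eq_iff)
    then show ?thesis using k by simp
  next
    case False
    have "\<bar>1 / real p\<bar> \<le> 1/2" using prime_ge_2_nat[OF factor(1)] by (simp add: field_simps)
    then show ?thesis
      using tendsto_0_of_recursion[OF abs_moebius_log_sum_le_1 k prime_gt_0_nat[OF factor(1)] _ 
          moebius_log_sum_prime_mult[OF factor(1) False]] by blast
  qed
qed auto

text \<open>Partial summation expresses the sum as N m(N) - m(1) - ... - m(N - 1), where m is the
  logarithmic sum tending to 0. The form \<eta> N + C, valid for all N, survives the substitution of
  N div p for N and finite sums over p.\<close>

theorem moebius_sum_small: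
  assumes "k > 0" "\<eta> > 0"
  obtains C where "C \<ge> 0" "\<And>N. \<bar>moebius_sum k N\<bar> \<le> \<eta> * real N + C"
proof -
  have "\<forall>\<^sub>F n in sequentially. \<bar>moebius_log_sum k n\<bar> < \<eta> / 2"
    using tendsto_rabs_zero[OF moebius_log_sum_tendsto_0[OF assms(1)]] assms(2) by (intro order_tendstoD(2)[of _ 0]) auto
  then obtain n0 where n0: "\<And>n. n \<ge> n0 \<Longrightarrow> \<bar>moebius_log_sum k n\<bar> < \<eta> / 2"
    by (auto simp: eventually_sequentially)
  have le: "\<bar>moebius_log_sum k n\<bar> \<le> \<eta> / 2 + (if n < n0 then 1 else 0)" for n
    using n0[of n] abs_moebius_log_sum_le_1[of k n] assms(2) by (cases "n < n0") auto
  let ?v = "\<lambda>t. if coprime t k then real_of_int (moebius t) / real t else 0"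
  have v: "(\<Sum>t=1..n. ?v t) = moebius_log_sum k n" for n
    unfolding moebius_log_sum_def by (rule sum.mono_neutral_cong_right) auto
  have "\<bar>moebius_sum k N\<bar> \<le> \<eta> * real N + 2 * real n0" for N
  proof (cases "N = 0")
    case True
    then show ?thesis by (simp add: moebius_sum_def)
  next
    case False
    have "moebius_sum k N = (\<Sum>t=1..N. real t *\<^sub>R ?v t)"
      unfolding moebius_sum_def by (rule sum.mono_neutral_cong_left) auto
    also have "\<dots> = real N * moebius_log_sum k N - (\<Sum>n=1..<N. moebius_log_sum k n)"
      using False by (subst abel_identity) (auto simp: v sum_negf simp del: One_nat_def)
    finally have eq: "moebius_sum k N = real N * moebius_log_sum k N - (\<Sum>n=1..<N. moebius_log_sum k n)" .
    have "\<bar>moebius_sum k N\<bar> \<le> real N * \<bar>moebius_log_sum k N\<bar> + (\<Sum>n=1..<N. \<bar>moebius_log_sum k n\<bar>)"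
    proof -
      have "\<bar>a - b\<bar> \<le> \<bar>a\<bar> + c" if "\<bar>b\<bar> \<le> c" for a b c :: real using that by linarith
      from this[OF sum_abs, of "real N * moebius_log_sum k N" "moebius_log_sum k" "{1..<N}"] eq show ?thesis
        by (simp add: abs_mult)
    qed
    also have "real N * \<bar>moebius_log_sum k N\<bar> \<le> real N * (\<eta> / 2 + (if N < n0 then 1 else 0))"
      by (intro mult_left_mono le) auto
    also have "\<dots> \<le> real N * \<eta> / 2 + real n0" by (auto simp: field_simps)
    also have "(\<Sum>n=1..<N. \<bar>moebius_log_sum k n\<bar>) \<le> (\<Sum>n=1..<N. \<eta> / 2 + (if n < n0 then 1 else 0))"
      by (intro sum_mono le)
    also have "\<dots> = (\<Sum>n=1..<N. \<eta> / 2) + (\<Sum>n=1..<N. if n < n0 then 1 else 0)"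
      by (rule sum.distrib)
    also have "(\<Sum>n=1..<N. if n < n0 then 1 else 0 :: real) \<le> real n0"
    proof -
      have "(\<Sum>n=1..<N. if n < n0 then 1 else 0 :: real) = (\<Sum>n\<in>{1..<N} \<inter> {..<n0}. 1)"
        by (rule sum.mono_neutral_cong_right) auto
      also have "\<dots> \<le> real (card {..<n0})" using card_mono[of "{..<n0}" "{1..<N} \<inter> {..<n0}"] by simp
      finally show ?thesis by simp
    qed
    also have "(\<Sum>n=1..<N. \<eta> / 2) \<le> real N * \<eta> / 2"
      using assms(2) by (auto simp: field_simps of_nat_diff)
    finally show ?thesis by (simp add: field_simps)
  qed
  then show ?thesis by (intro that[of "2 * real n0"]) auto
qed

section \<open>Mertens' first theorem and smooth numbers\<close>

lemma sum_ln_eq_sum_mangoldt: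
  "(\<Sum>n=1..N. ln (real n)) = (\<Sum>d=1..N. mangoldt d * real (N div d))"
proof -
  have "(\<Sum>n=1..N. ln (real n)) = (\<Sum>n=1..N. \<Sum>d | d dvd n. mangoldt d)"
    using mangoldt_sum[where ?'a = real] by (intro sum.cong) auto
  also have "\<dots> = (\<Sum>d=1..N. mangoldt d * real (N div d))"
    by (rule sum_divisors_count)
  finally show ?thesis .
qed

lemma ln_div_nat_nonneg: "0 \<le> ln (real n) / real n"
  by (cases "n = 0") auto

lemma ln_fact_eq_sum: "ln (fact N :: real) = (\<Sum>n=1..N. ln (real n))"
  by (induction N) (simp_all add: ln_mult)

lemma sum_ln_bounds:
  assumes "N \<ge> 1"
  shows "(\<Sum>n=1..N. ln (real n)) \<le> real N * ln (real N)" "(\<Sum>n=1..N. ln (real n)) \<ge> real N * ln (real N) - real N"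
proof -
  have "(\<Sum>n=1..N. ln (real n)) \<le> (\<Sum>n=1..N. ln (real N))" by (intro sum_mono) auto
  then show "(\<Sum>n=1..N. ln (real n)) \<le> real N * ln (real N)" by simp
  show "(\<Sum>n=1..N. ln (real n)) \<ge> real N * ln (real N) - real N"
    using assms
  proof (induction N rule: dec_induct)
    case (step n)
    have "ln (real (Suc n) / real n) \<le> real (Suc n) / real n - 1"
      using step.hyps by (intro ln_le_minus_one) auto
    also have "\<dots> = 1 / real n" using step.hyps by (simp add: field_simps)
    finally have "real n * (ln (real (Suc n)) - ln (real n)) \<le> real n * (1 / real n)"
      using step.hyps by (intro mult_left_mono) (auto simp: ln_div)
    also have "real n * (1 / real n) = 1" using step.hyps by simp
    finally have "real (Suc n) * ln (real (Suc n)) - real (Suc n) \<le> real n * ln (real n) - real n + ln (real (Suc n))"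
      by (simp add: algebra_simps)
    then show ?case using step.IH step.hyps by simp
  qed auto
qed

section \<open>Chebyshev's bound and Mertens' first theorem\<close>

definition chebyshev_psi :: "nat \<Rightarrow> real" where
  "chebyshev_psi N = (\<Sum>n=1..N. mangoldt n)"

text \<open>The central binomial coefficient is at most 4^n, and its logarithm is the sum of
  \<Lambda>(d) (floor(2n / d) - 2 floor(n / d)), whose weights are never negative and equal 1 for n
  < d \<le> 2n.\<close>

lemma chebyshev_psi_double: "chebyshev_psi (2 * n) - chebyshev_psi n \<le> 2 * real n * ln 2"
proof -
  have "chebyshev_psi (2 * n) - chebyshev_psi n = (\<Sum>d=Suc n..2*n. mangoldt d)"
  proof -
    have "{1..2*n} = {1..n} \<union> {Suc n..2*n}" by auto
    then show ?thesis unfolding chebyshev_psi_def by (simp add: sum.union_disjoint)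
  qed
  also have "\<dots> = (\<Sum>d=Suc n..2*n. mangoldt d * (real (2 * n div d) - 2 * real (n div d)))"
  proof (rule sum.cong)
    fix d assume d: "d \<in> {Suc n..2*n}"
    then have "2 * n div d = 1" by (intro div_nat_eqI) auto
    with d show "mangoldt d = mangoldt d * (real (2 * n div d) - 2 * real (n div d))" by simp
  qed auto
  also have "\<dots> \<le> (\<Sum>d=1..2*n. mangoldt d * (real (2 * n div d) - 2 * real (n div d)))"
  proof (rule sum_mono2)
    fix d
    have "2 * (n div d) \<le> 2 * n div d"
      by (cases "d = 0") (simp_all add: less_eq_div_iff_mult_less_eq)
    then have "2 * real (n div d) \<le> real (2 * n div d)" by (metis of_nat_le_iff of_nat_mult of_nat_numeral)
    then show "0 \<le> mangoldt d * (real (2 * n div d) - 2 * real (n div d))"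
      by (intro mult_nonneg_nonneg mangoldt_nonneg) auto
  qed auto
  also have "\<dots> = (\<Sum>d=1..2*n. mangoldt d * real (2 * n div d)) - 2 * (\<Sum>d=1..2*n. mangoldt d * real (n div d))"
    by (simp add: sum_subtractf sum_distrib_left algebra_simps)
  also have "(\<Sum>d=1..2*n. mangoldt d * real (n div d)) = (\<Sum>d=1..n. mangoldt d * real (n div d))"
    by (rule sum.mono_neutral_right) auto
  also have "(\<Sum>d=1..2*n. mangoldt d * real (2 * n div d)) - 2 * (\<Sum>d=1..n. mangoldt d * real (n div d))
      = ln (fact (2 * n)) - 2 * ln (fact n)"
    unfolding ln_fact_eq_sum sum_ln_eq_sum_mangoldt ..
  also have "\<dots> = ln (real (2 * n choose n))"
    by (simp add: binomial_fact ln_div ln_mult)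
  also have "\<dots> \<le> ln (2 ^ (2 * n))"
  proof -
    have "real (2 * n choose n) \<le> 2 ^ (2 * n)"
      using binomial_le_pow2[of "2 * n" n] by (metis of_nat_le_iff of_nat_power of_nat_numeral)
    moreover have "real (2 * n choose n) > 0" by simp
    ultimately show ?thesis using ln_le_cancel_iff[of "real (2 * n choose n)" "2 ^ (2 * n)"] by simp
  qed
  also have "\<dots> = 2 * real n * ln 2" by (simp add: ln_realpow)
  finally show ?thesis .
qed

lemma ln_2_le: "ln (2 :: real) \<le> 1"
  using ln_le_minus_one[of "2 :: real"] by simp

text \<open>With n = N div 2 the contributions are 4n by induction, 2n ln 2 \<le> 2n by doubling,
  and at most N for the last term of an odd N; since 2n \<le> N they add up to at most 4N.\<close>

lemma chebyshev_psi_le: "chebyshev_psi N \<le> 4 * real N"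
proof (induction N rule: less_induct)
  case (less N)
  show ?case
  proof (cases "N \<le> 1")
    case True
    then have "N = 0 \<or> N = 1" by auto
    then show ?thesis by (auto simp: chebyshev_psi_def)
  next
    case False
    define n where "n = N div 2"
    have n: "n < N" "2 * n \<le> N" "N \<le> 2 * n + 1" using False by (auto simp: n_def)
    have "chebyshev_psi N \<le> chebyshev_psi (2 * n) + ln (real N)"
    proof (cases "N = 2 * n")
      case True
      then show ?thesis using False by simp
    next
      case neq: False
      then have N: "N = Suc (2 * n)" using n by simp
      then have "chebyshev_psi N = chebyshev_psi (2 * n) + mangoldt N" by (simp add: chebyshev_psi_def)
      then show ?thesis using mangoldt_le[of N] False by simp
    qed
    also have "chebyshev_psi (2 * n) \<le> chebyshev_psi n + 2 * real n * ln 2"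
      using chebyshev_psi_double[of n] by simp
    also have "chebyshev_psi n \<le> 4 * real n" using less n by simp
    also have "2 * real n * ln 2 \<le> 2 * real n * 1" using ln_2_le by (intro mult_left_mono) auto
    also have "ln (real N) \<le> real N - 1" using False by (intro ln_le_minus_one) auto
    finally have "chebyshev_psi N \<le> 6 * real n + real N" by simp
    moreover have "2 * real n \<le> real N" using n(2) by (metis of_nat_le_iff of_nat_mult of_nat_numeral)
    ultimately show ?thesis by simp
  qed
qed

lemma sum_mangoldt_mod_bounds:
  "0 \<le> (\<Sum>d=1..N. mangoldt d * (real (N mod d) / real d))"
  "(\<Sum>d=1..N. mangoldt d * (real (N mod d) / real d)) \<le> 4 * real N"
proof -
  show "0 \<le> (\<Sum>d=1..N. mangoldt d * (real (N mod d) / real d))"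
    by (intro sum_nonneg mult_nonneg_nonneg mangoldt_nonneg) auto
  have "(\<Sum>d=1..N. mangoldt d * (real (N mod d) / real d)) \<le> (\<Sum>d=1..N. mangoldt d * 1)"
    by (intro sum_mono mult_left_mono mangoldt_nonneg) (auto simp: order_less_imp_le)
  also have "\<dots> = chebyshev_psi N" by (simp add: chebyshev_psi_def)
  also note chebyshev_psi_le
  finally show "(\<Sum>d=1..N. mangoldt d * (real (N mod d) / real d)) \<le> 4 * real N" .
qed

text \<open>N times the sum is ln N! plus fractional parts. The first lies at most N below N ln N,
  and Chebyshev's bound puts the second between 0 and 4N, whence the constant.\<close>

theorem mertens_mangoldt:
  assumes "N \<ge> 1"
  shows "\<bar>(\<Sum>d=1..N. mangoldt d / real d) - ln (real N)\<bar> \<le> 4"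
proof -
  have "real N * (\<Sum>d=1..N. mangoldt d / real d) = (\<Sum>d=1..N. mangoldt d * real (N div d)) +
      (\<Sum>d=1..N. mangoldt d * (real (N mod d) / real d))"
    unfolding real_nat_div sum_distrib_left sum.distrib[symmetric]
    by (intro sum.cong) (auto simp: algebra_simps)
  then have "real N * ((\<Sum>d=1..N. mangoldt d / real d) - ln (real N)) = (\<Sum>n=1..N. ln (real n)) - real N * ln (real N) +
      (\<Sum>d=1..N. mangoldt d * (real (N mod d) / real d))"
    unfolding sum_ln_eq_sum_mangoldt by (simp add: algebra_simps)
  then have "\<bar>real N * ((\<Sum>d=1..N. mangoldt d / real d) - ln (real N))\<bar> \<le> 4 * real N"
    using sum_ln_bounds[OF assms] sum_mangoldt_mod_bounds[of N] by linarith
  then have "real N * \<bar>(\<Sum>d=1..N. mangoldt d / real d) - ln (real N)\<bar> \<le> real N * 4"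
    by (simp add: abs_mult)
  then show ?thesis using assms by (simp add: mult_le_cancel_left)
qed

text \<open>Each prime p contributes a geometric series of at most 2 ln p / p^2. The pairs (p, j)
  with 2 \<le> j \<le> N over-cover the prime powers up to N, which only adds non-negative
  terms.\<close>

lemma mangoldt_prime_powers_bound:
  obtains C where "C \<ge> 0" "\<And>N. (\<Sum>n | n \<in> {1..N} \<and> \<not> prime n. mangoldt n / real n) \<le> C"
proof -
  have summable: "summable (\<lambda>n. 2 * (ln (real n) * real n powr (-2)))"
    by (intro summable_mult summable_ln_powr) auto
  define C where "C = (\<Sum>n. 2 * (ln (real n) * real n powr (-2)))"
  have nonneg: "0 \<le> 2 * (ln (real n) * real n powr (-2))" for n
    by (cases "n = 0") auto
  have "(\<Sum>n | n \<in> {1..N} \<and> \<not> prime n. mangoldt n / real n) \<le> C" for N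
  proof -
    let ?P = "{p. prime p \<and> p \<le> N}"
    have "(\<Sum>n | n \<in> {1..N} \<and> \<not> prime n. mangoldt n / real n) =
        (\<Sum>n | n \<in> {1..N} \<and> \<not> prime n \<and> primepow n. mangoldt n / real n)"
      by (rule sum.mono_neutral_right) (auto simp: mangoldt_def)
    also have "\<dots> \<le> (\<Sum>n\<in>(\<lambda>(p, j). p ^ j) ` (?P \<times> {2..N}). mangoldt n / real n)"
    proof (rule sum_mono2)
      show "{n \<in> {1..N}. \<not> prime n \<and> primepow n} \<subseteq> (\<lambda>(p, j). p ^ j) ` (?P \<times> {2..N})"
      proof
        fix n assume n: "n \<in> {n \<in> {1..N}. \<not> prime n \<and> primepow n}"
        then obtain p j where pj: "prime p" "j > 0" "n = p ^ j" by (auto simp: primepow_def)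
        have "j \<noteq> 1" using n pj by auto
        moreover have "j < p ^ j" using prime_ge_2_nat[OF pj(1)] by (intro power_gt_expt) auto
        moreover have "p ^ 1 \<le> p ^ j" using pj prime_ge_1_nat[OF pj(1)] by (intro power_increasing) auto
        ultimately show "n \<in> (\<lambda>(p, j). p ^ j) ` (?P \<times> {2..N})"
          using n pj by (auto intro!: image_eqI[of _ _ "(p, j)"])
      qed
    qed (auto simp: mangoldt_nonneg)
    also have "\<dots> \<le> (\<Sum>(p, j)\<in>?P \<times> {2..N}. mangoldt (p ^ j) / real (p ^ j))"
      by (rule order_trans[OF sum_image_le]) (auto simp: mangoldt_nonneg o_def case_prod_unfold)
    also have "\<dots> = (\<Sum>p\<in>?P. \<Sum>j=2..N. mangoldt (p ^ j) / real (p ^ j))"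
      by (rule sum.cartesian_product[symmetric])
    also have "\<dots> \<le> (\<Sum>p\<in>?P. 2 * (ln (real p) * real p powr (-2)))"
    proof (rule sum_mono)
      fix p assume "p \<in> ?P"
      then have p: "prime p" "p \<ge> 2" by (auto intro: prime_ge_2_nat)
      let ?x = "1 / real p"
      have x: "0 < ?x" "?x \<le> 1/2" using p by (auto simp: field_simps)
      have "(\<Sum>j=2..N. mangoldt (p ^ j) / real (p ^ j)) = (\<Sum>j=2..N. ln (real p) * ?x ^ j)"
        using p by (intro sum.cong) (auto simp: power_divide)
      also have "\<dots> = ln (real p) * (\<Sum>j=2..N. ?x ^ j)" by (simp add: sum_distrib_left)
      also have "(\<Sum>j=2..N. ?x ^ j) \<le> 2 * ?x ^ 2"
      proof -
        have "(\<Sum>j=2..N. ?x ^ j) * (1 - ?x) \<le> ?x ^ 2"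
        proof (cases "2 \<le> N")
          case True
          have "(1 - ?x) * (\<Sum>j=2..N. ?x ^ j) = ?x ^ 2 - ?x ^ Suc N"
            by (rule sum_gp_multiplied[OF True])
          moreover have "?x ^ Suc N \<ge> 0" by simp
          ultimately show ?thesis by (simp only: mult.commute)
        qed auto
        moreover have "(\<Sum>j=2..N. ?x ^ j) * (1/2) \<le> (\<Sum>j=2..N. ?x ^ j) * (1 - ?x)"
          using x by (intro mult_left_mono sum_nonneg) auto
        ultimately show ?thesis by linarith
      qed
      finally have "(\<Sum>j=2..N. mangoldt (p ^ j) / real (p ^ j)) \<le> ln (real p) * (2 * ?x ^ 2)"
        using p by (simp add: mult_left_mono)
      also have "?x ^ 2 = real p powr (-2)"
        using p by (simp add: powr_minus power_divide powr_numeral field_simps)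
      finally show "(\<Sum>j=2..N. mangoldt (p ^ j) / real (p ^ j)) \<le> 2 * (ln (real p) * real p powr (-2))"
        by (simp add: mult_ac)
    qed
    also have "\<dots> \<le> C" unfolding C_def
      by (intro sum_le_suminf summable) (use nonneg in auto)
    finally show ?thesis .
  qed
  moreover have "C \<ge> 0" unfolding C_def using summable nonneg by (intro suminf_nonneg) auto
  ultimately show ?thesis using that by blast
qed

theorem mertens_first:
  obtains C where "C \<ge> 0" "\<And>N. N \<ge> 1 \<Longrightarrow> \<bar>(\<Sum>p | prime p \<and> p \<le> N. ln (real p) / real p) - ln (real N)\<bar> \<le> C"
proof -
  obtain C where C: "C \<ge> 0" "\<And>N. (\<Sum>n | n \<in> {1..N} \<and> \<not> prime n. mangoldt n / real n) \<le> C"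
    using mangoldt_prime_powers_bound by blast
  have "\<bar>(\<Sum>p | prime p \<and> p \<le> N. ln (real p) / real p) - ln (real N)\<bar> \<le> 4 + C" if "N \<ge> 1" for N
  proof -
    have "(\<Sum>n=1..N. mangoldt n / real n) = (\<Sum>n | n \<in> {1..N} \<and> prime n. mangoldt n / real n) + (\<Sum>n | n \<in> {1..N} \<and> \<not> prime n. mangoldt n / real n)"
      by (subst sum.union_disjoint[symmetric]) (auto intro!: sum.cong)
    also have "(\<Sum>n | n \<in> {1..N} \<and> prime n. mangoldt n / real n) = (\<Sum>p | prime p \<and> p \<le> N. ln (real p) / real p)"
      by (rule sum.cong) (auto simp: prime_gt_0_nat Suc_le_eq)
    finally have "(\<Sum>n=1..N. mangoldt n / real n) = (\<Sum>p | prime p \<and> p \<le> N. ln (real p) / real p) + (\<Sum>n | n \<in> {1..N} \<and> \<not> prime n. mangoldt n / real n)" .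
    moreover have "0 \<le> (\<Sum>n | n \<in> {1..N} \<and> \<not> prime n. mangoldt n / real n)"
      by (intro sum_nonneg divide_nonneg_nonneg mangoldt_nonneg) auto
    ultimately show ?thesis using mertens_mangoldt[OF that] C(2)[of N] by linarith
  qed
  then show ?thesis using C(1) by (intro that[of "4 + C"]) auto
qed

text \<open>De Bruijn's function \<Psi>(N, y).\<close>

definition smooth_count :: "nat \<Rightarrow> real \<Rightarrow> nat" where
  "smooth_count N y = card {n \<in> {1..N}. \<forall>p. prime p \<longrightarrow> p dvd n \<longrightarrow> real p \<le> y}"

text \<open>Weigh each smooth n by ln n, the sum of \<Lambda> over its divisors, which are smooth
  again: the total is at most N times the sum of \<Lambda>(d) / d over smooth d, hence N (ln y +
  O(1)) by Mertens. Each n above the square root of N has weight at least half of ln N. For y =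
  N^\<epsilon> the main term is 2 \<epsilon> N.\<close>

theorem smooth_count_le:
  obtains C where "C \<ge> 0" "\<And>N y. N \<ge> 2 \<Longrightarrow> y \<ge> 1 \<Longrightarrow>
     real (smooth_count N y) \<le> sqrt (real N) + 2 * real N * (ln y + C) / ln (real N)"
proof -
  obtain C1 where C1: "C1 \<ge> 0" "\<And>N. (\<Sum>n | n \<in> {1..N} \<and> \<not> prime n. mangoldt n / real n) \<le> C1"
    using mangoldt_prime_powers_bound by blast
  obtain C2 where C2: "C2 \<ge> 0" "\<And>N. N \<ge> 1 \<Longrightarrow> \<bar>(\<Sum>p | prime p \<and> p \<le> N. ln (real p) / real p) - ln (real N)\<bar> \<le> C2"
    using mertens_first by blast
  have "real (smooth_count N y) \<le> sqrt (real N) + 2 * real N * (ln y + (C1 + C2)) / ln (real N)"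
    if N: "N \<ge> 2" and y: "y \<ge> 1" for N y
  proof -
    let ?sm = "\<lambda>n. \<forall>p. prime p \<longrightarrow> p dvd n \<longrightarrow> real p \<le> y"
    define A where "A = {n \<in> {1..N}. ?sm n}"
    define B where "B = {n \<in> A. real n > sqrt (real N)}"
    have fin: "finite A" "finite B" "B \<subseteq> A" by (auto simp: A_def B_def)
    have cardA: "real (card A) \<le> sqrt (real N) + real (card B)"
    proof -
      have "A - B \<subseteq> {1..nat \<lfloor>sqrt (real N)\<rfloor>}"
      proof
        fix n assume "n \<in> A - B"
        then have "n \<ge> 1" "real n \<le> sqrt (real N)" by (auto simp: A_def B_def)
        then show "n \<in> {1..nat \<lfloor>sqrt (real N)\<rfloor>}" using le_nat_floor[of n] by simp
      qed
      then have "card (A - B) \<le> nat \<lfloor>sqrt (real N)\<rfloor>"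
        using card_mono[of "{1..nat \<lfloor>sqrt (real N)\<rfloor>}" "A - B"] by simp
      then have "real (card (A - B)) \<le> sqrt (real N)" by (meson le_nat_floor of_nat_floor of_nat_le_iff order_trans real_sqrt_ge_zero of_nat_0_le_iff)
      moreover have "card A = card (A - B) + card B"
        using fin by (metis card_Diff_subset card_mono le_add_diff_inverse2)
      ultimately show ?thesis by simp
    qed
    have lnN: "ln (real N) > 0" using N by simp
    have "real (card B) * (ln (real N) / 2) = (\<Sum>n\<in>B. ln (sqrt (real N)))"
      using N by (simp add: ln_sqrt)
    also have "\<dots> \<le> (\<Sum>n\<in>B. ln (real n))"
      using N by (intro sum_mono) (auto simp: B_def A_def)
    also have "\<dots> \<le> (\<Sum>n\<in>A. ln (real n))"
      using fin by (intro sum_mono2) (auto simp: A_def)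
    also have "\<dots> = (\<Sum>n\<in>A. \<Sum>d | d dvd n. mangoldt d)"
      using mangoldt_sum[where ?'a = real] by (intro sum.cong) (auto simp: A_def)
    also have "\<dots> \<le> (\<Sum>n\<in>A. \<Sum>d | d dvd n. if ?sm d then mangoldt d else 0)"
    proof (rule sum_mono)
      fix n assume "n \<in> A"
      then show "(\<Sum>d | d dvd n. mangoldt d) \<le> (\<Sum>d | d dvd n. if ?sm d then mangoldt d else (0::real))"
        by (intro sum_mono) (auto simp: A_def mangoldt_nonneg dest: dvd_trans)
    qed
    also have "\<dots> \<le> (\<Sum>n=1..N. \<Sum>d | d dvd n. if ?sm d then mangoldt d else 0)"
      by (intro sum_mono2) (auto simp: A_def intro!: sum_nonneg mangoldt_nonneg)
    also have "\<dots> = (\<Sum>d=1..N. (if ?sm d then mangoldt d else 0) * real (N div d))"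
      by (rule sum_divisors_count)
    also have "\<dots> \<le> (\<Sum>d=1..N. (if ?sm d then mangoldt d else 0) * (real N / real d))"
      by (intro sum_mono mult_left_mono of_nat_div_le_of_nat) (auto simp: mangoldt_nonneg)
    also have "\<dots> = real N * (\<Sum>d=1..N. if ?sm d then mangoldt d / real d else 0)"
      unfolding sum_distrib_left by (intro sum.cong) auto
    also have "(\<Sum>d=1..N. if ?sm d then mangoldt d / real d else 0) \<le>
        (\<Sum>d | d \<in> {1..N} \<and> prime d. if ?sm d then mangoldt d / real d else 0) + (\<Sum>d | d \<in> {1..N} \<and> \<not> prime d. mangoldt d / real d)"
    proof -
      have "(\<Sum>d=1..N. if ?sm d then mangoldt d / real d else 0) = 
        (\<Sum>d | d \<in> {1..N} \<and> prime d. if ?sm d then mangoldt d / real d else 0) + (\<Sum>d | d \<in> {1..N} \<and> \<not> prime d. if ?sm d then mangoldt d / real d else 0)"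
        by (subst sum.union_disjoint[symmetric]) (auto intro!: sum.cong)
      also have "(\<Sum>d | d \<in> {1..N} \<and> \<not> prime d. if ?sm d then mangoldt d / real d else 0) \<le> (\<Sum>d | d \<in> {1..N} \<and> \<not> prime d. mangoldt d / real d)"
        by (intro sum_mono) (auto simp: mangoldt_nonneg)
      finally show ?thesis by simp
    qed
    also have "(\<Sum>d | d \<in> {1..N} \<and> prime d. if ?sm d then mangoldt d / real d else 0) \<le>
        (\<Sum>p | prime p \<and> p \<le> nat \<lfloor>y\<rfloor>. ln (real p) / real p)"
    proof -
      have "(\<Sum>d | d \<in> {1..N} \<and> prime d. if ?sm d then mangoldt d / real d else 0) = (\<Sum>d | d \<in> {1..N} \<and> prime d \<and> ?sm d. ln (real d) / real d)"
        by (rule sum.mono_neutral_cong_right) auto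
      also have "\<dots> \<le> (\<Sum>p | prime p \<and> p \<le> nat \<lfloor>y\<rfloor>. ln (real p) / real p)"
        by (rule sum_mono2) (auto intro: ln_div_nat_nonneg simp: le_nat_floor prime_gt_0_nat Suc_le_eq)
      finally show ?thesis .
    qed
    also have "\<dots> \<le> ln (real (nat \<lfloor>y\<rfloor>)) + C2"
      using C2(2)[of "nat \<lfloor>y\<rfloor>"] y by (simp add: le_nat_floor)
    also have "ln (real (nat \<lfloor>y\<rfloor>)) \<le> ln y"
      using y by (subst ln_le_cancel_iff) (auto simp: of_nat_floor)
    also have "(\<Sum>d | d \<in> {1..N} \<and> \<not> prime d. mangoldt d / real d) \<le> C1" by (rule C1)
    finally have "real (card B) * (ln (real N) / 2) \<le> real N * (ln y + C2 + C1)"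
      by (simp add: mult_left_mono)
    then have "real (card B) \<le> 2 * real N * (ln y + (C1 + C2)) / ln (real N)"
      using lnN by (simp add: field_simps)
    with cardA show ?thesis by (simp add: smooth_count_def A_def)
  qed
  then show ?thesis using C1(1) C2(1) by (intro that[of "C1 + C2"]) auto
qed

section \<open>Moebius sums over integers with restricted least prime divisor\<close>

abbreviation (input) lpd :: "nat \<Rightarrow> nat" where "lpd \<equiv> least_prime_divisor"

lemma lpd_prime: "n \<ge> 2 \<Longrightarrow> prime (lpd n)"
  and lpd_dvd: "n \<ge> 2 \<Longrightarrow> lpd n dvd n"
proof -
  assume "n \<ge> 2"
  then have "\<exists>p. prime p \<and> p dvd n" using prime_factor_nat[of n] by auto
  from LeastI_ex[OF this] show "prime (lpd n)" "lpd n dvd n"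
    by (auto simp: least_prime_divisor_def)
qed

lemma lpd_le: "prime p \<Longrightarrow> p dvd n \<Longrightarrow> lpd n \<le> p"
  unfolding least_prime_divisor_def by (rule Least_le) simp

lemma lpd_eqI:
  assumes "prime p" "p dvd n" "\<And>q. prime q \<Longrightarrow> q dvd n \<Longrightarrow> p \<le> q"
  shows "lpd n = p"
  unfolding least_prime_divisor_def using assms by (intro Least_equality) auto

lemma lpd_le_self: "n \<ge> 2 \<Longrightarrow> lpd n \<le> n"
  using lpd_dvd[of n] by (auto intro: dvd_imp_le)

definition primorial :: "nat \<Rightarrow> nat" where
  "primorial K = \<Prod>{p. prime p \<and> p \<le> K}"

lemma prime_dvd_primorial_iff: "prime p \<Longrightarrow> p dvd primorial K \<longleftrightarrow> p \<le> K"
proof -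
  assume p: "prime p"
  have "p dvd primorial K \<longleftrightarrow> (\<exists>q\<in>{p. prime p \<and> p \<le> K}. p dvd q)"
    unfolding primorial_def using prime_dvd_prod_iff[OF _ p, of "{p. prime p \<and> p \<le> K}" "\<lambda>x. x"] by simp
  also have "\<dots> \<longleftrightarrow> p \<le> K" using p primes_dvd_imp_eq by auto
  finally show ?thesis .
qed

lemma primorial_pos: "primorial K > 0"
  unfolding primorial_def by (intro prod_pos) (auto simp: prime_gt_0_nat)

lemma coprime_primorial_iff: "coprime t (primorial K) \<longleftrightarrow> (\<forall>p. prime p \<longrightarrow> p dvd t \<longrightarrow> p > K)"
proof
  assume c: "coprime t (primorial K)"
  show "\<forall>p. prime p \<longrightarrow> p dvd t \<longrightarrow> p > K"
  proof (intro allI impI)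
    fix p assume p: "prime p" "p dvd t"
    then have "\<not> p dvd primorial K" using coprime_common_divisor[OF c, of p] by auto
    then show "p > K" using prime_dvd_primorial_iff[OF p(1)] by auto
  qed
next
  assume *: "\<forall>p. prime p \<longrightarrow> p dvd t \<longrightarrow> p > K"
  show "coprime t (primorial K)"
  proof (rule ccontr)
    assume "\<not> coprime t (primorial K)"
    then obtain d where d: "d dvd t" "d dvd primorial K" "\<not> is_unit d" by (rule not_coprimeE)
    then obtain p where p: "prime p" "p dvd d" using prime_factor_nat[of d] by auto
    with d * have "p > K" "p \<le> K" using prime_dvd_primorial_iff[OF p(1)] dvd_trans by blast+
    then show False by simp
  qed
qed

lemma prime_factors_primorial: "prime_factors (primorial K) = {p. prime p \<and> p \<le> K}"
  using prime_dvd_primorial_iff primorial_pos[of K] by (auto simp: prime_factors_dvd)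

text \<open>In n = p t the cofactor t is free of primes up to p unless p^2 divides n, and then
  \<mu>(n) = 0. The weight F is left open for its different uses: 1, N div n, and 1 / n combined
  with a condition on the least prime or with coprimality.\<close>

lemma sum_moebius_lpd:
  fixes F :: "nat \<Rightarrow> real"
  shows "(\<Sum>n | n \<in> {2..N} \<and> lpd n \<in> S. real_of_int (moebius n) * F n) =
     - (\<Sum>p | prime p \<and> p \<le> N \<and> p \<in> S. \<Sum>t | t \<in> {1..N div p} \<and> coprime t (primorial p). real_of_int (moebius t) * F (p * t))"
proof -
  let ?A = "{n. n \<in> {2..N} \<and> lpd n \<in> S}"
  let ?P = "{p. prime p \<and> p \<le> N \<and> p \<in> S}"
  let ?T = "\<lambda>p. {t. t \<in> {1..N div p} \<and> coprime t (primorial p)}"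
  have "(\<Sum>n\<in>?A. real_of_int (moebius n) * F n) = (\<Sum>n | n \<in> ?A \<and> \<not> (lpd n)^2 dvd n. real_of_int (moebius n) * F n)"
  proof (rule sum.mono_neutral_right)
    have "moebius n = 0" if "n \<in> {2..N}" "(lpd n)^2 dvd n" for n
    proof -
      have "\<not> is_unit (lpd n)" using lpd_prime[of n] that by auto
      then show ?thesis using that by (auto simp: moebius_def squarefree_def)
    qed
    then show "\<forall>n\<in>?A - {n. n \<in> ?A \<and> \<not> (lpd n)^2 dvd n}. real_of_int (moebius n) * F n = 0" by auto
  qed auto
  also have "\<dots> = (\<Sum>(p, t)\<in>Sigma ?P ?T. - (real_of_int (moebius t) * F (p * t)))"
  proof (rule sum.reindex_bij_witness[where i = "\<lambda>(p, t). p * t" and j = "\<lambda>n. (lpd n, n div lpd n)"])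
    fix n assume n: "n \<in> {n. n \<in> ?A \<and> \<not> (lpd n)^2 dvd n}"
    then have n2: "n \<ge> 2" "n \<le> N" by auto
    note lp = lpd_prime[OF n2(1)] lpd_dvd[OF n2(1)]
    then obtain t where t: "n = lpd n * t" by auto
    have t0: "t > 0" using t n2 by (cases "t = 0") auto
    have nt: "n div lpd n = t" using t lp prime_gt_0_nat by (metis nonzero_mult_div_cancel_left not_gr_zero)
    show "(case (lpd n, n div lpd n) of (p, t) \<Rightarrow> p * t) = n" using t nt by simp
    have ndvd: "\<not> lpd n dvd t" using n t by (metis (no_types, lifting) dvd_mult_div_cancel lp(2) mem_Collect_eq mult_dvd_mono dvd_refl power2_eq_square)
    have cop: "coprime t (primorial (lpd n))"
      unfolding coprime_primorial_iff
    proof (intro allI impI)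
      fix q assume q: "prime q" "q dvd t"
      then have "lpd n \<le> q" using lpd_le[of q n] t by (metis dvd_mult)
      moreover have "q \<noteq> lpd n" using q ndvd by auto
      ultimately show "lpd n < q" by simp
    qed
    have tN: "t \<le> N div lpd n" using nt n2 div_le_mono by metis
    show "(lpd n, n div lpd n) \<in> Sigma ?P ?T"
      using n lp lpd_le_self[OF n2(1)] cop tN t0 nt by auto
    show "(case (lpd n, n div lpd n) of (p, t) \<Rightarrow> - (real_of_int (moebius t) * F (p * t))) = real_of_int (moebius n) * F n"
      using moebius_prime_mult[OF lp(1) ndvd] t nt by simp
  next
    fix x assume x: "x \<in> Sigma ?P ?T"
    then obtain p t where pt: "x = (p, t)" "prime p" "p \<le> N" "p \<in> S" "1 \<le> t" "t \<le> N div p" "coprime t (primorial p)" by auto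
    have p2: "p \<ge> 2" using pt prime_ge_2_nat by auto
    have rough: "q > p" if "prime q" "q dvd t" for q using pt(7) that by (auto simp: coprime_primorial_iff)
    have lp: "lpd (p * t) = p"
    proof (rule lpd_eqI)
      fix q assume "prime q" "q dvd p * t"
      then have "q dvd p \<or> q dvd t" by (simp add: prime_dvd_mult_iff)
      then show "p \<le> q" using rough[OF \<open>prime q\<close>] \<open>prime q\<close> pt(2) primes_dvd_imp_eq by (metis order.refl order.strict_implies_order)
    qed (use pt in auto)
    have "p * t \<le> N" using pt(6) p2 by (simp add: less_eq_div_iff_mult_less_eq mult.commute)
    moreover have "p * t \<ge> 2" using p2 pt(5) mult_le_mono[of 2 p 1 t] by simp
    moreover have "\<not> p ^ 2 dvd p * t" using rough[of p] pt(2) p2 by (auto simp: power2_eq_square)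
    ultimately show "(case x of (p, t) \<Rightarrow> p * t) \<in> {n. n \<in> ?A \<and> \<not> (lpd n)^2 dvd n}"
      using pt lp by auto
    show "(lpd (case x of (p, t) \<Rightarrow> p * t), (case x of (p, t) \<Rightarrow> p * t) div lpd (case x of (p, t) \<Rightarrow> p * t)) = x"
      using pt lp p2 by auto
  qed
  also have "\<dots> = (\<Sum>p\<in>?P. \<Sum>t\<in>?T p. - (real_of_int (moebius t) * F (p * t)))"
    by (rule sum.Sigma[symmetric]) auto
  finally show ?thesis by (simp add: sum_negf)
qed

section \<open>Integers without small prime factors\<close>

lemma card_coprime_le:
  assumes P: "P > 0"
  shows "card {n \<in> {1..N}. coprime n P} \<le> (N div P + 1) * totient P"
proof -
  have "{n \<in> {1..N}. coprime n P} \<subseteq> (\<lambda>(i, r). i * P + r) ` ({0..N div P} \<times> totatives P)"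
  proof
    fix n assume n: "n \<in> {n \<in> {1..N}. coprime n P}"
    \<comment> \<open>Blocks of length P start at 1, so that residues lie in {1..P}, the range of
      \<open>totatives\<close>; hence the shift by one.\<close>
    define i r where "i = (n - 1) div P" and "r = (n - 1) mod P + 1"
    have eq: "n = i * P + r" using n div_mult_mod_eq[of "n - 1" P] by (simp add: i_def r_def)
    have "r \<le> P" "r > 0" using mod_less_divisor[OF P, of "n - 1"] by (auto simp: r_def)
    moreover have "coprime r P"
    proof -
      have "coprime P n" using n by (simp add: coprime_commute)
      then have "gcd P (i * P + r) = 1" by (subst (asm) eq) (simp only: coprime_iff_gcd_eq_1)
      then have "gcd P r = 1" by (simp only: gcd_add_mult)
      then show ?thesis by (metis coprime_commute coprime_iff_gcd_eq_1)
    qed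
    moreover have "i \<le> N div P" using n by (auto simp: i_def intro!: div_le_mono)
    ultimately show "n \<in> (\<lambda>(i, r). i * P + r) ` ({0..N div P} \<times> totatives P)"
      using eq by (intro image_eqI[of _ _ "(i, r)"]) (auto simp: totatives_def)
  qed
  then have "card {n \<in> {1..N}. coprime n P} \<le> card ({0..N div P} \<times> totatives P)"
    by (rule surj_card_le[rotated]) auto
  then show ?thesis by (simp add: totient_def card_cartesian_product)
qed

text \<open>If the sums were bounded, the tail beyond some K would be below 1/2; as ln p \<le> ln N,
  the primes in (K, N] would give at most half of ln N to the sum of ln p / p, against ln N - O(1)
  by Mertens.\<close>

lemma sum_prime_recip_unbounded: "\<exists>K. (\<Sum>p | prime p \<and> p \<le> K. 1 / real p) \<ge> B"
proof (rule ccontr)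
  assume neg: "\<not> ?thesis"
  obtain C where C: "C \<ge> 0" "\<And>N. N \<ge> 1 \<Longrightarrow> \<bar>(\<Sum>p | prime p \<and> p \<le> N. ln (real p) / real p) - ln (real N)\<bar> \<le> C"
    using mertens_first by blast
  let ?f = "\<lambda>n. if prime n then 1 / real n else 0"
  have fs: "(\<Sum>n\<le>K. ?f n) = (\<Sum>p | prime p \<and> p \<le> K. 1 / real p)" for K
    by (rule sum.mono_neutral_cong_right) auto
  have "summable ?f"
  proof (rule bounded_imp_summable)
    show "(\<Sum>n\<le>K. ?f n) \<le> B" for K using neg unfolding fs by (metis linear)
  qed auto
  then have "\<exists>K. \<forall>m\<ge>K. \<forall>n. norm (sum ?f {m..<n}) < 1/2"
    unfolding summable_Cauchy by (rule allE[where x = "1/2"]) auto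
  then obtain K where K: "\<And>n. norm (sum ?f {K..<n}) < 1/2" by blast
  have bound: "ln (real N) - C \<le> ln (real K + 1) + C + ln (real N) / 2" if N: "N > K" for N
  proof -
    have "(\<Sum>p | prime p \<and> p \<le> N. ln (real p) / real p) =
        (\<Sum>p | prime p \<and> p \<le> K. ln (real p) / real p) + (\<Sum>p | prime p \<and> K < p \<and> p \<le> N. ln (real p) / real p)"
      using N by (subst sum.union_disjoint[symmetric]) (auto intro!: sum.cong)
    also have "(\<Sum>p | prime p \<and> p \<le> K. ln (real p) / real p) \<le> ln (real K + 1) + C"
    proof (cases "K = 0")
      case True
      then have "{p. prime p \<and> p \<le> K} = {}" by (auto simp: prime_gt_0_nat)
      then show ?thesis using C True by (simp)
    next
      case False
      then have "ln (real K) \<le> ln (real K + 1)" by simp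
      then show ?thesis using C(2)[of K] False by linarith
    qed
    also have "(\<Sum>p | prime p \<and> K < p \<and> p \<le> N. ln (real p) / real p) \<le> (\<Sum>p | prime p \<and> K < p \<and> p \<le> N. ln (real N) * (1 / real p))"
      by (intro sum_mono) (auto intro!: divide_right_mono simp: prime_gt_0_nat)
    also have "\<dots> = ln (real N) * (\<Sum>p | prime p \<and> K < p \<and> p \<le> N. 1 / real p)"
      by (simp add: sum_distrib_left)
    also have "(\<Sum>p | prime p \<and> K < p \<and> p \<le> N. 1 / real p) \<le> sum ?f {K..<Suc N}"
    proof -
      have "(\<Sum>p | prime p \<and> K < p \<and> p \<le> N. 1 / real p) = (\<Sum>p | prime p \<and> K < p \<and> p \<le> N. ?f p)"
        by (intro sum.cong) auto
      also have "\<dots> \<le> sum ?f {K..<Suc N}" by (rule sum_mono2) auto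
      finally show ?thesis .
    qed
    also have "sum ?f {K..<Suc N} \<le> 1/2" using K[of "Suc N"] by simp
    finally have "(\<Sum>p | prime p \<and> p \<le> N. ln (real p) / real p) \<le> ln (real K + 1) + C + ln (real N) / 2"
      using N by (simp add: mult_left_mono)
    then show ?thesis using C(2)[of N] N by linarith
  qed
  have "filterlim (\<lambda>N. ln (real N) / 2) at_top sequentially" by real_asymp
  then have "\<forall>\<^sub>F N in sequentially. ln (real N) / 2 > ln (real K + 1) + 2 * C"
    unfolding filterlim_at_top_dense by (rule spec)
  moreover have "\<forall>\<^sub>F N in sequentially. N > K" by (rule eventually_gt_at_top)
  ultimately have "\<forall>\<^sub>F N::nat in sequentially. False"
  proof eventually_elim
    case (elim N)
    then show ?case using bound[of N] by (simp add: field_simps)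
  qed
  then show False by simp
qed

text \<open>The proportion \<phi>(P) / P is a product of factors 1 - 1 / p \<le> exp(-1 / p), and K
  is chosen so that the sum of 1 / p reaches - ln \<eta>.\<close>

lemma rough_count_small:
  assumes "\<eta> > 0"
  obtains K where "\<And>N. real (card {n \<in> {1..N}. coprime n (primorial K)}) \<le> \<eta> * real N + real (primorial K)"
proof -
  obtain K where K: "(\<Sum>p | prime p \<and> p \<le> K. 1 / real p) \<ge> - ln \<eta>" using sum_prime_recip_unbounded by blast
  let ?P = "primorial K"
  have "real (totient ?P) = real ?P * (\<Prod>p | prime p \<and> p \<le> K. 1 - 1 / real p)"
    by (simp add: totient_formula2 prime_factors_primorial)
  also have "(\<Prod>p | prime p \<and> p \<le> K. 1 - 1 / real p) \<le> (\<Prod>p | prime p \<and> p \<le> K. exp (- (1 / real p)))"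
  proof (rule prod_mono)
    fix p assume "p \<in> {p. prime p \<and> p \<le> K}"
    then have "real p \<ge> 1" using prime_ge_1_nat[of p] by auto
    then show "0 \<le> 1 - 1 / real p \<and> 1 - 1 / real p \<le> exp (- (1 / real p))"
      using exp_ge_add_one_self[of "- (1 / real p)"] by simp
  qed
  also have "\<dots> = exp (- (\<Sum>p | prime p \<and> p \<le> K. 1 / real p))"
    by (simp add: exp_sum sum_negf[symmetric])
  also have "\<dots> \<le> exp (ln \<eta>)" using K by (simp del: exp_ln)
  also have "\<dots> = \<eta>" using assms by simp
  finally have tot: "real (totient ?P) \<le> real ?P * \<eta>" by (simp add: mult_left_mono)
  have "real (card {n \<in> {1..N}. coprime n ?P}) \<le> \<eta> * real N + real ?P" for N
  proof -
    have "real (card {n \<in> {1..N}. coprime n ?P}) \<le> real ((N div ?P + 1) * totient ?P)"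
      using card_coprime_le[OF primorial_pos] by (simp only: of_nat_le_iff)
    also have "\<dots> = real (N div ?P) * real (totient ?P) + real (totient ?P)" by (simp add: algebra_simps)
    also have "real (N div ?P) * real (totient ?P) \<le> (real N / real ?P) * (real ?P * \<eta>)"
      using assms by (intro mult_mono tot of_nat_div_le_of_nat) auto
    also have "\<dots> = \<eta> * real N" using primorial_pos[of K] by simp
    also have "real (totient ?P) \<le> real ?P" using totient_le by simp
    finally show ?thesis by simp
  qed
  then show ?thesis by (rule that)
qed

text \<open>For least primes above K the trivial bound by the number of integers without prime
  factors up to K suffices. The finitely many p \<le> K involve single Moebius sums, whose absolute
  values are added. Neither step looks at S, so C does not depend on S; this matters because the set
  is later cut off at a bound growing with N.\<close>

lemma moebius_lpd_sum_small:
  assumes "\<eta> > 0"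
  obtains C where "C \<ge> 0" "\<And>S N. \<bar>\<Sum>n | n \<in> {2..N} \<and> lpd n \<in> S. real_of_int (moebius n)\<bar> \<le> \<eta> * real N + C"
proof -
  obtain K where K: "\<And>N. real (card {n \<in> {1..N}. coprime n (primorial K)}) \<le> (\<eta> / 2) * real N + real (primorial K)"
    using rough_count_small[of "\<eta> / 2"] assms by auto
  let ?PK = "{p. prime p \<and> p \<le> K}"
  \<comment> \<open>An equal share of \<eta> / 2 for each of the at most K + 1 primes up to
    K.\<close>
  define \<eta>' where "\<eta>' = \<eta> / (2 * (real K + 1))"
  have \<eta>': "\<eta>' > 0" using assms by (simp add: \<eta>'_def)
  have "\<forall>p. \<exists>C\<ge>0. \<forall>N. \<bar>moebius_sum (primorial p) N\<bar> \<le> \<eta>' * real N + C"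
    using moebius_sum_small[OF primorial_pos \<eta>'] by metis
  then obtain c where c: "\<And>p. c p \<ge> 0" "\<And>p N. \<bar>moebius_sum (primorial p) N\<bar> \<le> \<eta>' * real N + c p" by metis
  define C where "C = (\<Sum>p\<in>?PK. c p) + real (primorial K)"
  have "\<bar>\<Sum>n | n \<in> {2..N} \<and> lpd n \<in> S. real_of_int (moebius n)\<bar> \<le> \<eta> * real N + C" for S N
  proof -
    let ?f = "\<lambda>n. real_of_int (moebius n)"
    have split: "(\<Sum>n | n \<in> {2..N} \<and> lpd n \<in> S. ?f n) = (\<Sum>n | n \<in> {2..N} \<and> lpd n \<in> S \<inter> {..K}. ?f n) +
        (\<Sum>n | n \<in> {2..N} \<and> lpd n \<in> S - {..K}. ?f n)"
      by (subst sum.union_disjoint[symmetric]) (auto intro!: sum.cong)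
    have "(\<Sum>n | n \<in> {2..N} \<and> lpd n \<in> S \<inter> {..K}. ?f n) =
       - (\<Sum>p | prime p \<and> p \<le> N \<and> p \<in> S \<inter> {..K}. moebius_sum (primorial p) (N div p))"
      using sum_moebius_lpd[where N = N and S = "S \<inter> {..K}" and F = "\<lambda>_. 1"] by (simp add: moebius_sum_def)
    also have "\<bar>\<dots>\<bar> \<le> (\<Sum>p | prime p \<and> p \<le> N \<and> p \<in> S \<inter> {..K}. \<bar>moebius_sum (primorial p) (N div p)\<bar>)"
      unfolding abs_minus_cancel by (rule sum_abs)
    also have "\<dots> \<le> (\<Sum>p\<in>?PK. \<bar>moebius_sum (primorial p) (N div p)\<bar>)"
      by (rule sum_mono2) auto
    also have "\<dots> \<le> (\<Sum>p\<in>?PK. \<eta>' * real N + c p)"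
    proof (rule sum_mono)
      fix p
      have "\<bar>moebius_sum (primorial p) (N div p)\<bar> \<le> \<eta>' * real (N div p) + c p" by (rule c)
      also have "\<eta>' * real (N div p) \<le> \<eta>' * real N" using \<eta>' by (intro mult_left_mono) auto
      finally show "\<bar>moebius_sum (primorial p) (N div p)\<bar> \<le> \<eta>' * real N + c p" by simp
    qed
    also have "\<dots> = real (card ?PK) * (\<eta>' * real N) + (\<Sum>p\<in>?PK. c p)" by (simp add: sum.distrib)
    also have "real (card ?PK) * (\<eta>' * real N) \<le> (real K + 1) * (\<eta>' * real N)"
    proof -
      have "card ?PK \<le> card {..K}" by (rule card_mono) auto
      then show ?thesis using \<eta>' by (intro mult_right_mono) auto
    qed
    also have "\<dots> = \<eta> / 2 * real N"
    proof -
      have aux: "x * (\<eta> / (2 * x)) = \<eta> / 2" if "x > 0" for x :: real using that by simp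
      have "(real K + 1) * \<eta>' = \<eta> / 2" unfolding \<eta>'_def by (rule aux) simp
      then show ?thesis by (simp only: mult.assoc[symmetric])
    qed
    finally have 1: "\<bar>\<Sum>n | n \<in> {2..N} \<and> lpd n \<in> S \<inter> {..K}. ?f n\<bar> \<le> \<eta> / 2 * real N + (\<Sum>p\<in>?PK. c p)" by simp
    have "\<bar>\<Sum>n | n \<in> {2..N} \<and> lpd n \<in> S - {..K}. ?f n\<bar> \<le> (\<Sum>n | n \<in> {2..N} \<and> lpd n \<in> S - {..K}. 1)"
      by (rule order_trans[OF sum_abs sum_mono]) (rule abs_real_moebius_le_1)
    also have "\<dots> \<le> real (card {n \<in> {1..N}. coprime n (primorial K)})"
    proof -
      have "coprime n (primorial K)" if "n \<in> {2..N}" "lpd n \<notin> {..K}" for n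
        unfolding coprime_primorial_iff using that lpd_le[of _ n] by (auto intro: less_le_trans[of K "lpd n"])
      then have "{n. n \<in> {2..N} \<and> lpd n \<in> S - {..K}} \<subseteq> {n \<in> {1..N}. coprime n (primorial K)}" by auto
      then have "card {n. n \<in> {2..N} \<and> lpd n \<in> S - {..K}} \<le> card {n \<in> {1..N}. coprime n (primorial K)}"
        by (rule card_mono[rotated]) auto
      then show ?thesis by simp
    qed
    also note K[of N]
    finally show ?thesis using 1 split unfolding C_def by (simp add: field_simps)
  qed
  moreover have "C \<ge> 0" using c(1) by (auto simp: C_def intro!: add_nonneg_nonneg sum_nonneg)
  ultimately show ?thesis using that by blast
qed

text \<open>Axer's argument: on \<open>n > N / B\<close> both \<open>N / n\<close> and \<open>N div n\<close> are decreasing and bounded by \<open>B\<close>.\<close>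

lemma axer_bound:
  fixes f :: "nat \<Rightarrow> real"
  assumes f: "\<And>n. \<bar>f n\<bar> \<le> 1" and F: "\<And>M. \<bar>\<Sum>n=1..M. f n\<bar> \<le> \<eta> * real M + C" and "\<eta> \<ge> 0" "B \<ge> 1"
  shows "\<bar>\<Sum>n=1..N. f n * (real (N mod n) / real n)\<bar> \<le> real N / real B + 4 * real B * (\<eta> * real N + C)"
proof (cases "N = 0")
  case True
  have "C \<ge> 0" using F[of 0] by simp
  then show ?thesis using True by simp
next
  case False
  \<comment> \<open>Terms below a are at most 1 in modulus and cost N / B. From a on there are two
    weights, each against sums over intervals, which are differences of two initial sums; hence the
    factor 4.\<close>
  define a where "a = N div B + 1"
  have C: "C \<ge> 0" using F[of 0] by simp
  have a: "a \<ge> 1" "N < a * B" using \<open>B \<ge> 1\<close> dividend_less_div_times[of B N]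
    by (simp_all add: a_def add.commute)
  let ?g = "\<lambda>n. f n * (real (N mod n) / real n)"
  have "{1..N} = {1..N div B} \<union> {a..N}" by (auto simp: a_def intro: order_trans[OF _ div_le_dividend])
  then have "(\<Sum>n=1..N. ?g n) = (\<Sum>n=1..N div B. ?g n) + (\<Sum>n=a..N. ?g n)"
    by (simp only:) (subst sum.union_disjoint, auto simp: a_def)
  moreover have "\<bar>\<Sum>n=1..N div B. ?g n\<bar> \<le> real N / real B"
  proof -
    have "\<bar>\<Sum>n=1..N div B. ?g n\<bar> \<le> (\<Sum>n=1..N div B. 1)"
    proof (rule order_trans[OF sum_abs sum_mono])
      fix n assume "n \<in> {1..N div B}"
      then have "real (N mod n) / real n \<le> 1" by (auto simp: order_less_imp_le)
      then show "\<bar>?g n\<bar> \<le> 1" unfolding abs_mult abs_divide abs_of_nat using f by (intro mult_le_one) auto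
    qed
    also have "\<dots> = real (N div B)" by simp
    also have "\<dots> \<le> real N / real B" by (rule of_nat_div_le_of_nat)
    finally show ?thesis .
  qed
  moreover have "\<bar>\<Sum>n=a..N. ?g n\<bar> \<le> 4 * real B * (\<eta> * real N + C)"
  proof (cases "a \<le> N")
    case aN: True
    let ?V = "2 * (\<eta> * real N + C)"
    have V: "norm (\<Sum>i=a..n. f i) \<le> ?V" if "a \<le> n" "n \<le> N" for n
    proof -
      have "{1..n} = {1..a - 1} \<union> {a..n}" using a that by auto
      then have "(\<Sum>i=1..n. f i) = (\<Sum>i=1..a-1. f i) + (\<Sum>i=a..n. f i)"
        by (simp only:) (subst sum.union_disjoint, use a in auto)
      then have "\<bar>\<Sum>i=a..n. f i\<bar> \<le> (\<eta> * real n + C) + (\<eta> * real (a - 1) + C)"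
        using F[of n] F[of "a - 1"] by linarith
      also have "\<dots> \<le> (\<eta> * real N + C) + (\<eta> * real N + C)"
        using that a aN \<open>\<eta> \<ge> 0\<close> by (intro add_mono mult_left_mono) auto
      finally show ?thesis by simp
    qed
    have V0: "0 \<le> ?V" using \<open>\<eta> \<ge> 0\<close> C by simp
    have Nn: "real N / real a \<le> real B"
    proof -
      have "real N \<le> real a * real B" using a(2) by (metis less_imp_le of_nat_le_iff of_nat_mult)
      then show ?thesis using a by (simp add: field_simps)
    qed
    have 1: "norm (\<Sum>n=a..N. (real N / real n) *\<^sub>R f n) \<le> (real N / real a) * ?V"
      using a aN V by (intro abel_inequality) (auto intro!: divide_left_mono)
    have 2: "norm (\<Sum>n=a..N. real (N div n) *\<^sub>R f n) \<le> real (N div a) * ?V"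
      using a aN V by (intro abel_inequality) (auto intro!: div_le_mono2)
    have "(\<Sum>n=a..N. ?g n) = (\<Sum>n=a..N. (real N / real n) *\<^sub>R f n) - (\<Sum>n=a..N. real (N div n) *\<^sub>R f n)"
      unfolding real_nat_div by (simp add: sum_subtractf[symmetric] algebra_simps)
    then have "\<bar>\<Sum>n=a..N. ?g n\<bar> \<le> (real N / real a) * ?V + real (N div a) * ?V"
      using 1 2 by (simp only: real_norm_def)
    also have "\<dots> \<le> real B * ?V + real B * ?V"
      using Nn V0 order_trans[OF of_nat_div_le_of_nat Nn] by (intro add_mono mult_right_mono) auto
    finally show ?thesis by (simp add: algebra_simps)
  next
    case False
    then show ?thesis using \<open>\<eta> \<ge> 0\<close> C by simp
  qed
  ultimately show ?thesis by linarith
qed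

section \<open>Logarithmic density of sets of primes\<close>

definition log_prime_dev :: "nat set \<Rightarrow> real \<Rightarrow> nat \<Rightarrow> real" where
  "log_prime_dev S \<delta> N = (\<Sum>p | prime p \<and> p \<le> N. ((if p \<in> S then 1 else 0) - \<delta>) * (ln (real p) / real p))"

text \<open>By Mertens the full sum of ln p / p is ln N + O(1), so this says that S has relative
  density \<delta> among the primes weighted by ln p / p.\<close>

definition has_log_density :: "nat set \<Rightarrow> real \<Rightarrow> bool" where
  "has_log_density S \<delta> \<longleftrightarrow> (\<lambda>N. log_prime_dev S \<delta> N / ln (real N)) \<longlonglongrightarrow> 0"

lemma log_prime_dev_small:
  assumes "has_log_density S \<delta>" "\<eta> > 0"
  obtains C where "C \<ge> 0" "\<And>N. N \<ge> 1 \<Longrightarrow> \<bar>log_prime_dev S \<delta> N\<bar> \<le> \<eta> * ln (real N) + C"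
proof -
  have "\<forall>\<^sub>F N in sequentially. \<bar>log_prime_dev S \<delta> N / ln (real N)\<bar> < \<eta>"
    using tendsto_rabs_zero[OF assms(1)[unfolded has_log_density_def]] assms(2) by (rule order_tendstoD(2))
  then obtain N0 where N0: "\<And>N. N \<ge> N0 \<Longrightarrow> \<bar>log_prime_dev S \<delta> N / ln (real N)\<bar> < \<eta>"
    by (auto simp: eventually_sequentially)
  define C where "C = (\<Sum>N\<le>max N0 1. \<bar>log_prime_dev S \<delta> N\<bar>)"
  have C: "C \<ge> 0" by (auto simp: C_def intro: sum_nonneg)
  have "\<bar>log_prime_dev S \<delta> N\<bar> \<le> \<eta> * ln (real N) + C" if "N \<ge> 1" for N
  proof (cases "N \<le> max N0 1")
    case True
    then have "\<bar>log_prime_dev S \<delta> N\<bar> \<le> C" unfolding C_def by (intro member_le_sum) auto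
    moreover have "\<eta> * ln (real N) \<ge> 0" using that assms(2) by simp
    ultimately show ?thesis by linarith
  next
    case False
    then have "ln (real N) > 0" "\<bar>log_prime_dev S \<delta> N / ln (real N)\<bar> < \<eta>" using N0[of N] by auto
    then have "\<bar>log_prime_dev S \<delta> N\<bar> < \<eta> * ln (real N)" by (simp add: abs_divide field_simps)
    then show ?thesis using C by linarith
  qed
  then show ?thesis using C that by blast
qed

text \<open>Abel summation with the decreasing weight 1 / ln n turns ln p / p into 1 / p. Apart from
  D, the bound depends only on the left end, so the right end may vary freely.\<close>

lemma log_density_interval:
  assumes D: "\<And>n. n \<ge> 1 \<Longrightarrow> n \<le> b \<Longrightarrow> \<bar>log_prime_dev S \<delta> n\<bar> \<le> D" and a: "a \<ge> 2" "a \<le> b"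
  shows "\<bar>\<Sum>p | prime p \<and> p \<in> {a..b}. ((if p \<in> S then 1 else 0) - \<delta>) / real p\<bar> \<le> 2 * D / ln (real a)"
proof -
  let ?v = "\<lambda>n. if prime n then ((if n \<in> S then 1 else 0) - \<delta>) * (ln (real n) / real n) else 0"
  let ?w = "\<lambda>n. 1 / ln (real n)"
  have dev: "log_prime_dev S \<delta> n = (\<Sum>i=1..n. ?v i)" for n
    unfolding log_prime_dev_def by (rule sum.mono_neutral_cong_left) (auto simp: Suc_le_eq prime_gt_0_nat)
  have "norm (\<Sum>n=a..b. ?w n *\<^sub>R ?v n) \<le> ?w a * (2 * D)"
  proof (rule abel_inequality)
    fix n assume n: "a \<le> n" "n < b"
    show "?w (Suc n) \<le> ?w n" using n a by (intro divide_left_mono) auto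
  next
    fix n assume n: "a \<le> n" "n \<le> b"
    have "{1..n} = {1..a - 1} \<union> {a..n}" using a n by auto
    then have "log_prime_dev S \<delta> n = log_prime_dev S \<delta> (a - 1) + (\<Sum>i=a..n. ?v i)"
      unfolding dev by (simp only:) (subst sum.union_disjoint, use a in auto)
    moreover have "\<bar>log_prime_dev S \<delta> n\<bar> \<le> D" "\<bar>log_prime_dev S \<delta> (a - 1)\<bar> \<le> D" using D a n by auto
    ultimately show "norm (\<Sum>i=a..n. ?v i) \<le> 2 * D" unfolding real_norm_def by linarith
  qed (use a in auto)
  also have "(\<Sum>n=a..b. ?w n *\<^sub>R ?v n) = (\<Sum>p | prime p \<and> p \<in> {a..b}. ((if p \<in> S then 1 else 0) - \<delta>) / real p)"
    using a by (intro sum.mono_neutral_cong_right) auto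
  finally show ?thesis by simp
qed

text \<open>A squarefree t is the product of its set of prime factors, so the sum is part of the
  expansion of the product of 1 + 1 / p \<le> exp(1 / p).\<close>

lemma sum_rough_squarefree_recip:
  assumes A: "finite A" "\<And>p. p \<in> A \<Longrightarrow> prime p"
    and T: "finite T" "\<And>t. t \<in> T \<Longrightarrow> squarefree t \<and> prime_factors t \<subseteq> A"
  shows "(\<Sum>t\<in>T. 1 / real t) \<le> exp (\<Sum>p\<in>A. 1 / real p)"
proof -
  have prod_pf: "\<Prod>(prime_factors t) = t" if "squarefree t" for t :: nat
  proof -
    have "t \<noteq> 0" using that by (cases "t = 0") auto
    then have "t = (\<Prod>p\<in>prime_factors t. p ^ multiplicity p t)"
      using prime_factorization_nat by blast
    also have "\<dots> = (\<Prod>p\<in>prime_factors t. p)"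
    proof (rule prod.cong)
      fix p assume p: "p \<in> prime_factors t"
      then have "multiplicity p t = 1"
        using that squarefree_factorial_semiring'[OF \<open>t \<noteq> 0\<close>] by blast
      then show "p ^ multiplicity p t = p" by simp
    qed auto
    finally show ?thesis by simp
  qed
  have inj: "inj_on prime_factors T" using T prod_pf by (intro inj_on_inverseI[where g = "\<lambda>X. \<Prod>X"]) auto
  have "(\<Sum>t\<in>T. 1 / real t) = (\<Sum>t\<in>T. \<Prod>p\<in>prime_factors t. 1 / real p)"
  proof (rule sum.cong)
    fix t assume "t \<in> T"
    then have "(\<Prod>p\<in>prime_factors t. real p) = real t"
      unfolding of_nat_prod[symmetric] using T(2)[of t] prod_pf[of t] by simp
    then show "1 / real t = (\<Prod>p\<in>prime_factors t. 1 / real p)" by (simp add: prod_dividef)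
  qed auto
  also have "\<dots> = (\<Sum>X\<in>prime_factors ` T. \<Prod>p\<in>X. 1 / real p)"
    by (simp add: sum.reindex[OF inj])
  also have "\<dots> \<le> (\<Sum>X\<in>Pow A. \<Prod>p\<in>X. 1 / real p)"
    using A T by (intro sum_mono2) (auto intro: prod_nonneg)
  also have "\<dots> = (\<Prod>p\<in>A. 1 / real p + 1)"
    using prod_add[OF A(1), of "\<lambda>p. 1 / real p" "\<lambda>_. 1"] by simp
  also have "\<dots> \<le> (\<Prod>p\<in>A. exp (1 / real p))"
    by (intro prod_mono) (auto simp: add.commute)
  also have "\<dots> = exp (\<Sum>p\<in>A. 1 / real p)" using A by (simp add: exp_sum)
  finally show ?thesis .
qed

text \<open>For fixed t the admissible p, if any, are all primes from z up to some b, because p t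
  \<le> N and the absence of primes up to p in t both pass to smaller p; the deviation over such an
  interval is at most 2 D / ln z. The t that occur are squarefree with prime factors in [z, N], and
  for z near N^\<epsilon> the exponential stays bounded.\<close>

lemma large_lpd_sum_bound:
  assumes D: "\<And>n. n \<ge> 1 \<Longrightarrow> n \<le> N \<Longrightarrow> \<bar>log_prime_dev S \<delta> n\<bar> \<le> D" and z: "z \<ge> 2" and N: "N \<ge> 1"
  shows "\<bar>\<Sum>n | n \<in> {2..N} \<and> lpd n \<ge> z. ((if lpd n \<in> S then 1 else 0) - \<delta>) * real_of_int (moebius n) / real n\<bar>
      \<le> 2 * D / ln (real z) * exp (\<Sum>p | prime p \<and> p \<in> {z..N}. 1 / real p)"
proof -
  let ?c = "\<lambda>p. (if p \<in> S then 1 else 0) - \<delta>"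
  let ?A = "{p. prime p \<and> p \<in> {z..N}}"
  define Q where "Q t = {p. prime p \<and> z \<le> p \<and> p * t \<le> N \<and> coprime t (primorial p)}" for t
  define T where "T = {t \<in> {1..N}. squarefree t \<and> prime_factors t \<subseteq> ?A}"
  have finQ: "finite (Q t)" if "t \<ge> 1" for t
  proof (rule finite_subset)
    show "Q t \<subseteq> {..N}"
    proof
      fix p assume "p \<in> Q t"
      then have "p * 1 \<le> N" using that order_trans[OF mult_le_mono2[OF that, of p]] by (auto simp: Q_def)
      then show "p \<in> {..N}" by simp
    qed
  qed auto
  have D0: "D \<ge> 0" using D[of 1] N by (auto intro: order_trans[OF abs_ge_zero])
  have inner: "\<bar>\<Sum>p\<in>Q t. ?c p / real p\<bar> \<le> 2 * D / ln (real z)" if t: "t \<in> {1..N}" for t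
  proof (cases "Q t = {}")
    case True
    show ?thesis using True z D0 by simp
  next
    case False
    define b where "b = Max (Q t)"
    have bQ: "b \<in> Q t" unfolding b_def using False finQ t by (intro Max_in) auto
    have "Q t = {p. prime p \<and> p \<in> {z..b}}"
    proof (intro equalityI subsetI)
      fix p assume "p \<in> Q t"
      then show "p \<in> {p. prime p \<and> p \<in> {z..b}}" using finQ t by (auto simp: Q_def b_def)
    next
      fix p assume p: "p \<in> {p. prime p \<and> p \<in> {z..b}}"
      then have "p * t \<le> b * t" by simp
      also have "b * t \<le> N" using bQ by (simp add: Q_def)
      finally have "p * t \<le> N" .
      moreover have "coprime t (primorial p)" using bQ p by (auto simp: Q_def coprime_primorial_iff)
      ultimately show "p \<in> Q t" using p bQ by (auto simp: Q_def)
    qed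
    moreover have "z \<le> b" using bQ by (auto simp: Q_def)
    moreover have "b \<le> N"
    proof -
      have "b * 1 \<le> b * t" using t by (intro mult_le_mono2) auto
      also have "b * t \<le> N" using bQ by (simp add: Q_def)
      finally show ?thesis by simp
    qed
    ultimately show ?thesis using z D by (simp only:) (intro log_density_interval, auto)
  qed
  have rough: "t \<in> T" if "t \<in> {1..N}" and Qt: "Q t \<noteq> {}" and mt: "moebius t \<noteq> 0" for t
  proof -
    obtain p where p: "p \<in> Q t" using Qt by auto
    have "squarefree t" using mt by (auto simp: moebius_def split: if_splits)
    moreover have "q \<in> ?A" if q: "q \<in> prime_factors t" for q
    proof -
      have "q > p" using p q by (auto simp: Q_def coprime_primorial_iff in_prime_factors_iff)
      moreover have "q \<le> t" using q \<open>t \<in> {1..N}\<close> by (auto simp: in_prime_factors_iff intro!: dvd_imp_le)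
      ultimately show ?thesis using q p \<open>t \<in> {1..N}\<close> by (auto simp: Q_def in_prime_factors_iff)
    qed
    ultimately show ?thesis using that(1) by (auto simp: T_def)
  qed
  let ?F = "\<lambda>n. ?c (lpd n) / real n"
  have "(\<Sum>n | n \<in> {2..N} \<and> lpd n \<ge> z. ?c (lpd n) * real_of_int (moebius n) / real n) =
     (\<Sum>n | n \<in> {2..N} \<and> lpd n \<in> {z..}. real_of_int (moebius n) * ?F n)"
    by (intro sum.cong) auto
  also have "\<dots> = - (\<Sum>p | prime p \<and> p \<le> N \<and> p \<in> {z..}. \<Sum>t | t \<in> {1..N div p} \<and> coprime t (primorial p). real_of_int (moebius t) * ?F (p * t))"
    by (rule sum_moebius_lpd)
  also have "(\<Sum>p | prime p \<and> p \<le> N \<and> p \<in> {z..}. \<Sum>t | t \<in> {1..N div p} \<and> coprime t (primorial p). real_of_int (moebius t) * ?F (p * t)) =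
     (\<Sum>p | prime p \<and> p \<le> N \<and> p \<in> {z..}. \<Sum>t | t \<in> {1..N} \<and> p \<in> Q t. real_of_int (moebius t) / real t * (?c p / real p))"
  proof (rule sum.cong, rule refl)
    fix p assume p: "p \<in> {p. prime p \<and> p \<le> N \<and> p \<in> {z..}}"
    then have p0: "p > 0" by (simp add: prime_gt_0_nat)
    have iff: "t \<le> N div p \<longleftrightarrow> p * t \<le> N" for t using p0 by (simp add: less_eq_div_iff_mult_less_eq mult.commute)
    show "(\<Sum>t | t \<in> {1..N div p} \<and> coprime t (primorial p). real_of_int (moebius t) * ?F (p * t)) =
        (\<Sum>t | t \<in> {1..N} \<and> p \<in> Q t. real_of_int (moebius t) / real t * (?c p / real p))"
    proof (rule sum.cong)
      show "{t. t \<in> {1..N div p} \<and> coprime t (primorial p)} = {t. t \<in> {1..N} \<and> p \<in> Q t}"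
      proof -
        have "t \<le> N" if "p * t \<le> N" for t
          using p0 that order_trans[OF mult_le_mono1[of 1 p t] that] by simp
        then show ?thesis using p iff by (auto simp: Q_def)
      qed
    next
      fix t assume t: "t \<in> {t. t \<in> {1..N} \<and> p \<in> Q t}"
      have "lpd (p * t) = p"
      proof (rule lpd_eqI)
        fix q assume q: "prime q" "q dvd p * t"
        then have "q dvd p \<or> q dvd t" by (simp add: prime_dvd_mult_iff)
        then show "p \<le> q"
        proof
          assume "q dvd p"
          then show ?thesis using q p primes_dvd_imp_eq by auto
        next
          assume "q dvd t"
          then show ?thesis using t q by (auto simp: Q_def coprime_primorial_iff)
        qed
      qed (use p in auto)
      then show "real_of_int (moebius t) * ?F (p * t) = real_of_int (moebius t) / real t * (?c p / real p)" by simp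
    qed
  qed
  also have "\<dots> = (\<Sum>t\<in>{1..N}. \<Sum>p | p \<in> {p. prime p \<and> p \<le> N \<and> p \<in> {z..}} \<and> p \<in> Q t. real_of_int (moebius t) / real t * (?c p / real p))"
    by (rule sum.swap_restrict) auto
  also have "\<dots> = (\<Sum>t\<in>{1..N}. real_of_int (moebius t) / real t * (\<Sum>p\<in>Q t. ?c p / real p))"
  proof (rule sum.cong, rule refl)
    fix t assume t: "t \<in> {1..N}"
    have "p \<le> N" if "p \<in> Q t" for p
    proof -
      have "p * 1 \<le> p * t" using t by (intro mult_le_mono2) auto
      also have "p * t \<le> N" using that by (simp add: Q_def)
      finally show ?thesis by simp
    qed
    then have "{p. p \<in> {p. prime p \<and> p \<le> N \<and> p \<in> {z..}} \<and> p \<in> Q t} = Q t" by (auto simp: Q_def)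
    then show "(\<Sum>p | p \<in> {p. prime p \<and> p \<le> N \<and> p \<in> {z..}} \<and> p \<in> Q t. real_of_int (moebius t) / real t * (?c p / real p)) =
      real_of_int (moebius t) / real t * (\<Sum>p\<in>Q t. ?c p / real p)" by (simp only: sum_distrib_left)
  qed
  also have "\<dots> = (\<Sum>t\<in>T. real_of_int (moebius t) / real t * (\<Sum>p\<in>Q t. ?c p / real p))"
  proof (rule sum.mono_neutral_right)
    show "\<forall>t\<in>{1..N} - T. real_of_int (moebius t) / real t * (\<Sum>p\<in>Q t. ?c p / real p) = 0"
      using rough by fastforce
  qed (auto simp: T_def)
  finally have eq: "(\<Sum>n | n \<in> {2..N} \<and> lpd n \<ge> z. ?c (lpd n) * real_of_int (moebius n) / real n) =
      - (\<Sum>t\<in>T. real_of_int (moebius t) / real t * (\<Sum>p\<in>Q t. ?c p / real p))" .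
  have "\<bar>\<Sum>t\<in>T. real_of_int (moebius t) / real t * (\<Sum>p\<in>Q t. ?c p / real p)\<bar> \<le> (\<Sum>t\<in>T. 1 / real t * (2 * D / ln (real z)))"
  proof (rule order_trans[OF sum_abs sum_mono])
    fix t assume "t \<in> T"
    then have t: "t \<in> {1..N}" by (auto simp: T_def)
    have "\<bar>real_of_int (moebius t) / real t\<bar> \<le> 1 / real t"
      using abs_real_moebius_le_1[of t] by (simp add: divide_right_mono)
    then show "\<bar>real_of_int (moebius t) / real t * (\<Sum>p\<in>Q t. ?c p / real p)\<bar> \<le> 1 / real t * (2 * D / ln (real z))"
      using inner[OF t] by (subst abs_mult) (intro mult_mono, auto)
  qed
  also have "\<dots> = 2 * D / ln (real z) * (\<Sum>t\<in>T. 1 / real t)"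
    unfolding sum_distrib_left by (intro sum.cong) (auto simp: mult.commute)
  also have "\<dots> \<le> 2 * D / ln (real z) * exp (\<Sum>p\<in>?A. 1 / real p)"
  proof -
    have "2 * D / ln (real z) \<ge> 0" using D0 z by simp
    then show ?thesis by (intro mult_left_mono sum_rough_squarefree_recip) (auto simp: T_def)
  qed
  finally show ?thesis unfolding eq by simp
qed

text \<open>Replacing N / n by N div n costs Axer's error. What remains is, up to sign, the number
  of pairs (p, j) with p < z in S and j \<le> N / p composed of primes up to p: the inner sums all
  have one sign. As p is the largest prime factor of p j, the pairs are counted among the z-smooth
  integers.\<close>

lemma small_lpd_sum_bound:
  assumes C: "\<And>S N. \<bar>\<Sum>n | n \<in> {2..N} \<and> lpd n \<in> S. real_of_int (moebius n)\<bar> \<le> \<eta> * real N + C"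
    and \<eta>: "\<eta> \<ge> 0" and B: "B \<ge> 1"
  shows "real N * \<bar>\<Sum>n | n \<in> {2..N} \<and> lpd n \<in> S \<inter> {..<z}. real_of_int (moebius n) / real n\<bar>
     \<le> real (smooth_count N (real z)) + (real N / real B + 4 * real B * (\<eta> * real N + C))"
proof -
  let ?S = "S \<inter> {..<z}"
  define f where "f n = (if n \<ge> 2 \<and> lpd n \<in> ?S then real_of_int (moebius n) else 0)" for n
  have sum_f: "(\<Sum>n=1..M. f n * G n) = (\<Sum>n | n \<in> {2..M} \<and> lpd n \<in> ?S. real_of_int (moebius n) * G n)" for M and G :: "nat \<Rightarrow> real"
    unfolding f_def by (rule sum.mono_neutral_cong_right) auto
  have f1: "\<bar>f n\<bar> \<le> 1" for n using abs_real_moebius_le_1[of n] by (auto simp: f_def)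
  have F: "\<bar>\<Sum>n=1..M. f n\<bar> \<le> \<eta> * real M + C" for M
    using C[of M ?S] sum_f[of "\<lambda>_. 1" M] by simp
  have ax: "\<bar>\<Sum>n=1..N. f n * (real (N mod n) / real n)\<bar> \<le> real N / real B + 4 * real B * (\<eta> * real N + C)"
    by (rule axer_bound[OF f1 F \<eta> B])
  let ?P = "{p. prime p \<and> p \<le> N \<and> p \<in> ?S}"
  define J where "J p = {j \<in> {1..N div p}. \<forall>q. prime q \<longrightarrow> q dvd j \<longrightarrow> q dvd primorial p}" for p
  have "(\<Sum>n=1..N. f n * real (N div n)) =
     - (\<Sum>p\<in>?P. \<Sum>t | t \<in> {1..N div p} \<and> coprime t (primorial p). real_of_int (moebius t) * real (N div (p * t)))"
    unfolding sum_f by (rule sum_moebius_lpd)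
  also have "(\<Sum>p\<in>?P. \<Sum>t | t \<in> {1..N div p} \<and> coprime t (primorial p). real_of_int (moebius t) * real (N div (p * t))) = (\<Sum>p\<in>?P. real (card (J p)))"
    unfolding J_def div_mult2_eq moebius_div_sum_count ..
  also have "(\<Sum>p\<in>?P. real (card (J p))) = real (card (Sigma ?P J))"
  proof -
    have "finite ?P" "\<forall>p\<in>?P. finite (J p)" by (auto simp: J_def)
    then show ?thesis by simp
  qed
  finally have eq: "\<bar>\<Sum>n=1..N. f n * real (N div n)\<bar> = real (card (Sigma ?P J))" by simp
  have Jle: "q \<le> p" if "j \<in> J p" "prime q" "q dvd j" for p j q
    using that prime_dvd_primorial_iff[of q p] by (auto simp: J_def)
  have "card (Sigma ?P J) \<le> smooth_count N (real z)"
    unfolding smooth_count_def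
  proof (rule card_inj_on_le[where f = "\<lambda>(p, j). p * j"])
    show "inj_on (\<lambda>(p, j). p * j) (Sigma ?P J)"
    proof (rule inj_onI, clarify)
      fix p j p' j' assume p: "prime p" and p': "prime p'" and j: "j \<in> J p" and j': "j' \<in> J p'" and eq: "p * j = p' * j'"
      have "p \<le> p'"
      proof -
        have "p dvd p' * j'" using eq by (metis dvd_triv_left)
        then have "p dvd p' \<or> p dvd j'" using p by (simp add: prime_dvd_mult_iff)
        then show ?thesis using primes_dvd_imp_eq[OF p p'] Jle[OF j' p] by auto
      qed
      moreover have "p' \<le> p"
      proof -
        have "p' dvd p * j" using eq by (metis dvd_triv_left)
        then have "p' dvd p \<or> p' dvd j" using p' by (simp add: prime_dvd_mult_iff)
        then show ?thesis using primes_dvd_imp_eq[OF p' p] Jle[OF j p'] by auto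
      qed
      ultimately have "p = p'" by simp
      then show "p = p' \<and> j = j'" using eq p prime_gt_0_nat[of p] by auto
    qed
    show "(\<lambda>(p, j). p * j) ` Sigma ?P J \<subseteq> {n \<in> {1..N}. \<forall>q. prime q \<longrightarrow> q dvd n \<longrightarrow> real q \<le> real z}"
    proof
      fix n assume "n \<in> (\<lambda>(p, j). p * j) ` Sigma ?P J"
      then obtain p j where p: "prime p" "p \<le> N" "p \<in> ?S" and j: "j \<in> J p" and n: "n = p * j" by auto
      have j1: "j \<ge> 1" "j \<le> N div p" using j by (auto simp: J_def)
      then have "p * j \<le> N" using prime_gt_0_nat[OF p(1)] by (simp add: less_eq_div_iff_mult_less_eq mult.commute)
      moreover have "p * j \<ge> 1" using j1 prime_gt_0_nat[OF p(1)] by (simp add: Suc_le_eq)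
      moreover have "real q \<le> real z" if q: "prime q" "q dvd p * j" for q
      proof -
        have "q dvd p \<or> q dvd j" using q by (simp add: prime_dvd_mult_iff)
        then have "q \<le> p" using primes_dvd_imp_eq[OF q(1) p(1)] Jle[OF j q(1)] by auto
        then show ?thesis using p(3) by auto
      qed
      ultimately show "n \<in> {n \<in> {1..N}. \<forall>q. prime q \<longrightarrow> q dvd n \<longrightarrow> real q \<le> real z}" unfolding n by auto
    qed
  qed auto
  with eq have main: "\<bar>\<Sum>n=1..N. f n * real (N div n)\<bar> \<le> real (smooth_count N (real z))" by simp
  have "real N * (\<Sum>n | n \<in> {2..N} \<and> lpd n \<in> ?S. real_of_int (moebius n) / real n) = (\<Sum>n=1..N. f n * (real N / real n))"
    unfolding sum_f sum_distrib_left by (intro sum.cong) auto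
  also have "\<dots> = (\<Sum>n=1..N. f n * real (N div n)) + (\<Sum>n=1..N. f n * (real (N mod n) / real n))"
    unfolding real_nat_div sum.distrib[symmetric] by (intro sum.cong) (auto simp: algebra_simps)
  finally have "real N * (\<Sum>n | n \<in> {2..N} \<and> lpd n \<in> ?S. real_of_int (moebius n) / real n) =
     (\<Sum>n=1..N. f n * real (N div n)) + (\<Sum>n=1..N. f n * (real (N mod n) / real n))" .
  then have "\<bar>real N * (\<Sum>n | n \<in> {2..N} \<and> lpd n \<in> ?S. real_of_int (moebius n) / real n)\<bar> \<le>
     real (smooth_count N (real z)) + (real N / real B + 4 * real B * (\<eta> * real N + C))"
    using main ax by linarith
  then show ?thesis by (simp add: abs_mult)
qed

lemma sum_prime_recip_interval_le:
  assumes C: "\<bar>(\<Sum>p | prime p \<and> p \<le> N. ln (real p) / real p) - ln (real N)\<bar> \<le> C" and z: "z \<ge> 2"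
  shows "(\<Sum>p | prime p \<and> p \<in> {z..N}. 1 / real p) \<le> (ln (real N) + C) / ln (real z)"
proof -
  have lz: "ln (real z) > 0" using z by simp
  have "(\<Sum>p | prime p \<and> p \<in> {z..N}. 1 / real p) * ln (real z) \<le> (\<Sum>p | prime p \<and> p \<in> {z..N}. ln (real p) / real p)"
    unfolding sum_distrib_right using z by (intro sum_mono) (auto intro!: divide_right_mono)
  also have "\<dots> \<le> (\<Sum>p | prime p \<and> p \<le> N. ln (real p) / real p)"
    by (rule sum_mono2) (auto intro: ln_div_nat_nonneg)
  also have "\<dots> \<le> ln (real N) + C" using C by linarith
  finally show ?thesis using lz by (simp add: field_simps)
qed

theorem moebius_lpd_log_density:
  assumes "has_log_density S \<delta>"
  shows "(\<lambda>N. - (\<Sum>n | n \<in> {2..N} \<and> lpd n \<in> S. real_of_int (moebius n) / real n)) \<longlonglongrightarrow> \<delta>"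
proof -
  let ?c = "\<lambda>p. (if p \<in> S then 1 else 0) - \<delta>"
  define g where "g N = (\<Sum>n=2..N. ?c (lpd n) * real_of_int (moebius n) / real n)" for N
  obtain C3 where C3: "C3 \<ge> 0" "\<And>N. N \<ge> 1 \<Longrightarrow> \<bar>(\<Sum>p | prime p \<and> p \<le> N. ln (real p) / real p) - ln (real N)\<bar> \<le> C3"
    using mertens_first by blast
  obtain C4 where C4: "C4 \<ge> 0" "\<And>N y. N \<ge> 2 \<Longrightarrow> y \<ge> 1 \<Longrightarrow>
     real (smooth_count N y) \<le> sqrt (real N) + 2 * real N * (ln y + C4) / ln (real N)"
    using smooth_count_le by blast
  have "g \<longlonglongrightarrow> 0"
  proof (rule tendstoI)
    fix e :: real assume e: "e > 0"
    \<comment> \<open>Below z the parts for S and for all primes are bounded separately, each by e1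
      / 2; the second carries the factor \<delta>, and together they give e / 2.\<close>
    define e1 where "e1 = e / (1 + \<bar>\<delta>\<bar>)"
    have e1: "e1 > 0" "(1 + \<bar>\<delta>\<bar>) * e1 = e" using e by (auto simp: e1_def)
    \<comment> \<open>With the B and \<eta> below, the limit 2 \<epsilon> + 1 / B + 4 B \<eta> of
      the bound is less than e1 / 4; its parts are the smooth numbers, Axer's initial range and
      Axer's remaining range.\<close>
    define \<epsilon> where "\<epsilon> = e1 / 16"
    have \<epsilon>: "\<epsilon> > 0" using e1 by (simp add: \<epsilon>_def)
    obtain B :: nat where B: "real B > 16 / e1" using reals_Archimedean2 by blast
    have B1: "B \<ge> 1" using B e1 by (cases B) (auto simp: field_simps)
    have BB: "1 / real B < e1 / 16" using B B1 e1 by (simp add: field_simps)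
    define \<eta> where "\<eta> = e1 / (64 * real B)"
    have \<eta>: "\<eta> > 0" "4 * real B * \<eta> = e1 / 16" using e1 B1 by (auto simp: \<eta>_def)
    obtain C1 where C1: "C1 \<ge> 0" "\<And>S N. \<bar>\<Sum>n | n \<in> {2..N} \<and> lpd n \<in> S. real_of_int (moebius n)\<bar> \<le> \<eta> * real N + C1"
      using moebius_lpd_sum_small[OF \<eta>(1)] by blast
    \<comment> \<open>Chosen after \<epsilon>: it has to absorb exp(1 / \<epsilon>), the weight of
      the squarefree t with prime factors between N^\<epsilon> and N, and the 1 / \<epsilon> from ln
      z.\<close>
    define \<eta>2 where "\<eta>2 = \<epsilon> * exp (- (1 / \<epsilon>)) * e / 16"
    have \<eta>2: "\<eta>2 > 0" using \<epsilon> e by (simp add: \<eta>2_def)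
    obtain C2 where C2: "C2 \<ge> 0" "\<And>N. N \<ge> 1 \<Longrightarrow> \<bar>log_prime_dev S \<delta> N\<bar> \<le> \<eta>2 * ln (real N) + C2"
      using log_prime_dev_small[OF assms \<eta>2] by blast
    have "(\<lambda>N. 1 / sqrt (real N) + 2 * (\<epsilon> * ln (real N) + ln 2 + C4) / ln (real N) + (1 / real B + 4 * real B * (\<eta> + C1 / real N))) \<longlonglongrightarrow>
        2 * \<epsilon> + (1 / real B + 4 * real B * \<eta>)"
      by real_asymp
    moreover have "2 * \<epsilon> + (1 / real B + 4 * real B * \<eta>) < e1 / 2" using BB \<eta>(2) e1 by (simp add: \<epsilon>_def)
    ultimately have ev1: "\<forall>\<^sub>F N in sequentially. 1 / sqrt (real N) + 2 * (\<epsilon> * ln (real N) + ln 2 + C4) / ln (real N) + (1 / real B + 4 * real B * (\<eta> + C1 / real N)) < e1 / 2"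
      by (rule order_tendstoD(2))
    have "(\<lambda>N. 2 * (\<eta>2 * ln (real N) + C2) / (\<epsilon> * ln (real N)) * exp ((ln (real N) + C3) / (\<epsilon> * ln (real N)))) \<longlonglongrightarrow> 2 * \<eta>2 / \<epsilon> * exp (1 / \<epsilon>)"
    proof -
      have a: "(\<lambda>N. 2 * (\<eta>2 * ln (real N) + C2) / (\<epsilon> * ln (real N))) \<longlonglongrightarrow> 2 * \<eta>2 * inverse \<epsilon>" using \<epsilon> by real_asymp
      have b: "(\<lambda>N. (ln (real N) + C3) / (\<epsilon> * ln (real N))) \<longlonglongrightarrow> inverse \<epsilon>" using \<epsilon> by real_asymp
      have r: "2 * \<eta>2 / \<epsilon> = 2 * \<eta>2 * inverse \<epsilon>" "1 / \<epsilon> = inverse \<epsilon>" by (simp_all add: field_simps)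
      show ?thesis unfolding r by (intro tendsto_mult tendsto_exp a b)
    qed
    moreover have "2 * \<eta>2 / \<epsilon> * exp (1 / \<epsilon>) < e / 2"
      using \<epsilon> e by (simp add: \<eta>2_def exp_minus field_simps)
    ultimately have ev2: "\<forall>\<^sub>F N in sequentially. 2 * (\<eta>2 * ln (real N) + C2) / (\<epsilon> * ln (real N)) * exp ((ln (real N) + C3) / (\<epsilon> * ln (real N))) < e / 2"
      by (rule order_tendstoD(2))
    have "filterlim (\<lambda>N. real N powr \<epsilon>) at_top sequentially" using \<epsilon> by real_asymp
    then have ev3: "\<forall>\<^sub>F N in sequentially. real N powr \<epsilon> > 1" unfolding filterlim_at_top_dense by (rule spec)
    show "\<forall>\<^sub>F N in sequentially. dist (g N) 0 < e"
      using ev1 ev2 ev3 eventually_ge_at_top[of 2]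
    proof eventually_elim
      case (elim N)
      define z where "z = nat \<lceil>real N powr \<epsilon>\<rceil>"
      have z_ge: "real z \<ge> real N powr \<epsilon>" unfolding z_def by (rule real_nat_ceiling_ge)
      have z_le: "real z \<le> real N powr \<epsilon> + 1" unfolding z_def
        using of_nat_ceiling[of "real N powr \<epsilon>"] ceiling_correct[of "real N powr \<epsilon>"] elim(3) by simp
      have z2: "z \<ge> 2" using z_ge elim(3) by linarith
      have lnN: "ln (real N) > 0" using elim(4) by simp
      have lnz: "ln (real z) \<ge> \<epsilon> * ln (real N)"
      proof -
        have "ln (real N powr \<epsilon>) \<le> ln (real z)" using z_ge elim(3,4) z2 by (subst ln_le_cancel_iff) auto
        then show ?thesis using elim(4) by (simp add: ln_powr)
      qed
      have lnz': "ln (real z) \<le> \<epsilon> * ln (real N) + ln 2"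
      proof -
        have "ln (real z) \<le> ln (2 * real N powr \<epsilon>)" using z_le elim(3,4) z2 by (subst ln_le_cancel_iff) auto
        also have "\<dots> = \<epsilon> * ln (real N) + ln 2" using elim(3,4) by (simp add: ln_mult ln_powr)
        finally show ?thesis .
      qed
      have split: "g N = (\<Sum>n | n \<in> {2..N} \<and> lpd n < z. ?c (lpd n) * real_of_int (moebius n) / real n) +
          (\<Sum>n | n \<in> {2..N} \<and> lpd n \<ge> z. ?c (lpd n) * real_of_int (moebius n) / real n)"
        unfolding g_def by (subst sum.union_disjoint[symmetric]) (auto intro!: sum.cong)
      have small: "\<bar>\<Sum>n | n \<in> {2..N} \<and> lpd n \<in> S' \<inter> {..<z}. real_of_int (moebius n) / real n\<bar> < e1 / 2" for S'
      proof -
        have "real N * \<bar>\<Sum>n | n \<in> {2..N} \<and> lpd n \<in> S' \<inter> {..<z}. real_of_int (moebius n) / real n\<bar>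
            \<le> real (smooth_count N (real z)) + (real N / real B + 4 * real B * (\<eta> * real N + C1))"
          using C1 \<eta> B1 by (intro small_lpd_sum_bound) auto
        also have "real (smooth_count N (real z)) \<le> sqrt (real N) + 2 * real N * (ln (real z) + C4) / ln (real N)"
          using z2 elim(4) by (intro C4) auto
        also have "\<dots> \<le> sqrt (real N) + 2 * real N * ((\<epsilon> * ln (real N) + ln 2) + C4) / ln (real N)"
          using lnz' lnN by (intro add_left_mono divide_right_mono mult_left_mono add_right_mono) auto
        also have "sqrt (real N) = real N * (1 / sqrt (real N))"
          using elim(4) by (simp add: real_div_sqrt)
        also have "real N * (1 / sqrt (real N)) + 2 * real N * ((\<epsilon> * ln (real N) + ln 2) + C4) / ln (real N) + (real N / real B + 4 * real B * (\<eta> * real N + C1))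
            = real N * (1 / sqrt (real N) + 2 * (\<epsilon> * ln (real N) + ln 2 + C4) / ln (real N) + (1 / real B + 4 * real B * (\<eta> + C1 / real N)))"
        proof -
          have C1N: "C1 = real N * (C1 / real N)" using elim(4) by simp
          show ?thesis by (subst (1) C1N) (simp add: distrib_left mult.assoc mult.left_commute)
        qed
        also have "\<dots> < real N * (e1 / 2)" using elim(1,4) by (intro mult_strict_left_mono) auto
        finally show ?thesis using elim(4) by simp
      qed
      have "(\<Sum>n | n \<in> {2..N} \<and> lpd n < z. ?c (lpd n) * real_of_int (moebius n) / real n) =
          (\<Sum>n | n \<in> {2..N} \<and> lpd n < z. (if lpd n \<in> S then real_of_int (moebius n) / real n else 0)) -
          \<delta> * (\<Sum>n | n \<in> {2..N} \<and> lpd n < z. real_of_int (moebius n) / real n)"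
        unfolding sum_distrib_left sum_subtractf[symmetric] by (intro sum.cong) (auto simp: algebra_simps diff_divide_distrib)
      also have "(\<Sum>n | n \<in> {2..N} \<and> lpd n < z. (if lpd n \<in> S then real_of_int (moebius n) / real n else 0)) =
          (\<Sum>n | n \<in> {2..N} \<and> lpd n \<in> S \<inter> {..<z}. real_of_int (moebius n) / real n)"
        by (rule sum.mono_neutral_cong_right) auto
      also have "(\<Sum>n | n \<in> {2..N} \<and> lpd n < z. real_of_int (moebius n) / real n) =
          (\<Sum>n | n \<in> {2..N} \<and> lpd n \<in> UNIV \<inter> {..<z}. real_of_int (moebius n) / real n)"
        by (rule sum.cong) auto
      also have "\<bar>(\<Sum>n | n \<in> {2..N} \<and> lpd n \<in> S \<inter> {..<z}. real_of_int (moebius n) / real n) -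
          \<delta> * (\<Sum>n | n \<in> {2..N} \<and> lpd n \<in> UNIV \<inter> {..<z}. real_of_int (moebius n) / real n)\<bar> \<le> e1 / 2 + \<bar>\<delta>\<bar> * (e1 / 2)"
        by (rule order_trans[OF abs_triangle_ineq4 add_mono[OF less_imp_le[OF small]]],
            subst abs_mult, rule mult_left_mono[OF less_imp_le[OF small]], simp)
      also have "\<dots> = e / 2" using e1(2) by (simp add: algebra_simps)
      finally have 1: "\<bar>\<Sum>n | n \<in> {2..N} \<and> lpd n < z. ?c (lpd n) * real_of_int (moebius n) / real n\<bar> \<le> e / 2" .
      have "\<bar>\<Sum>n | n \<in> {2..N} \<and> lpd n \<ge> z. ?c (lpd n) * real_of_int (moebius n) / real n\<bar> \<le>
          2 * (\<eta>2 * ln (real N) + C2) / ln (real z) * exp (\<Sum>p | prime p \<and> p \<in> {z..N}. 1 / real p)"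
      proof (rule large_lpd_sum_bound[OF _ z2])
        fix n assume n: "1 \<le> n" "n \<le> N"
        have "\<bar>log_prime_dev S \<delta> n\<bar> \<le> \<eta>2 * ln (real n) + C2" using C2 n by auto
        also have "\<dots> \<le> \<eta>2 * ln (real N) + C2" using n \<eta>2 by (intro add_right_mono mult_left_mono) auto
        finally show "\<bar>log_prime_dev S \<delta> n\<bar> \<le> \<eta>2 * ln (real N) + C2" .
      qed (use elim(4) in auto)
      also have "\<dots> \<le> 2 * (\<eta>2 * ln (real N) + C2) / (\<epsilon> * ln (real N)) * exp ((ln (real N) + C3) / (\<epsilon> * ln (real N)))"
      proof (rule mult_mono)
        have pos: "\<epsilon> * ln (real N) > 0" using \<epsilon> lnN by simp
        have lz: "ln (real z) > 0" using z2 by simp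
        show "2 * (\<eta>2 * ln (real N) + C2) / ln (real z) \<le> 2 * (\<eta>2 * ln (real N) + C2) / (\<epsilon> * ln (real N))"
          using lnz pos lz \<eta>2 lnN C2 by (intro divide_left_mono) auto
        have "(\<Sum>p | prime p \<and> p \<in> {z..N}. 1 / real p) \<le> (ln (real N) + C3) / ln (real z)"
          using C3(2)[of N] z2 elim(4) by (intro sum_prime_recip_interval_le) auto
        also have "\<dots> \<le> (ln (real N) + C3) / (\<epsilon> * ln (real N))"
          using lnz pos lz lnN C3(1) by (intro divide_left_mono) auto
        finally show "exp (\<Sum>p | prime p \<and> p \<in> {z..N}. 1 / real p) \<le> exp ((ln (real N) + C3) / (\<epsilon> * ln (real N)))" by simp
        show "0 \<le> 2 * (\<eta>2 * ln (real N) + C2) / (\<epsilon> * ln (real N))"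
          using \<eta>2 lnN C2(1) \<epsilon> by simp
      qed auto
      also have "\<dots> < e / 2" by (rule elim(2))
      finally have "\<bar>\<Sum>n | n \<in> {2..N} \<and> lpd n \<ge> z. ?c (lpd n) * real_of_int (moebius n) / real n\<bar> < e / 2" .
      then show ?case using 1 split by simp
    qed
  qed
  \<comment> \<open>The term n = 1 is missing; its absence makes the limit -1 and produces the main
    term \<delta>.\<close>
  have U: "(\<lambda>N. \<Sum>n=2..N. real_of_int (moebius n) / real n) \<longlonglongrightarrow> 0 - 1"
  proof -
    have "(\<lambda>N. (\<Sum>n=1..N. real_of_int (moebius n) / real n) - 1) \<longlonglongrightarrow> 0 - 1"
      by (intro tendsto_diff tendsto_const moebius_sum_tendsto_0)
    moreover have "\<forall>\<^sub>F N in sequentially. (\<Sum>n=1..N. real_of_int (moebius n) / real n) - 1 = (\<Sum>n=2..N. real_of_int (moebius n) / real n)"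
      using eventually_ge_at_top[of 1]
      by eventually_elim (simp add: sum.atLeast_Suc_atMost numeral_2_eq_2)
    ultimately show ?thesis by (rule Lim_transform_eventually)
  qed
  have "- (\<Sum>n | n \<in> {2..N} \<and> lpd n \<in> S. real_of_int (moebius n) / real n) =
      - (g N + \<delta> * (\<Sum>n=2..N. real_of_int (moebius n) / real n))" for N
  proof -
    have "(\<Sum>n | n \<in> {2..N} \<and> lpd n \<in> S. real_of_int (moebius n) / real n) = (\<Sum>n=2..N. if lpd n \<in> S then real_of_int (moebius n) / real n else 0)"
      by (rule sum.mono_neutral_cong_left) auto
    also have "\<dots> = g N + \<delta> * (\<Sum>n=2..N. real_of_int (moebius n) / real n)"
      unfolding g_def sum_distrib_left sum.distrib[symmetric] by (intro sum.cong) (auto simp: algebra_simps diff_divide_distrib)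
    finally show ?thesis by simp
  qed
  moreover have "(\<lambda>N. - (g N + \<delta> * (\<Sum>n=2..N. real_of_int (moebius n) / real n))) \<longlonglongrightarrow> - (0 + \<delta> * (0 - 1))"
    by (intro tendsto_intros \<open>g \<longlonglongrightarrow> 0\<close> U)
  ultimately show ?thesis by simp
qed

text \<open>The maximum of ln x / x is at e, and e \<le> 3.\<close>

lemma ln_div_decreasing:
  assumes "n \<ge> 3"
  shows "ln (real (Suc n)) / real (Suc n) \<le> ln (real n) / real n"
proof -
  have "exp 1 \<le> real n" using exp_le assms by linarith
  then have ln1: "1 \<le> ln (real n)" using assms by (subst ln_ge_iff) auto
  have "ln (real (Suc n) / real n) \<le> real (Suc n) / real n - 1"
    using assms by (intro ln_le_minus_one) auto
  also have "\<dots> = 1 / real n" using assms by (simp add: field_simps)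
  finally have "real n * (ln (real (Suc n)) - ln (real n)) \<le> real n * (1 / real n)"
    using assms by (intro mult_left_mono) (auto simp: ln_div)
  also have "\<dots> \<le> ln (real n)" using ln1 assms by simp
  finally have "real n * ln (real (Suc n)) \<le> real (Suc n) * ln (real n)" by (simp add: algebra_simps)
  then show ?thesis using assms by (simp add: field_simps)
qed

lemma ln_div_le_1: "ln (real n) / real n \<le> 1"
proof (cases "n = 0")
  case False
  then have "ln (real n) \<le> real n - 1" by (intro ln_le_minus_one) auto
  then show ?thesis using False by (simp add: field_simps)
qed auto

lemma prime_count_in_nat: "real (prime_count_in S (real n)) = (\<Sum>i=1..n. if prime i \<and> i \<in> S then 1 else 0)"
proof -
  have "(\<Sum>i=1..n. if prime i \<and> i \<in> S then 1 else 0 :: real) = (\<Sum>i | i \<in> S \<and> prime i \<and> real i \<le> real n. 1)"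
    by (rule sum.mono_neutral_cong_right) (auto simp: Suc_le_eq prime_gt_0_nat)
  then show ?thesis by (simp add: prime_count_in_def)
qed

text \<open>The counting deviation satisfies |E n| \<le> b n = \<eta> \<pi>(n) + C. Summation by
  parts with the weight ln n / n gives a bound in terms of b, and summing by parts back converts
  \<eta> \<pi>(n) into \<eta> times the sum of ln p / p, known by Mertens.\<close>

theorem natural_density_imp_log_density:
  assumes "has_natural_density S \<delta>"
  shows "has_log_density S \<delta>"
proof -
  define E where "E n = (\<Sum>i=1..n. if prime i then (if i \<in> S then 1 else 0) - \<delta> else 0)" for n :: nat
  define \<pi> where "\<pi> n = (\<Sum>i=1..n. if prime i then 1 else 0 :: real)" for n :: nat
  have \<pi>0: "\<pi> n \<ge> 0" for n by (auto simp: \<pi>_def intro: sum_nonneg)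
  have E_eq: "E n = real (prime_count_in S (real n)) - \<delta> * \<pi> n" for n
    unfolding E_def \<pi>_def prime_count_in_nat sum_distrib_left sum_subtractf[symmetric] by (intro sum.cong) auto
  have \<pi>_eq: "\<pi> n = real (prime_count_in UNIV (real n))" for n
    unfolding \<pi>_def prime_count_in_nat by simp
  have lim: "(\<lambda>n. real (prime_count_in S (real n)) / \<pi> n) \<longlonglongrightarrow> \<delta>"
    unfolding \<pi>_eq using filterlim_compose[OF assms[unfolded has_natural_density_def] filterlim_real_sequentially] .
  let ?w = "\<lambda>n. ln (real n) / real n"
  obtain C3 where C3: "C3 \<ge> 0" "\<And>N. N \<ge> 1 \<Longrightarrow> \<bar>(\<Sum>p | prime p \<and> p \<le> N. ln (real p) / real p) - ln (real N)\<bar> \<le> C3"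
    using mertens_first by blast
  have dev: "log_prime_dev S \<delta> N = (\<Sum>n=1..N. ?w n *\<^sub>R (if prime n then (if n \<in> S then 1 else 0) - \<delta> else 0))" for N
    unfolding log_prime_dev_def by (rule sum.mono_neutral_cong_left) (auto simp: Suc_le_eq prime_gt_0_nat)
  have main: "\<exists>C. \<forall>N\<ge>1. \<bar>log_prime_dev S \<delta> N\<bar> \<le> \<eta> * ln (real N) + C" if \<eta>: "\<eta> > 0" for \<eta>
  proof -
    have "\<forall>\<^sub>F n in sequentially. dist (real (prime_count_in S (real n)) / \<pi> n) \<delta> < \<eta>"
      using lim \<eta> by (rule tendstoD)
    then obtain n0 where n0: "\<And>n. n \<ge> n0 \<Longrightarrow> \<bar>real (prime_count_in S (real n)) / \<pi> n - \<delta>\<bar> < \<eta>"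
      by (auto simp: eventually_sequentially dist_real_def)
    define C where "C = (\<Sum>n\<le>n0. \<bar>E n\<bar>)"
    have C: "C \<ge> 0" by (auto simp: C_def intro: sum_nonneg)
    define b where "b n = \<eta> * \<pi> n + C" for n
    have b0: "b n \<ge> 0" for n using \<eta> C \<pi>0[of n] by (simp add: b_def)
    have Eb: "\<bar>E n\<bar> \<le> b n" for n
    proof (cases "n \<le> n0")
      case True
      then have "\<bar>E n\<bar> \<le> C" unfolding C_def by (intro member_le_sum) auto
      moreover have "\<eta> * \<pi> n \<ge> 0" using \<eta> \<pi>0 by simp
      ultimately show ?thesis by (simp add: b_def)
    next
      case False
      have "\<bar>E n\<bar> \<le> \<eta> * \<pi> n"
      \<comment> \<open>Here the quotient is 0 by convention and says nothing about \<delta>, but E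
        n itself is 0.\<close>
      proof (cases "\<pi> n = 0")
        case True
        have "real (prime_count_in S (real n)) \<le> \<pi> n"
          unfolding \<pi>_def prime_count_in_nat by (intro sum_mono) auto
        then show ?thesis using True E_eq by simp
      next
        case nz: False
        then have "\<pi> n > 0" using \<pi>0[of n] by simp
        moreover from this have "E n = (real (prime_count_in S (real n)) / \<pi> n - \<delta>) * \<pi> n"
          by (simp add: E_eq field_simps)
        ultimately show ?thesis using n0[of n] False by (simp add: abs_mult)
      qed
      then show ?thesis using C by (simp add: b_def)
    qed
    define d where "d n = ?w n - ?w (Suc n)" for n
    \<comment> \<open>The weight ln n / n still increases up to n = 3, so d is negative for n = 1
      and n = 2; as the weight lies in [0, 1], adding 2 compensates.\<close>
    have d_le: "\<bar>d n\<bar> \<le> d n + (if n \<le> 2 then 2 else 0)" if "n \<ge> 1" for n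
    proof (cases "n \<le> 2")
      case True
      have "?w n \<ge> 0" "?w (Suc n) \<ge> 0" "?w n \<le> 1" "?w (Suc n) \<le> 1"
        using ln_div_nat_nonneg ln_div_le_1 by blast+
      then have "\<bar>d n\<bar> \<le> d n + 2" unfolding d_def by linarith
      then show ?thesis using True by simp
    next
      case False
      then show ?thesis using ln_div_decreasing[of n] by (simp add: d_def)
    qed
    have "\<bar>log_prime_dev S \<delta> N\<bar> \<le> \<eta> * ln (real N) + (\<eta> * C3 + C + 2 * b 1 + 2 * b 2)" if N: "N \<ge> 1" for N
    proof -
      have "log_prime_dev S \<delta> N = ?w N * E N + (\<Sum>n=1..<N. d n * E n)"
        unfolding dev E_def d_def by (subst abel_identity[OF N]) (simp only: real_scaleR_def)
      also have "\<bar>\<dots>\<bar> \<le> \<bar>?w N * E N\<bar> + (\<Sum>n=1..<N. \<bar>d n * E n\<bar>)"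
        by (rule order_trans[OF abs_triangle_ineq]) (intro add_left_mono sum_abs)
      also have "\<bar>?w N * E N\<bar> \<le> ?w N * b N"
        using Eb[of N] ln_div_nat_nonneg[of N] by (simp only: abs_mult abs_of_nonneg) (intro mult_left_mono)
      also have "(\<Sum>n=1..<N. \<bar>d n * E n\<bar>) \<le> (\<Sum>n=1..<N. d n * b n + (if n \<le> 2 then 2 * b n else 0))"
      proof (rule sum_mono)
        fix n assume "n \<in> {1..<N}"
        then have "\<bar>d n\<bar> * \<bar>E n\<bar> \<le> (d n + (if n \<le> 2 then 2 else 0)) * b n"
          using d_le[of n] Eb[of n] by (intro mult_mono) auto
        then show "\<bar>d n * E n\<bar> \<le> d n * b n + (if n \<le> 2 then 2 * b n else 0)"
          by (auto simp: abs_mult algebra_simps)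
      qed
      also have "\<dots> = (\<Sum>n=1..<N. d n * b n) + (\<Sum>n=1..<N. if n \<le> 2 then 2 * b n else 0)"
        by (rule sum.distrib)
      also have "(\<Sum>n=1..<N. if n \<le> 2 then 2 * b n else 0) \<le> 2 * b 1 + 2 * b 2"
      proof -
        have "(\<Sum>n=1..<N. if n \<le> 2 then 2 * b n else 0) = (\<Sum>n\<in>{1..<N} \<inter> {1,2}. 2 * b n)"
          by (rule sum.mono_neutral_cong_right) auto
        also have "\<dots> \<le> (\<Sum>n\<in>{1,2}. 2 * b n)" using b0 by (intro sum_mono2) auto
        finally show ?thesis by simp
      qed
      finally have 1: "\<bar>log_prime_dev S \<delta> N\<bar> \<le> (?w N * b N + (\<Sum>n=1..<N. d n * b n)) + (2 * b 1 + 2 * b 2)" by simp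
      \<comment> \<open>The constant C is placed at i = 1, where the weight ln i / i vanishes, so it
        disappears when the summation by parts is reversed.\<close>
      have b_sum: "b n = (\<Sum>i=1..n. \<eta> * (if prime i then 1 else 0) + (if i = 1 then C else 0))" if "n \<ge> 1" for n
        using that unfolding b_def \<pi>_def sum.distrib sum_distrib_left by (simp add: sum.delta)
      have "?w N * b N + (\<Sum>n=1..<N. d n * b n) =
         (\<Sum>n=1..N. ?w n *\<^sub>R (\<eta> * (if prime n then 1 else 0) + (if n = 1 then C else 0)))"
        by (subst abel_identity[OF N]) (use N b_sum in \<open>simp add: d_def\<close>)
      also have "\<dots> = \<eta> * (\<Sum>n=1..N. if prime n then ?w n else 0) + (\<Sum>n=1..N. if n = 1 then ?w n * C else 0)"
        unfolding sum_distrib_left sum.distrib[symmetric] by (intro sum.cong) auto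
      also have "(\<Sum>n=1..N. if n = 1 then ?w n * C else 0) = 0" by (intro sum.neutral) auto
      also have "(\<Sum>n=1..N. if prime n then ?w n else 0) = (\<Sum>p | prime p \<and> p \<le> N. ln (real p) / real p)"
        by (rule sum.mono_neutral_cong_right) (auto simp: Suc_le_eq prime_gt_0_nat)
      finally have 2: "?w N * b N + (\<Sum>n=1..<N. d n * b n) = \<eta> * (\<Sum>p | prime p \<and> p \<le> N. ln (real p) / real p)" by simp
      have "(\<Sum>p | prime p \<and> p \<le> N. ln (real p) / real p) \<le> ln (real N) + C3" using C3(2)[OF N] by linarith
      then have "\<eta> * (\<Sum>p | prime p \<and> p \<le> N. ln (real p) / real p) \<le> \<eta> * (ln (real N) + C3)" using \<eta> by (intro mult_left_mono) auto
      with 1 2 C show ?thesis by (simp add: algebra_simps)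
    qed
    then show ?thesis by blast
  qed
  show ?thesis unfolding has_log_density_def
  proof (rule tendstoI)
    fix e :: real assume e: "e > 0"
    then obtain C where C: "\<And>N. N \<ge> 1 \<Longrightarrow> \<bar>log_prime_dev S \<delta> N\<bar> \<le> e / 2 * ln (real N) + C"
      using main[of "e / 2"] by auto
    have "(\<lambda>N. C / ln (real N)) \<longlonglongrightarrow> 0" by real_asymp
    then have "\<forall>\<^sub>F N in sequentially. C / ln (real N) < e / 2" using e by (intro order_tendstoD(2)) auto
    then show "\<forall>\<^sub>F N in sequentially. dist (log_prime_dev S \<delta> N / ln (real N)) 0 < e"
      using eventually_ge_at_top[of 2]
    proof eventually_elim
      case (elim N)
      then have ln: "ln (real N) > 0" by simp
      have "\<bar>log_prime_dev S \<delta> N\<bar> / ln (real N) \<le> (e / 2 * ln (real N) + C) / ln (real N)"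
        using C[of N] elim ln by (intro divide_right_mono) auto
      also have "\<dots> = e / 2 + C / ln (real N)" using ln by (simp add: field_simps)
      also have "\<dots> < e" using elim(1) by linarith
      finally show ?case using ln by (simp add: abs_divide)
    qed
  qed
qed

section \<open>Division by the totient\<close>

lemma real_totient_prime_mult:
  assumes "prime p" "n > 0"
  shows "real (totient (p * n)) = (if p dvd n then real p else real p - 1) * real (totient n)"
proof (cases "p dvd n")
  case True
  have "prime_factors (p * n) = insert p (prime_factors n)"
    using assms by (auto simp: prime_factors_product prime_prime_factors prime_gt_0_nat)
  also have "\<dots> = prime_factors n" using True assms by (auto simp: in_prime_factors_iff)
  finally show ?thesis using True by (simp add: totient_formula2)
next
  case False
  then have "totient (p * n) = (p - 1) * totient n"
    using assms by (simp add: totient_mult_coprime prime_imp_coprime totient_prime)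
  then show ?thesis using False prime_ge_1_nat[OF assms(1)] by (simp add: of_nat_diff)
qed

text \<open>A prime p of d not dividing e multiplies the sum over q by 1 + 1 / (p - 1) = p / (p -
  1), which accounts for \<phi>(p) = p - 1. If p divides e, then \<phi> grows by the full factor p
  and no q is added.\<close>

lemma inverse_totient_mult_squarefree:
  assumes e: "e > 0" and d: "squarefree d"
  shows "1 / real (totient (e * d)) = 1 / (real (totient e) * real d) * (\<Sum>q | q dvd d \<and> coprime q e. 1 / real (totient q))"
  using d
proof (induction d rule: prime_divisors_induct)
  case (unit d)
  have "{q. q dvd (1::nat) \<and> coprime q e} = {1}" by auto
  then show ?case using unit by simp
next
  case (factor p d)
  have sq: "squarefree d" using factor.prems by (meson squarefree_multD)
  have d0: "d > 0" using sq by (cases "d = 0") auto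
  have npd: "\<not> p dvd d"
  proof
    assume "p dvd d"
    then have "p ^ 2 dvd p * d" by (simp add: power2_eq_square)
    then show False using factor.prems factor.hyps by (auto simp: squarefree_def)
  qed
  have p1: "real p > 1" using prime_gt_1_nat[OF factor.hyps(1)] by simp
  let ?D = "\<lambda>d. {q. q dvd d \<and> coprime q e}"
  have fin: "finite (?D d)" using d0 by simp
  note IH = factor.IH[OF sq]
  have tot: "real (totient (e * (p * d))) = (if p dvd e then real p else real p - 1) * real (totient (e * d))"
    using real_totient_prime_mult[OF factor.hyps(1), of "e * d"] e d0 npd factor.hyps(1)
    by (auto simp: prime_dvd_mult_iff mult.left_commute)
  have dvd_pd: "q dvd d" if "q dvd p * d" "\<not> p dvd q" for q
    using that factor.hyps(1) by (meson coprime_commute coprime_dvd_mult_right_iff prime_imp_coprime)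
  show ?case
  proof (cases "p dvd e")
    case True
    have "\<not> p dvd q" if "coprime q e" for q
      using that True factor.hyps(1) coprime_common_divisor[of q e p] by auto
    then have D: "?D (p * d) = ?D d" using dvd_pd by (auto intro: dvd_mult)
    have "1 / real (totient (e * (p * d))) = 1 / real p * (1 / real (totient (e * d)))"
      using tot True by simp
    also have "\<dots> = 1 / real p * (1 / (real (totient e) * real d) * (\<Sum>q\<in>?D d. 1 / real (totient q)))"
      by (simp only: IH)
    finally show ?thesis unfolding D by simp
  next
    case False
    have cpe: "coprime p e" using False factor.hyps(1) by (simp add: prime_imp_coprime)
    have "?D (p * d) = ?D d \<union> (\<lambda>q. p * q) ` ?D d"
    proof (intro equalityI subsetI)
      fix q assume q: "q \<in> ?D (p * d)"
      show "q \<in> ?D d \<union> (\<lambda>q. p * q) ` ?D d"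
      proof (cases "p dvd q")
        case True
        then obtain r where "q = p * r" by auto
        then show ?thesis using q p1 by auto
      qed (use q dvd_pd in auto)
    qed (use cpe in auto)
    moreover have "?D d \<inter> (\<lambda>q. p * q) ` ?D d = {}" using npd by (auto dest: dvd_mult_left)
    ultimately have "(\<Sum>q\<in>?D (p * d). 1 / real (totient q)) =
        (\<Sum>q\<in>?D d. 1 / real (totient q)) + (\<Sum>q\<in>(\<lambda>q. p * q) ` ?D d. 1 / real (totient q))"
      using fin by (simp add: sum.union_disjoint)
    also have "(\<Sum>q\<in>(\<lambda>q. p * q) ` ?D d. 1 / real (totient q)) = (\<Sum>q\<in>?D d. 1 / real (totient (p * q)))"
      using p1 by (subst sum.reindex) (auto simp: inj_on_def)
    also have "\<dots> = (\<Sum>q\<in>?D d. 1 / (real p - 1) * (1 / real (totient q)))"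
    proof (rule sum.cong)
      fix q assume q: "q \<in> ?D d"
      then have "\<not> p dvd q" "q > 0" using npd d0 by (auto intro: dvd_trans dvd_pos_nat)
      then show "1 / real (totient (p * q)) = 1 / (real p - 1) * (1 / real (totient q))"
        using real_totient_prime_mult[OF factor.hyps(1), of q] by simp
    qed auto
    also have "\<dots> = 1 / (real p - 1) * (\<Sum>q\<in>?D d. 1 / real (totient q))" by (rule sum_distrib_left[symmetric])
    also have "(\<Sum>q\<in>?D d. 1 / real (totient q)) + 1 / (real p - 1) * (\<Sum>q\<in>?D d. 1 / real (totient q))
        = real p / (real p - 1) * (\<Sum>q\<in>?D d. 1 / real (totient q))"
      using p1 by (simp add: field_simps)
    finally have R: "(\<Sum>q\<in>?D (p * d). 1 / real (totient q)) = real p / (real p - 1) * (\<Sum>q\<in>?D d. 1 / real (totient q))" .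
    have "1 / real (totient (e * (p * d))) = 1 / (real p - 1) * (1 / real (totient (e * d)))"
      using tot False by simp
    also have "\<dots> = 1 / (real p - 1) * (1 / (real (totient e) * real d) * (\<Sum>q\<in>?D d. 1 / real (totient q)))"
      by (simp only: IH)
    also have "\<dots> = 1 / (real (totient e) * real (p * d)) * (real p / (real p - 1) * (\<Sum>q\<in>?D d. 1 / real (totient q)))"
      using p1 by simp
    finally show ?thesis using R by simp
  qed
qed auto

text \<open>The i-th smallest element is at least i + 1, so its factor is at most (i + 1) / i and
  the product telescopes; the induction adds the largest element.\<close>

lemma prod_ratio_le_card:
  assumes "finite A" "\<And>x. x \<in> A \<Longrightarrow> x \<ge> (2::nat)"
  shows "(\<Prod>x\<in>A. real x / (real x - 1)) \<le> real (card A) + 1"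
  using assms
proof (induction A rule: finite_linorder_max_induct)
  case (insert b A)
  have "A \<subseteq> {2..<b}" using insert by auto
  then have "card A \<le> b - 2" using card_mono[of "{2..<b}" A] by simp
  moreover have "b \<ge> 2" using insert.prems by simp
  ultimately have b: "real b \<ge> real (card A) + 2" by linarith
  have "b \<notin> A" using insert by auto
  then have "(\<Prod>x\<in>insert b A. real x / (real x - 1)) = real b / (real b - 1) * (\<Prod>x\<in>A. real x / (real x - 1))"
    using insert by simp
  also have "\<dots> \<le> real b / (real b - 1) * (real (card A) + 1)"
    using insert b by (intro mult_left_mono) auto
  also have "\<dots> \<le> real (card A) + 2"
    using b by (simp add: field_simps)
  finally show ?case using insert \<open>b \<notin> A\<close> by simp
qed auto

text \<open>The quotient n / \<phi>(n) is a product over the distinct primes of n, and 2 to the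
  power of their number is at most n. The logarithmic loss is harmless next to any power
  saving.\<close>

lemma inverse_totient_le:
  assumes n: "n > 0"
  shows "1 / real (totient n) \<le> (1 + 2 * ln (real n)) / real n"
proof -
  let ?P = "prime_factors n"
  have p2: "p \<ge> 2" if "p \<in> ?P" for p using that prime_ge_2_nat by auto
  have "real (totient n) * (\<Prod>p\<in>?P. real p / (real p - 1)) = real n * (\<Prod>p\<in>?P. (1 - 1 / real p) * (real p / (real p - 1)))"
    by (simp only: totient_formula2 prod.distrib mult.assoc)
  also have "(\<Prod>p\<in>?P. (1 - 1 / real p) * (real p / (real p - 1))) = 1"
  proof (rule prod.neutral, rule ballI)
    fix p assume "p \<in> ?P"
    then have "real p \<ge> 2" using p2 by force
    then show "(1 - 1 / real p) * (real p / (real p - 1)) = 1" by (simp add: field_simps)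
  qed
  finally have eq: "real (totient n) * (\<Prod>p\<in>?P. real p / (real p - 1)) = real n" by simp
  have "2 ^ card ?P = (\<Prod>p\<in>?P. 2 :: nat)" by simp
  also have "\<dots> \<le> \<Prod>?P" using p2 by (intro prod_mono) auto
  also have "\<dots> \<le> n"
  proof (rule dvd_imp_le)
    have "\<Prod>?P dvd (\<Prod>p\<in>?P. p ^ multiplicity p n)"
      by (intro prod_dvd_prod) (auto simp: prime_factors_multiplicity intro: dvd_power)
    then show "\<Prod>?P dvd n" using prime_factorization_nat[OF n] by simp
  qed (use n in auto)
  finally have "real (2 ^ card ?P) \<le> real n" by (simp only: of_nat_le_iff)
  then have "ln (2 ^ card ?P) \<le> ln (real n)" using n by (subst ln_le_cancel_iff) auto
  then have 1: "real (card ?P) * ln 2 \<le> ln (real n)" by (simp add: ln_realpow)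
  have "ln (2 :: real) \<ge> 1/2" using ln_le_minus_one[of "1/2 :: real"] by (simp add: ln_div)
  then have "real (card ?P) * (1/2) \<le> real (card ?P) * ln 2" by (intro mult_left_mono) auto
  with 1 have "real (card ?P) \<le> 2 * ln (real n)" by linarith
  then have "(\<Prod>p\<in>?P. real p / (real p - 1)) \<le> 1 + 2 * ln (real n)"
    using prod_ratio_le_card[of ?P] p2 by force
  then have "real n \<le> real (totient n) * (1 + 2 * ln (real n))"
    using eq by (metis mult_left_mono of_nat_0_le_iff)
  moreover have "real (totient n) > 0" using n by simp
  ultimately show ?thesis using n by (simp add: field_simps)
qed

lemma summable_ln_totient:
  assumes \<alpha>: "\<alpha> > 0"
  shows "summable (\<lambda>n. (1 + ln (real n)) * (real n powr (- \<alpha>) / real (totient n)))"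
proof (rule summable_comparison_test'[where N = 1])
  \<comment> \<open>From ln n \<le> n^(\<alpha>/4) / (\<alpha>/4). One logarithm stands in the
    summand and one comes from 1 / \<phi>; together they cost n^(\<alpha>/2), half of the available
    decay.\<close>
  define C where "C = 1 + 8 / \<alpha>"
  show "summable (\<lambda>n. C\<^sup>2 * real n powr (- 1 - \<alpha> / 2))"
    using \<alpha> by (intro summable_mult) (simp add: summable_real_powr_iff)
  fix n :: nat assume n: "n \<ge> 1"
  have ln0: "ln (real n) \<ge> 0" using n by simp
  have "ln (real n) \<le> real n powr (\<alpha> / 4) / (\<alpha> / 4)" using n \<alpha> by (intro ln_powr_bound) auto
  moreover have "1 \<le> real n powr (\<alpha> / 4)" using n \<alpha> by (simp add: ge_one_powr_ge_zero)
  ultimately have L: "1 + 2 * ln (real n) \<le> C * real n powr (\<alpha> / 4)"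
    by (simp add: C_def algebra_simps)
  have "(1 + ln (real n)) * (real n powr (- \<alpha>) / real (totient n)) \<le>
      (1 + 2 * ln (real n)) * (real n powr (- \<alpha>) * ((1 + 2 * ln (real n)) / real n))"
    using n ln0 inverse_totient_le[of n] mult_left_mono[of "1 / real (totient n)" "(1 + 2 * ln (real n)) / real n" "real n powr (- \<alpha>)"]
    by (intro mult_mono) auto
  also have "\<dots> = (1 + 2 * ln (real n))\<^sup>2 * (real n powr (- \<alpha>) / real n)"
    by (simp add: power2_eq_square)
  also have "\<dots> \<le> (C * real n powr (\<alpha> / 4))\<^sup>2 * (real n powr (- \<alpha>) / real n)"
    using L ln0 by (intro mult_right_mono power_mono) auto
  also have "\<dots> = C\<^sup>2 * real n powr (- 1 - \<alpha> / 2)"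
  proof -
    have i: "1 / real n = real n powr (- 1)" using n by (simp add: powr_minus_divide)
    have "(real n powr (\<alpha> / 4))\<^sup>2 * (real n powr (- \<alpha>) / real n) =
        real n powr (\<alpha> / 4) * real n powr (\<alpha> / 4) * real n powr (- \<alpha>) * (1 / real n)"
      by (simp add: power2_eq_square)
    also have "\<dots> = real n powr (\<alpha> / 4 + \<alpha> / 4 + (- \<alpha>) + (- 1))"
      by (simp only: i powr_add)
    also have "\<alpha> / 4 + \<alpha> / 4 + (- \<alpha>) + (- 1) = - 1 - \<alpha> / 2" by simp
    finally show ?thesis by (simp only: power_mult_distrib mult.assoc)
  qed
  finally show "norm ((1 + ln (real n)) * (real n powr (- \<alpha>) / real (totient n))) \<le> C\<^sup>2 * real n powr (- 1 - \<alpha> / 2)"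
    using ln0 by simp
qed

text \<open>The sum over t that remains after n = e q t, where e is the argument of a and q comes
  from expanding 1 / \<phi>: then m = e q and r = q, since \<mu>(q t) vanishes unless t is coprime
  to q. The guard excludes m = t = 1, where there is no least prime divisor.\<close>

definition lpd_moebius_sum :: "nat set \<Rightarrow> nat \<Rightarrow> nat \<Rightarrow> nat \<Rightarrow> real" where
  "lpd_moebius_sum S m r N =
     (\<Sum>t | t \<in> {1..N} \<and> coprime t r \<and> m * t \<ge> 2 \<and> lpd (m * t) \<in> S. real_of_int (moebius t) / real t)"

lemma lpd_moebius_sum_1: "lpd_moebius_sum S 1 1 N = (\<Sum>n | n \<in> {2..N} \<and> lpd n \<in> S. real_of_int (moebius n) / real n)"
  unfolding lpd_moebius_sum_def by (intro sum.cong) auto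

text \<open>Either every prime factor of \<open>t\<close> is at least \<open>lpd m\<close>, and then \<open>lpd (m * t) = lpd m\<close>,
  or \<open>lpd (m * t) = lpd t\<close> is a prime below \<open>lpd m\<close>, which does not divide \<open>r\<close>.\<close>

lemma lpd_moebius_sum_eq:
  assumes m: "m \<ge> 2" and r: "r dvd m"
  shows "lpd_moebius_sum S m r N =
     (if lpd m \<in> S then moebius_log_sum (r * primorial (lpd m - 1)) N else 0) -
     (\<Sum>p | prime p \<and> p < lpd m \<and> p \<in> S. 1 / real p * moebius_log_sum (r * primorial p) (N div p))"
proof -
  define P where "P = lpd m"
  have P: "prime P" "P dvd m" using lpd_prime[OF m] lpd_dvd[OF m] by (auto simp: P_def)
  have P2: "P \<ge> 2" using P prime_ge_2_nat by auto
  have lpd_mt: "lpd (m * t) = (if coprime t (primorial (P - 1)) then P else lpd t)" if t: "t \<ge> 1" for t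
  proof (cases "coprime t (primorial (P - 1))")
    case True
    have "lpd (m * t) = P"
    proof (rule lpd_eqI)
      fix q assume q: "prime q" "q dvd m * t"
      then have "q dvd m \<or> q dvd t" by (simp add: prime_dvd_mult_iff)
      then show "P \<le> q"
        using lpd_le[of q m] q True P2 by (auto simp: P_def coprime_primorial_iff)
    qed (use P in auto)
    then show ?thesis using True by simp
  next
    case False
    then obtain q where q: "prime q" "q dvd t" "q < P" using P2 by (auto simp: coprime_primorial_iff not_less)
    have t2: "t \<ge> 2" using q t prime_ge_2_nat[of q] by (auto dest!: dvd_imp_le)
    have "lpd t \<le> q" using q by (intro lpd_le)
    have "lpd (m * t) = lpd t"
    proof (rule lpd_eqI)
      fix q' assume q': "prime q'" "q' dvd m * t"
      then have "q' dvd m \<or> q' dvd t" by (simp add: prime_dvd_mult_iff)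
      then show "lpd t \<le> q'"
        using lpd_le[of q' m] lpd_le[of q' t] q' \<open>lpd t \<le> q\<close> q(3) by (auto simp: P_def)
    qed (use lpd_prime[OF t2] lpd_dvd[OF t2] in auto)
    then show ?thesis using False by simp
  qed
  have ncop: "\<not> coprime t (primorial (P - 1)) \<longleftrightarrow> t \<ge> 2 \<and> lpd t < P" if t: "t \<ge> 1" for t
  proof
    assume "\<not> coprime t (primorial (P - 1))"
    then obtain q where q: "prime q" "q dvd t" "q < P" using P2 by (auto simp: coprime_primorial_iff not_less)
    then show "t \<ge> 2 \<and> lpd t < P" using t prime_ge_2_nat[of q] lpd_le[of q t] by (auto dest!: dvd_imp_le)
  next
    assume "t \<ge> 2 \<and> lpd t < P"
    then show "\<not> coprime t (primorial (P - 1))"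
      using lpd_prime[of t] lpd_dvd[of t] by (auto simp: coprime_primorial_iff intro!: exI[of _ "lpd t"])
  qed
  have cop: "coprime t (primorial (P - 1)) \<longleftrightarrow> \<not> (t \<ge> 2 \<and> lpd t < P)" if t: "t \<ge> 1" for t
    using ncop[OF t] by blast
  let ?f = "\<lambda>t. real_of_int (moebius t) / real t"
  have mt2: "m * t \<ge> 2" if "t \<ge> 1" for t using m that mult_le_mono[of 2 m 1 t] by simp
  have "lpd_moebius_sum S m r N = (\<Sum>t | t \<in> {1..N} \<and> coprime t r \<and> lpd (m * t) \<in> S. ?f t)"
    unfolding lpd_moebius_sum_def using mt2 by (intro sum.cong) auto
  also have "\<dots> = (\<Sum>t | t \<in> {1..N} \<and> coprime t r \<and> coprime t (primorial (P - 1)) \<and> P \<in> S. ?f t) +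
      (\<Sum>t | t \<in> {1..N} \<and> coprime t r \<and> \<not> coprime t (primorial (P - 1)) \<and> lpd t \<in> S. ?f t)"
    by (subst sum.union_disjoint[symmetric]) (auto intro!: sum.cong simp: lpd_mt split: if_splits)
  also have "(\<Sum>t | t \<in> {1..N} \<and> coprime t r \<and> coprime t (primorial (P - 1)) \<and> P \<in> S. ?f t) =
      (if P \<in> S then moebius_log_sum (r * primorial (P - 1)) N else 0)"
    by (auto simp: moebius_log_sum_def intro!: sum.cong)
  also have "(\<Sum>t | t \<in> {1..N} \<and> coprime t r \<and> \<not> coprime t (primorial (P - 1)) \<and> lpd t \<in> S. ?f t) =
      (\<Sum>t | t \<in> {2..N} \<and> lpd t \<in> S \<inter> {..<P}. real_of_int (moebius t) * (if coprime t r then 1 / real t else 0))"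
    by (rule sum.mono_neutral_cong_left) (auto simp: cop simp del: One_nat_def)
  also have "\<dots> = - (\<Sum>p | prime p \<and> p \<le> N \<and> p \<in> S \<inter> {..<P}. \<Sum>t | t \<in> {1..N div p} \<and> coprime t (primorial p).
      real_of_int (moebius t) * (if coprime (p * t) r then 1 / real (p * t) else 0))"
    by (rule sum_moebius_lpd)
  also have "(\<Sum>p | prime p \<and> p \<le> N \<and> p \<in> S \<inter> {..<P}. \<Sum>t | t \<in> {1..N div p} \<and> coprime t (primorial p).
      real_of_int (moebius t) * (if coprime (p * t) r then 1 / real (p * t) else 0)) =
      (\<Sum>p | prime p \<and> p \<le> N \<and> p \<in> S \<inter> {..<P}. 1 / real p * moebius_log_sum (r * primorial p) (N div p))"
  proof (rule sum.cong)
    fix p assume p: "p \<in> {p. prime p \<and> p \<le> N \<and> p \<in> S \<inter> {..<P}}"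
    have "\<not> p dvd r"
    proof
      assume "p dvd r"
      then have "P \<le> p" using lpd_le[of p m] p r by (auto simp: P_def intro: dvd_trans)
      then show False using p by auto
    qed
    then have "coprime p r" using p by (auto simp: prime_imp_coprime)
    then have c: "coprime (p * t) r \<longleftrightarrow> coprime t r" for t by simp
    show "(\<Sum>t | t \<in> {1..N div p} \<and> coprime t (primorial p). real_of_int (moebius t) * (if coprime (p * t) r then 1 / real (p * t) else 0)) =
       1 / real p * moebius_log_sum (r * primorial p) (N div p)"
      unfolding moebius_log_sum_def sum_distrib_left c
      by (rule sum.mono_neutral_cong_right) auto
  qed auto
  also have "\<dots> = (\<Sum>p | prime p \<and> p < P \<and> p \<in> S. 1 / real p * moebius_log_sum (r * primorial p) (N div p))"
  proof (rule sum.mono_neutral_left)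
    show "\<forall>p\<in>{p. prime p \<and> p < P \<and> p \<in> S} - {p. prime p \<and> p \<le> N \<and> p \<in> S \<inter> {..<P}}.
        1 / real p * moebius_log_sum (r * primorial p) (N div p) = 0"
    proof
      fix p assume "p \<in> {p. prime p \<and> p < P \<and> p \<in> S} - {p. prime p \<and> p \<le> N \<and> p \<in> S \<inter> {..<P}}"
      then have "N < p" by auto
      then show "1 / real p * moebius_log_sum (r * primorial p) (N div p) = 0"
        by (simp add: moebius_log_sum_def)
    qed
  qed auto
  finally show ?thesis by (simp add: P_def)
qed

text \<open>For fixed m this is a finite combination of logarithmic Moebius sums, each tending to 0,
  so a main term can come only from m = 1.\<close>

lemma lpd_moebius_sum_tendsto_0:
  assumes m: "m \<ge> 2" and r: "r dvd m"
  shows "lpd_moebius_sum S m r \<longlonglongrightarrow> 0"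
proof -
  have r0: "r > 0" using dvd_pos_nat[OF _ r] m by simp
  have lim: "(\<lambda>N. moebius_log_sum (r * primorial K) N) \<longlonglongrightarrow> 0" for K
    using moebius_log_sum_tendsto_0[of "r * primorial K"] r0 primorial_pos[of K] by simp
  have "(\<lambda>N. (if lpd m \<in> S then moebius_log_sum (r * primorial (lpd m - 1)) N else 0) -
     (\<Sum>p | prime p \<and> p < lpd m \<and> p \<in> S. 1 / real p * moebius_log_sum (r * primorial p) (N div p))) \<longlonglongrightarrow>
     0 - (\<Sum>p | prime p \<and> p < lpd m \<and> p \<in> S. 1 / real p * 0)"
  proof (intro tendsto_diff tendsto_sum tendsto_mult tendsto_const)
    show "(\<lambda>N. if lpd m \<in> S then moebius_log_sum (r * primorial (lpd m - 1)) N else 0) \<longlonglongrightarrow> 0"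
      using lim by (cases "lpd m \<in> S") auto
    fix p assume "p \<in> {p. prime p \<and> p < lpd m \<and> p \<in> S}"
    then have "p > 0" by (auto simp: prime_gt_0_nat)
    then show "(\<lambda>N. moebius_log_sum (r * primorial p) (N div p)) \<longlonglongrightarrow> 0"
      by (intro filterlim_compose[OF lim] filterlim_div_at_top)
  qed
  then have "(\<lambda>N. lpd_moebius_sum S m r N) \<longlonglongrightarrow> 0"
    by (simp only: lpd_moebius_sum_eq[OF m r]) simp
  then show ?thesis by simp
qed

text \<open>For m \<ge> 2 the logarithmic Moebius sums are at most 1 in modulus whatever their
  coprimality condition, so only the sum of 1 / p over p < lpd m remains, and 1 / p \<le> 2 ln p / p
  brings in Mertens. For m = 1 boundedness comes from convergence.\<close>

lemma lpd_moebius_sum_bound: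
  assumes "has_log_density S \<delta>"
  obtains K where "K > 0" "\<And>m r N. m > 0 \<Longrightarrow> r dvd m \<Longrightarrow> \<bar>lpd_moebius_sum S m r N\<bar> \<le> K * (1 + ln (real m))"
proof -
  obtain C3 where C3: "C3 \<ge> 0" "\<And>N. N \<ge> 1 \<Longrightarrow> \<bar>(\<Sum>p | prime p \<and> p \<le> N. ln (real p) / real p) - ln (real N)\<bar> \<le> C3"
    using mertens_first by blast
  have "Bseq (lpd_moebius_sum S 1 1)"
  proof (rule convergent_imp_Bseq)
    have "(\<lambda>N. - (- lpd_moebius_sum S 1 1 N)) \<longlonglongrightarrow> - \<delta>"
      using moebius_lpd_log_density[OF assms] unfolding lpd_moebius_sum_1 by (rule tendsto_minus)
    then show "convergent (lpd_moebius_sum S 1 1)" by (auto simp: convergent_def)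
  qed
  then obtain K1 where K1: "K1 > 0" "\<And>N. \<bar>lpd_moebius_sum S 1 1 N\<bar> \<le> K1"
    by (auto simp: Bseq_def)
  define K where "K = K1 + (3 + 2 * C3)"
  have "\<bar>lpd_moebius_sum S m r N\<bar> \<le> K * (1 + ln (real m))" if m: "m > 0" and r: "r dvd m" for m r N
  proof (cases "m = 1")
    case True
    then have "r = 1" using r by simp
    then show ?thesis using True K1(2)[of N] C3(1) by (simp add: K_def)
  next
    case False
    then have m2: "m \<ge> 2" using m by simp
    let ?P = "{p. prime p \<and> p < lpd m \<and> p \<in> S}"
    have "\<bar>lpd_moebius_sum S m r N\<bar> \<le> \<bar>if lpd m \<in> S then moebius_log_sum (r * primorial (lpd m - 1)) N else 0\<bar> +
      \<bar>\<Sum>p\<in>?P. 1 / real p * moebius_log_sum (r * primorial p) (N div p)\<bar>"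
      unfolding lpd_moebius_sum_eq[OF m2 r] by (rule abs_triangle_ineq4)
    also have "\<bar>if lpd m \<in> S then moebius_log_sum (r * primorial (lpd m - 1)) N else 0\<bar> \<le> 1"
      using abs_moebius_log_sum_le_1 by auto
    also have "\<bar>\<Sum>p\<in>?P. 1 / real p * moebius_log_sum (r * primorial p) (N div p)\<bar> \<le> (\<Sum>p\<in>?P. 2 * (ln (real p) / real p))"
    proof (rule order_trans[OF sum_abs sum_mono])
      fix p assume "p \<in> ?P"
      then have p: "real p \<ge> 2" using prime_ge_2_nat by force
      have "\<bar>1 / real p * moebius_log_sum (r * primorial p) (N div p)\<bar> \<le> 1 / real p * 1"
        using abs_moebius_log_sum_le_1 p by (subst abs_mult) (intro mult_mono, auto)
      also have "1 / 2 \<le> ln (2 :: real)" using ln_le_minus_one[of "1/2 :: real"] by (simp add: ln_div)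
      then have "1 / 2 \<le> ln (real p)" using p ln_le_cancel_iff[of 2 "real p"] by linarith
      then have "1 / real p * 1 \<le> 2 * (ln (real p) / real p)" using p by (simp add: field_simps)
      finally show "\<bar>1 / real p * moebius_log_sum (r * primorial p) (N div p)\<bar> \<le> 2 * (ln (real p) / real p)" .
    qed
    also have "\<dots> \<le> (\<Sum>p | prime p \<and> p \<le> m. 2 * (ln (real p) / real p))"
      using lpd_le_self[OF m2] ln_div_nat_nonneg
      by (intro sum_mono2) (auto simp del: times_divide_eq_right intro!: mult_nonneg_nonneg)
    also have "\<dots> = 2 * (\<Sum>p | prime p \<and> p \<le> m. ln (real p) / real p)" by (rule sum_distrib_left[symmetric])
    also have "\<dots> \<le> 2 * (ln (real m) + C3)" using C3(2)[of m] m by simp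
    finally have "\<bar>lpd_moebius_sum S m r N\<bar> \<le> (1 + 2 * C3) + 2 * ln (real m)" by simp
    also have "\<dots> \<le> K + K * ln (real m)"
      using m K1 C3(1) by (intro add_mono mult_right_mono) (auto simp: K_def)
    finally show ?thesis by (simp add: algebra_simps)
  qed
  moreover have "K > 0" using K1 C3 by (simp add: K_def)
  ultimately show ?thesis using that by blast
qed

lemma sum_divisors_flip:
  fixes f :: "nat \<Rightarrow> nat \<Rightarrow> 'a :: comm_monoid_add"
  assumes "n > 0"
  shows "(\<Sum>d | d dvd n. f d (n div d)) = (\<Sum>d | d dvd n. f (n div d) d)"
  by (rule sum.reindex_bij_witness[where i = "\<lambda>d. n div d" and j = "\<lambda>d. n div d"])
     (use assms in \<open>auto elim!: dvdE\<close>)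

definition inner_sum :: "nat set \<Rightarrow> nat \<Rightarrow> nat \<Rightarrow> real" where
  "inner_sum S e N = (\<Sum>q=1..N. if coprime q e
     then real_of_int (moebius q) / (real q * real (totient q)) * lpd_moebius_sum S (e * q) q (N div q) else 0)"

text \<open>Since \<mu>(d) vanishes unless d is squarefree, 1 / \<phi>(e d) may be expanded over the
  q dividing d. With d = q t, \<mu>(q t) is \<mu>(q) \<mu>(t) or 0 according to whether q and t are
  coprime.\<close>

lemma sum_moebius_totient_eq_inner_sum:
  assumes e: "e > 0"
  shows "(\<Sum>d=1..N. if e * d \<ge> 2 \<and> lpd (e * d) \<in> S then real_of_int (moebius d) / real (totient (e * d)) else 0) =
     1 / real (totient e) * inner_sum S e N"
proof -
  let ?ind = "\<lambda>n. if n \<ge> 2 \<and> lpd n \<in> S then 1 else (0 :: real)"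
  define h where "h q t = (if coprime q e then ?ind (e * (q * t)) * (real_of_int (moebius (q * t)) / (real (q * t) * real (totient q))) else 0)" for q t
  have "(\<Sum>d=1..N. if e * d \<ge> 2 \<and> lpd (e * d) \<in> S then real_of_int (moebius d) / real (totient (e * d)) else 0) =
      (\<Sum>d=1..N. 1 / real (totient e) * (\<Sum>q | q dvd d. h q (d div q)))"
  proof (rule sum.cong)
    fix d assume d: "d \<in> {1..N}"
    have "(\<Sum>q | q dvd d. h q (d div q)) = (\<Sum>q | q dvd d \<and> coprime q e. ?ind (e * d) * (real_of_int (moebius d) / (real d * real (totient q))))"
      using d by (intro sum.mono_neutral_cong_right) (auto simp: h_def)
    also have "\<dots> = ?ind (e * d) * (real_of_int (moebius d) / real d * (\<Sum>q | q dvd d \<and> coprime q e. 1 / real (totient q)))"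
      unfolding sum_distrib_left by (intro sum.cong) auto
    finally have eq: "(\<Sum>q | q dvd d. h q (d div q)) = ?ind (e * d) * (real_of_int (moebius d) / real d * (\<Sum>q | q dvd d \<and> coprime q e. 1 / real (totient q)))" .
    have "real_of_int (moebius d) / real (totient (e * d)) = 1 / real (totient e) * (real_of_int (moebius d) / real d * (\<Sum>q | q dvd d \<and> coprime q e. 1 / real (totient q)))"
    proof (cases "squarefree d")
      case True
      have "real_of_int (moebius d) / real (totient (e * d)) = real_of_int (moebius d) * (1 / real (totient (e * d)))" by simp
      also have "\<dots> = real_of_int (moebius d) * (1 / (real (totient e) * real d) * (\<Sum>q | q dvd d \<and> coprime q e. 1 / real (totient q)))"
        by (simp only: inverse_totient_mult_squarefree[OF e True])
      finally show ?thesis by simp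
    qed (simp add: moebius_def)
    then show "(if e * d \<ge> 2 \<and> lpd (e * d) \<in> S then real_of_int (moebius d) / real (totient (e * d)) else 0) =
        1 / real (totient e) * (\<Sum>q | q dvd d. h q (d div q))"
      unfolding eq by simp
  qed auto
  also have "\<dots> = 1 / real (totient e) * (\<Sum>d=1..N. \<Sum>q | q dvd d. h q (d div q))"
    by (rule sum_distrib_left[symmetric])
  also have "(\<Sum>d=1..N. \<Sum>q | q dvd d. h q (d div q)) = (\<Sum>q=1..N. \<Sum>t=1..N div q. h q t)"
    by (rule sum_divisors_swap)
  also have "\<dots> = inner_sum S e N"
    unfolding inner_sum_def
  proof (rule sum.cong)
    fix q assume q: "q \<in> {1..N}"
    show "(\<Sum>t=1..N div q. h q t) = (if coprime q e
     then real_of_int (moebius q) / (real q * real (totient q)) * lpd_moebius_sum S (e * q) q (N div q) else 0)"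
    proof (cases "coprime q e")
      case True
      have mm: "moebius (q * t) = (if coprime t q then moebius q * moebius t else 0)" for t
        using moebius_mult_coprime[of q t] moebius_mult_not_coprime[of q t] by (auto simp: coprime_commute)
      have "(\<Sum>t=1..N div q. h q t) = (\<Sum>t | t \<in> {1..N div q} \<and> coprime t q \<and> e * q * t \<ge> 2 \<and> lpd (e * q * t) \<in> S.
          real_of_int (moebius q) / (real q * real (totient q)) * (real_of_int (moebius t) / real t))"
        by (rule sum.mono_neutral_cong_right)
           (auto simp: h_def True mm mult.assoc)
      then show ?thesis using True by (simp only: lpd_moebius_sum_def sum_distrib_left if_True)
    qed (simp add: h_def)
  qed auto
  finally show ?thesis .
qed

text \<open>Tannery's theorem in q. The domination rests on 1 + ln(e q) \<le> (1 + ln e)(1 + ln q),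
  which also keeps a logarithmic bound in e for the next passage to the limit.\<close>

lemma inner_sum_bound_and_limit:
  assumes S: "has_log_density S \<delta>"
  obtains K where "K > 0" "\<And>e N. e > 0 \<Longrightarrow> \<bar>inner_sum S e N\<bar> \<le> K * (1 + ln (real e))"
    "\<And>e. e > 0 \<Longrightarrow> inner_sum S e \<longlonglongrightarrow> (if e = 1 then - \<delta> else 0)"
proof -
  obtain K where K: "K > 0" "\<And>m r N. m > 0 \<Longrightarrow> r dvd m \<Longrightarrow> \<bar>lpd_moebius_sum S m r N\<bar> \<le> K * (1 + ln (real m))"
    using lpd_moebius_sum_bound[OF S] by blast
  \<comment> \<open>Summable as the case \<alpha> = 1: the power of q is the factor 1 / q in front
    of 1 / \<phi>(q).\<close>
  define s where "s q = (1 + ln (real q)) * (real q powr (-1) / real (totient q))" for q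
  have summ: "summable s" unfolding s_def by (intro summable_ln_totient) auto
  have s0: "s q \<ge> 0" for q by (cases "q = 0") (auto simp: s_def)
  define F where "F e N q = (if q \<in> {1..N} \<and> coprime q e
     then real_of_int (moebius q) / (real q * real (totient q)) * lpd_moebius_sum S (e * q) q (N div q) else 0)" for e N q
  have F_bound: "norm (F e N q) \<le> K * (1 + ln (real e)) * s q" if e: "e > 0" for e N q
  proof (cases "q \<in> {1..N} \<and> coprime q e")
    case True
    then have q: "q > 0" by auto
    have "norm (F e N q) = \<bar>real_of_int (moebius q) / (real q * real (totient q))\<bar> * \<bar>lpd_moebius_sum S (e * q) q (N div q)\<bar>"
      using True by (simp add: F_def abs_mult)
    also have "\<dots> \<le> 1 / (real q * real (totient q)) * (K * (1 + ln (real (e * q))))"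
      using abs_real_moebius_le_1[of q] e q K(2)[of "e * q" q]
      by (intro mult_mono) (auto simp: divide_right_mono)
    also have "\<dots> \<le> 1 / (real q * real (totient q)) * (K * ((1 + ln (real e)) * (1 + ln (real q))))"
    proof -
      have "1 + ln (real (e * q)) \<le> (1 + ln (real e)) * (1 + ln (real q))"
        using e q by (simp add: ln_mult algebra_simps)
      then show ?thesis using K(1) by (intro mult_left_mono) auto
    qed
    also have "\<dots> = K * (1 + ln (real e)) * s q"
      using q by (simp add: s_def powr_minus divide_simps)
    finally show ?thesis .
  next
    case False
    then show ?thesis using s0[of q] K(1) e by (auto simp: F_def intro!: mult_nonneg_nonneg add_nonneg_nonneg)
  qed
  have inner_eq: "inner_sum S e N = (\<Sum>q. F e N q)" for e N
  proof -
    have "(\<Sum>q. F e N q) = (\<Sum>q\<in>{1..N}. F e N q)" by (rule suminf_finite) (auto simp: F_def)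
    then show ?thesis unfolding inner_sum_def by (simp add: F_def)
  qed
  have s_sum0: "suminf s \<ge> 0" using summ s0 by (intro suminf_nonneg)
  define K' where "K' = K * (suminf s + 1)"
  have "\<bar>inner_sum S e N\<bar> \<le> K' * (1 + ln (real e))" if e: "e > 0" for e N
  proof -
    have "norm (\<Sum>q. F e N q) \<le> (\<Sum>q. K * (1 + ln (real e)) * s q)"
      by (rule norm_suminf_le[OF F_bound[OF e] summable_mult[OF summ]])
    also have "\<dots> = K * (1 + ln (real e)) * suminf s" by (rule suminf_mult[OF summ])
    also have "\<dots> \<le> K * (1 + ln (real e)) * (suminf s + 1)" using K(1) e by (intro mult_left_mono) auto
    finally show ?thesis by (simp add: inner_eq K'_def mult_ac)
  qed
  moreover have "K' > 0" using K(1) s_sum0 by (simp add: K'_def)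
  moreover have "inner_sum S e \<longlonglongrightarrow> (if e = 1 then - \<delta> else 0)" if e: "e > 0" for e
  proof -
    let ?L = "\<lambda>q::nat. if q = 1 \<and> e = 1 then - \<delta> else 0"
    have lim: "(\<lambda>N. F e N q) \<longlonglongrightarrow> ?L q" for q
    proof (cases "q \<ge> 1 \<and> coprime q e")
      case True
      then have q: "q > 0" by auto
      have "(\<lambda>N. real_of_int (moebius q) / (real q * real (totient q)) * lpd_moebius_sum S (e * q) q (N div q)) \<longlonglongrightarrow> ?L q"
      proof (cases "e * q = 1")
        case True
        have "(\<lambda>N. - (- lpd_moebius_sum S 1 1 N)) \<longlonglongrightarrow> - \<delta>"
          using moebius_lpd_log_density[OF S] unfolding lpd_moebius_sum_1 by (rule tendsto_minus)
        then show ?thesis using True by simp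
      next
        case False
        then have "e * q \<ge> 2" using e q by (metis Suc_1 Suc_leI gr0I less_one linorder_neqE_nat mult_is_0 not_less)
        then have "(\<lambda>N. lpd_moebius_sum S (e * q) q (N div q)) \<longlonglongrightarrow> 0"
          using q by (intro filterlim_compose[OF lpd_moebius_sum_tendsto_0] filterlim_div_at_top) auto
        then have "(\<lambda>N. real_of_int (moebius q) / (real q * real (totient q)) * lpd_moebius_sum S (e * q) q (N div q)) \<longlonglongrightarrow> real_of_int (moebius q) / (real q * real (totient q)) * 0"
          by (rule tendsto_mult_left)
        then show ?thesis using False by (auto split: if_splits)
      qed
      moreover have "\<forall>\<^sub>F N in sequentially. real_of_int (moebius q) / (real q * real (totient q)) * lpd_moebius_sum S (e * q) q (N div q) = F e N q"
        using eventually_ge_at_top[of q] by eventually_elim (use True in \<open>simp add: F_def\<close>)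
      ultimately show ?thesis by (rule Lim_transform_eventually)
    next
      case False
      then have "F e N q = 0" "?L q = 0" for N by (auto simp: F_def)
      then show ?thesis by simp
    qed
    have "(\<lambda>N. \<Sum>q. F e N q) \<longlonglongrightarrow> suminf ?L"
    proof (rule tannerys_theorem[THEN conjunct2, THEN conjunct2])
      show "\<forall>\<^sub>F (q, N) in sequentially \<times>\<^sub>F sequentially. norm (F e N q) \<le> K * (1 + ln (real e)) * s q"
        using F_bound[OF e] by (intro always_eventually) auto
    qed (use lim summ in \<open>auto intro: summable_mult\<close>)
    moreover have "suminf ?L = (\<Sum>q\<in>{1}. ?L q)" by (rule suminf_finite) auto
    ultimately show ?thesis unfolding inner_eq[abs_def] by simp
  qed
  ultimately show ?thesis using that by blast
qed

text \<open>Tannery's theorem again, now in e: |a(e)| / \<phi>(e) times K (1 + ln e) is summable by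
  the assumed decay of a.\<close>

theorem dirichlet_conv_log_density:
  fixes a :: "nat \<Rightarrow> complex"
  assumes a1: "a 1 = 1" and \<alpha>: "\<alpha> > 0" and C: "\<And>n. n \<ge> 1 \<Longrightarrow> norm (a n) \<le> C * real n powr (- \<alpha>)"
    and S: "has_log_density S \<delta>"
  shows "(\<lambda>N. - (\<Sum>n | n \<in> {2..N} \<and> lpd n \<in> S. dirichlet_conv (\<lambda>d. of_int (moebius d)) a n / of_nat (totient n)))
           \<longlonglongrightarrow> complex_of_real \<delta>"
proof -
  obtain K where K: "K > 0" "\<And>e N. e > 0 \<Longrightarrow> \<bar>inner_sum S e N\<bar> \<le> K * (1 + ln (real e))"
    "\<And>e. e > 0 \<Longrightarrow> inner_sum S e \<longlonglongrightarrow> (if e = 1 then - \<delta> else 0)"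
    using inner_sum_bound_and_limit[OF S] by blast
  define g where "g e d = (if e * d \<ge> 2 \<and> lpd (e * d) \<in> S then a e * of_int (moebius d) / of_nat (totient (e * d)) else 0)" for e d
  define F where "F N e = (if e \<in> {1..N} then a e / of_nat (totient e) * of_real (inner_sum S e (N div e)) else 0)" for N e
  have eq: "(\<Sum>n | n \<in> {2..N} \<and> lpd n \<in> S. dirichlet_conv (\<lambda>d. of_int (moebius d)) a n / of_nat (totient n)) = (\<Sum>e. F N e)" for N
  proof -
    have "(\<Sum>n | n \<in> {2..N} \<and> lpd n \<in> S. dirichlet_conv (\<lambda>d. of_int (moebius d)) a n / of_nat (totient n)) =
        (\<Sum>n=1..N. \<Sum>e | e dvd n. g e (n div e))"
    proof (rule sum.mono_neutral_cong_left)
      show "\<forall>n\<in>{1..N} - {n. n \<in> {2..N} \<and> lpd n \<in> S}. (\<Sum>e | e dvd n. g e (n div e)) = 0"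
        by (auto simp: g_def intro!: sum.neutral split: if_splits)
      fix n assume n: "n \<in> {n. n \<in> {2..N} \<and> lpd n \<in> S}"
      \<comment> \<open>\<open>dirichlet_conv\<close> indexes divisors by the argument of \<mu>, the
        outer sum by that of a; hence the passage to complementary divisors.\<close>
      have "(\<Sum>e | e dvd n. g e (n div e)) = (\<Sum>e | e dvd n. g (n div e) e)"
        using n by (intro sum_divisors_flip) auto
      also have "\<dots> = (\<Sum>e | e dvd n. of_int (moebius e) * a (n div e) / of_nat (totient n))"
        using n by (intro sum.cong) (auto simp: g_def)
      finally show "dirichlet_conv (\<lambda>d. of_int (moebius d)) a n / of_nat (totient n) = (\<Sum>e | e dvd n. g e (n div e))"
        by (simp add: dirichlet_conv_def sum_divide_distrib)
    qed auto
    also have "\<dots> = (\<Sum>e=1..N. \<Sum>d=1..N div e. g e d)" by (rule sum_divisors_swap)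
    also have "\<dots> = (\<Sum>e=1..N. F N e)"
    proof (rule sum.cong)
      fix e assume e: "e \<in> {1..N}"
      then have "e > 0" by simp
      note * = sum_moebius_totient_eq_inner_sum[OF this, of S "N div e"]
      have "(\<Sum>d=1..N div e. g e d) = a e * of_real (\<Sum>d=1..N div e. if e * d \<ge> 2 \<and> lpd (e * d) \<in> S then real_of_int (moebius d) / real (totient (e * d)) else 0)"
        unfolding of_real_sum sum_distrib_left by (intro sum.cong) (auto simp: g_def)
      also have "\<dots> = F N e" unfolding * using e by (simp add: F_def)
      finally show "(\<Sum>d=1..N div e. g e d) = F N e" .
    qed auto
    also have "\<dots> = (\<Sum>e. F N e)" by (rule suminf_finite[symmetric]) (auto simp: F_def)
    finally show ?thesis .
  qed
  define s where "s n = (1 + ln (real n)) * (real n powr (- \<alpha>) / real (totient n))" for n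
  have summ: "summable s" unfolding s_def using \<alpha> by (rule summable_ln_totient)
  have s0: "s n \<ge> 0" for n by (cases "n = 0") (auto simp: s_def)
  have C0: "C \<ge> 0" using C[of 1] a1 by simp
  have bound: "norm (F N e) \<le> C * K * s e" for N e
  proof (cases "e \<in> {1..N}")
    case True
    then have "norm (F N e) = norm (a e) / real (totient e) * \<bar>inner_sum S e (N div e)\<bar>"
      by (simp add: F_def norm_mult norm_divide)
    also have "\<dots> \<le> (C * real e powr (- \<alpha>)) / real (totient e) * (K * (1 + ln (real e)))"
      using True K(2)[of e] C[of e] C0 by (intro mult_mono divide_right_mono) auto
    also have "\<dots> = C * K * s e" by (simp add: s_def)
    finally show ?thesis .
  next
    case False
    then have "F N e = 0" by (auto simp: F_def)
    then show ?thesis using C0 K(1) s0[of e] by simp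
  qed
  let ?L = "\<lambda>e::nat. if e = 1 then - complex_of_real \<delta> else 0"
  have lim: "(\<lambda>N. F N e) \<longlonglongrightarrow> ?L e" for e
  proof (cases "e = 0")
    case False
    then have e: "e > 0" by simp
    have "(\<lambda>N. a e / of_nat (totient e) * of_real (inner_sum S e (N div e))) \<longlonglongrightarrow> a e / of_nat (totient e) * of_real (if e = 1 then - \<delta> else 0)"
      using e by (intro tendsto_mult_left tendsto_of_real filterlim_compose[OF K(3)] filterlim_div_at_top)
    moreover have "a e / of_nat (totient e) * of_real (if e = 1 then - \<delta> else 0) = ?L e" using a1 by auto
    moreover have "\<forall>\<^sub>F N in sequentially. a e / of_nat (totient e) * of_real (inner_sum S e (N div e)) = F N e"
      using eventually_ge_at_top[of e] by eventually_elim (use e in \<open>simp add: F_def\<close>)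
    ultimately show ?thesis by (simp only:) (rule Lim_transform_eventually)
  qed (simp add: F_def)
  have "(\<lambda>N. \<Sum>e. F N e) \<longlonglongrightarrow> suminf ?L"
  proof (rule tannerys_theorem[THEN conjunct2, THEN conjunct2])
    show "\<forall>\<^sub>F (e, N) in sequentially \<times>\<^sub>F sequentially. norm (F N e) \<le> C * K * s e"
      using bound by (intro always_eventually) auto
  qed (use lim summ in \<open>auto intro: summable_mult\<close>)
  moreover have "suminf ?L = (\<Sum>e\<in>{1}. ?L e)" by (rule suminf_finite) auto
  ultimately have "(\<lambda>N. \<Sum>e. F N e) \<longlonglongrightarrow> - complex_of_real \<delta>" by simp
  from tendsto_minus[OF this] show ?thesis unfolding eq by simp
qed

section \<open>Dirichlet characters\<close>

text \<open>Extended to all of nat by 0 off the residues coprime to k, so that periodicity and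
  complete multiplicativity can be stated without reference to the unit group.\<close>

definition dirichlet_char :: "nat \<Rightarrow> (nat \<Rightarrow> complex) \<Rightarrow> bool" where
  "dirichlet_char k \<psi> \<longleftrightarrow> \<psi> 1 = 1 \<and> (\<forall>m n. \<psi> (m * n) = \<psi> m * \<psi> n) \<and> (\<forall>n. \<psi> (n + k) = \<psi> n) \<and>
     (\<forall>n. \<psi> n = 0 \<longleftrightarrow> \<not> coprime n k)"

definition principal_char :: "nat \<Rightarrow> nat \<Rightarrow> complex" where
  "principal_char k n = (if coprime n k then 1 else 0)"

lemma periodic_cong:
  fixes f :: "nat \<Rightarrow> 'a"
  assumes "\<And>n. f (n + k) = f n" "[m = n] (mod k)"
  shows "f m = f n"
proof -
  have shift: "f (n + j * k) = f n" for n j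
  proof (induction j)
    case (Suc j)
    have "f (n + Suc j * k) = f ((n + j * k) + k)" by (simp add: algebra_simps)
    then show ?case using assms(1) Suc by simp
  qed simp
  have "f m = f (m mod k)" using shift[of "m mod k" "m div k"] by simp
  also have "\<dots> = f (n mod k)" using assms(2) by (simp add: cong_def)
  also have "\<dots> = f n" using shift[of "n mod k" "n div k"] by simp
  finally show ?thesis .
qed

lemma sum_root_unity_inverse:
  assumes M: "M > 0" and i: "i < M"
  shows "(\<Sum>j<M. inverse (exp (2 * of_real pi * \<i> * of_nat j / of_nat M)) ^ i) = (if i = 0 then of_nat M else 0 :: complex)"
proof (cases "i = 0")
  case False
  define z where "z = inverse (exp (2 * of_real pi * \<i> * of_nat i / of_nat M))"
  have eq: "inverse (exp (2 * of_real pi * \<i> * of_nat j / of_nat M)) ^ i = z ^ j" for j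
    by (simp add: z_def power_inverse exp_of_nat_mult[symmetric] field_simps)
  have "\<not> M dvd i" using False i by (auto dest: dvd_imp_le)
  then have "exp (2 * of_real pi * \<i> * of_nat i / of_nat M) \<noteq> 1"
    using complex_root_unity_eq_1[of M i] M by auto
  then have z1: "z \<noteq> 1" by (simp add: z_def)
  have "exp (2 * of_real pi * \<i> * of_nat i / of_nat M) ^ M = (1 :: complex)"
    using complex_root_unity[of M i] M by simp
  then have zM: "z ^ M = 1" by (simp add: z_def power_inverse)
  have "(\<Sum>j<M. z ^ j) = 0" using geometric_sum[OF z1, of M] zM by simp
  then show ?thesis using False eq by simp
qed simp

text \<open>An interpolation between arbitrary functions on the residues coprime to k, for A empty,
  and multiples of characters, once A contains all of these residues. Enlarging A by one unit at a
  time expands an indicator function into characters.\<close>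

definition eigen_on :: "nat \<Rightarrow> nat set \<Rightarrow> (nat \<Rightarrow> complex) \<Rightarrow> bool" where
  "eigen_on k A f \<longleftrightarrow> (\<forall>n. f (n + k) = f n) \<and> (\<forall>n. \<not> coprime n k \<longrightarrow> f n = 0) \<and> (\<forall>g\<in>A. \<exists>c. \<forall>n. f (g * n) = c * f n)"

text \<open>Averaging the translates of \<open>f\<close> by powers of \<open>g\<close> against roots of unity splits \<open>f\<close> into
  eigenfunctions of multiplication by \<open>g\<close>, without losing the eigenvalues already present.\<close>

lemma eigen_on_split:
  assumes k: "k > 0" and f: "eigen_on k A f" and g: "coprime g k"
  obtains hs where "\<And>h. h \<in> set hs \<Longrightarrow> eigen_on k (insert g A) h" "\<And>n. f n = (\<Sum>h\<leftarrow>hs. h n)"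
proof -
  define M where "M = totient k"
  have M: "M > 0" using k by (simp add: M_def)
  have per: "f (n + k) = f n" for n using f by (simp add: eigen_on_def)
  have gM: "f (g ^ M * n) = f n" for n
  proof (rule periodic_cong[where f = f and k = k, OF per])
    have "[g ^ M = 1] (mod k)" unfolding M_def by (rule euler_theorem[OF g])
    then show "[g ^ M * n = n] (mod k)" using cong_mult[of "g ^ M" 1 k n n] by simp
  qed
  define W where "W j = exp (2 * of_real pi * \<i> * of_nat j / of_nat M)" for j :: nat
  have WM: "W j ^ M = 1" for j unfolding W_def using complex_root_unity[of M j] M by simp
  have W0: "W j \<noteq> 0" for j by (simp add: W_def)
  \<comment> \<open>The projection onto the eigenvalue \<open>W j\<close>: since g^M acts as the
    identity, all eigenvalues are M-th roots of unity. Some of these projections may vanish.\<close>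
  define h where "h j n = (1 / of_nat M) * (\<Sum>i<M. inverse (W j) ^ i * f (g ^ i * n))" for j n
  have eig: "h j (g * n) = W j * h j n" for j n
  proof -
    define F where "F i = inverse (W j) ^ i * f (g ^ i * n)" for i
    have FM: "F M = F 0" using gM[of n] WM[of j] by (simp add: F_def power_inverse)
    have step: "inverse (W j) ^ i * f (g ^ i * (g * n)) = W j * F (Suc i)" for i
    proof -
      have "g ^ i * (g * n) = g ^ Suc i * n" by simp
      then show ?thesis using W0[of j] by (simp add: F_def field_simps)
    qed
    have "(\<Sum>i<M. F (Suc i)) = (\<Sum>i<M. F i)"
      using FM sum.lessThan_Suc_shift[of F M] sum.lessThan_Suc[of F M] by simp
    then show ?thesis unfolding h_def step by (simp add: F_def sum_distrib_left[symmetric])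
  qed
  have "eigen_on k (insert g A) (h j)" for j
    unfolding eigen_on_def
  proof (intro conjI allI impI ballI)
    fix n
    show "h j (n + k) = h j n"
    proof -
      have "f (g ^ i * (n + k)) = f (g ^ i * n)" for i
        by (rule periodic_cong[where f = f and k = k, OF per]) (simp add: cong_def algebra_simps)
      then show ?thesis by (simp add: h_def)
    qed
    show "h j n = 0" if "\<not> coprime n k"
    proof -
      have "\<not> coprime (g ^ i * n) k" for i using that by simp
      then have "f (g ^ i * n) = 0" for i using f by (simp add: eigen_on_def)
      then show ?thesis by (simp add: h_def)
    qed
  next
    fix a assume a: "a \<in> insert g A"
    show "\<exists>c. \<forall>n. h j (a * n) = c * h j n"
    proof (cases "a = g")
      case False
      then have "\<exists>c. \<forall>n. f (a * n) = c * f n" using f a unfolding eigen_on_def by blast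
      then obtain c where c: "\<forall>n. f (a * n) = c * f n" by blast
      have "h j (a * n) = c * h j n" for n
      proof -
        have "f (g ^ i * (a * n)) = c * f (g ^ i * n)" for i
          using spec[OF c, of "g ^ i * n"] by (simp add: mult_ac)
        then show ?thesis unfolding h_def sum_distrib_left by (intro sum.cong) auto
      qed
      then show ?thesis by blast
    qed (use eig in auto)
  qed
  moreover have "f n = (\<Sum>h\<leftarrow>map h [0..<M]. h n)" for n
  proof -
    have "(\<Sum>h\<leftarrow>map h [0..<M]. h n) = (\<Sum>j<M. h j n)"
      by (simp add: interv_sum_list_conv_sum_set_nat o_def atLeast0LessThan)
    also have "\<dots> = (1 / of_nat M) * (\<Sum>i<M. (\<Sum>j<M. inverse (W j) ^ i) * f (g ^ i * n))"
      unfolding h_def sum_distrib_left[symmetric] sum_distrib_right by (subst sum.swap) simp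
    also have "(\<Sum>i<M. (\<Sum>j<M. inverse (W j) ^ i) * f (g ^ i * n)) = (\<Sum>i<M. if i = 0 then of_nat M * f n else 0)"
    proof (rule sum.cong)
      fix i assume "i \<in> {..<M}"
      then have "(\<Sum>j<M. inverse (W j) ^ i) = (if i = 0 then of_nat M else 0 :: complex)"
        unfolding W_def by (intro sum_root_unity_inverse) auto
      then show "(\<Sum>j<M. inverse (W j) ^ i) * f (g ^ i * n) = (if i = 0 then of_nat M * f n else 0)" by auto
    qed auto
    also have "(1 / of_nat M) * \<dots> = f n" using M by simp
    finally show ?thesis by simp
  qed
  ultimately show ?thesis using that[of "map h [0..<M]"] by auto
qed

lemma eigen_on_decompose:
  assumes k: "k > 0" and "finite A" "\<And>g. g \<in> A \<Longrightarrow> coprime g k" and f: "eigen_on k {} f"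
  shows "\<exists>hs. (\<forall>h\<in>set hs. eigen_on k A h) \<and> (\<forall>n. f n = (\<Sum>h\<leftarrow>hs. h n))"
  using assms(2,3)
proof (induction A rule: finite_induct)
  case empty
  then show ?case using f by (intro exI[of _ "[f]"]) auto
next
  case (insert g A)
  then obtain hs where hs: "\<forall>h\<in>set hs. eigen_on k A h" "\<forall>n. f n = (\<Sum>h\<leftarrow>hs. h n)" by auto
  have g: "coprime g k" using insert.prems by simp
  have "\<exists>hs'. (\<forall>h\<in>set hs'. eigen_on k (insert g A) h) \<and> (\<forall>n. (\<Sum>h\<leftarrow>hs. h n) = (\<Sum>h\<leftarrow>hs'. h n))"
    using hs(1)
  proof (induction hs)
    case (Cons h hs)
    then obtain hs' where hs': "\<forall>h\<in>set hs'. eigen_on k (insert g A) h" "\<forall>n. (\<Sum>h\<leftarrow>hs. h n) = (\<Sum>h\<leftarrow>hs'. h n)" by auto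
    have "eigen_on k A h" using Cons.prems by simp
    from eigen_on_split[OF k this g] obtain hs'' where
      "\<And>h. h \<in> set hs'' \<Longrightarrow> eigen_on k (insert g A) h" "\<And>n. h n = (\<Sum>h\<leftarrow>hs''. h n)" by blast
    then show ?case using hs' by (intro exI[of _ "hs'' @ hs'"]) auto
  qed (auto intro: exI[of _ "[]"])
  then show ?case using hs(2) by auto
qed

text \<open>The eigenvalue at g is visible at n = 1, where h(g) = c h(1); hence h(g n) h(1) = h(g)
  h(n), and h / h(1) is multiplicative. If h(1) = 0, then h(n)^2 = 0 for n coprime to k, and h is
  the zero multiple of the principal character.\<close>

lemma eigen_on_imp_char:
  assumes k: "k > 0" and h: "eigen_on k {g. g \<le> k \<and> coprime g k} h"
  shows "\<exists>c \<psi>. dirichlet_char k \<psi> \<and> (\<forall>n. h n = c * \<psi> n)"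
proof -
  have per: "h (n + k) = h n" and nc: "\<not> coprime n k \<Longrightarrow> h n = 0" for n using h by (auto simp: eigen_on_def)
  have eig: "h (g * n) * h 1 = h g * h n" for g n
  proof (cases "coprime g k")
    case True
    have "g mod k \<le> k" using mod_less_divisor[OF k, of g] by linarith
    then have "g mod k \<in> {g. g \<le> k \<and> coprime g k}" using True k by simp
    then have "\<exists>c. \<forall>n. h ((g mod k) * n) = c * h n" using h unfolding eigen_on_def by blast
    then obtain c where c: "\<forall>n. h ((g mod k) * n) = c * h n" by blast
    have cg: "h (g * n) = c * h n" for n
    proof -
      have "h (g * n) = h ((g mod k) * n)" by (rule periodic_cong[where f = h and k = k, OF per]) (simp add: cong_def mod_mult_left_eq)
      then show ?thesis using c by simp
    qed
    show ?thesis using cg[of n] cg[of 1] by simp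
  next
    case False
    then have "\<not> coprime (g * n) k" by simp
    then show ?thesis using nc False by simp
  qed
  show ?thesis
  proof (cases "h 1 = 0")
    case True
    have "h n = 0" for n
    proof (cases "coprime n k")
      case c: True
      then have "h n * h n = 0" using eig[of n n] True by simp
      then show ?thesis by simp
    qed (rule nc)
    moreover have "dirichlet_char k (principal_char k)"
    proof -
      have "coprime (n + k) k \<longleftrightarrow> coprime n k" for n by (metis coprime_iff_gcd_eq_1 gcd_add1)
      then show ?thesis by (auto simp: dirichlet_char_def principal_char_def)
    qed
    ultimately show ?thesis by (intro exI[of _ 0] exI[of _ "principal_char k"]) auto
  next
    case False
    define \<psi> where "\<psi> n = h n / h 1" for n
    have mult: "\<psi> (m * n) = \<psi> m * \<psi> n" for m n
      using eig[of m n] False by (simp add: \<psi>_def field_simps)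
    have nz: "\<psi> n \<noteq> 0" if n: "coprime n k" for n
    proof
      assume "\<psi> n = 0"
      have "\<psi> (n ^ totient k) = \<psi> 1"
        by (rule periodic_cong[where k = k]) (use per euler_theorem[OF n] in \<open>auto simp: \<psi>_def\<close>)
      moreover have "n ^ totient k = n * n ^ (totient k - 1)"
        using k by (simp add: power_eq_if)
      ultimately have "\<psi> n * \<psi> (n ^ (totient k - 1)) = \<psi> 1" using mult by metis
      then show False using \<open>\<psi> n = 0\<close> False by (simp add: \<psi>_def)
    qed
    have "dirichlet_char k \<psi>"
      unfolding dirichlet_char_def using mult nz nc per False by (auto simp: \<psi>_def)
    moreover have "h n = h 1 * \<psi> n" for n using False by (simp add: \<psi>_def)
    ultimately show ?thesis by blast
  qed
qed

text \<open>Obtained by decomposing the indicator into eigenfunctions for all units. Characters may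
  repeat in the list and the coefficients stay undetermined; the total coefficient of the principal
  character is found later by averaging over a period.\<close>

theorem residue_class_char_expansion:
  assumes k: "k > 0" and l: "coprime l k"
  obtains cs where "\<And>c \<psi>. (c, \<psi>) \<in> set cs \<Longrightarrow> dirichlet_char k \<psi>"
    "\<And>n. (if [n = l] (mod k) then 1 else 0) = (\<Sum>(c, \<psi>)\<leftarrow>cs. c * \<psi> n)"
proof -
  define f where "f n = (if [n = l] (mod k) then 1 else 0 :: complex)" for n
  have eig: "eigen_on k {} f"
    unfolding eigen_on_def f_def using l cong_imp_coprime[of l _ k] by (auto simp: cong_def)
  have "finite {g. g \<le> k \<and> coprime g k}" by simp
  from eigen_on_decompose[OF k this _ eig]
  have "\<exists>hs. (\<forall>h\<in>set hs. eigen_on k {g. g \<le> k \<and> coprime g k} h) \<and> (\<forall>n. f n = (\<Sum>h\<leftarrow>hs. h n))"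
    by simp
  then obtain hs where hs: "\<forall>h\<in>set hs. eigen_on k {g. g \<le> k \<and> coprime g k} h" "\<forall>n. f n = (\<Sum>h\<leftarrow>hs. h n)"
    by (elim exE conjE)
  have "\<exists>cs. (\<forall>(c, \<psi>)\<in>set cs. dirichlet_char k \<psi>) \<and> (\<forall>n. (\<Sum>h\<leftarrow>hs. h n) = (\<Sum>(c, \<psi>)\<leftarrow>cs. c * \<psi> n))"
    using hs(1)
  proof (induction hs)
    case (Cons h hs)
    then obtain cs where cs: "\<forall>(c, \<psi>)\<in>set cs. dirichlet_char k \<psi>" "\<forall>n. (\<Sum>h\<leftarrow>hs. h n) = (\<Sum>(c, \<psi>)\<leftarrow>cs. c * \<psi> n)" by auto
    obtain c \<psi> where "dirichlet_char k \<psi>" "\<forall>n. h n = c * \<psi> n" using eigen_on_imp_char[OF k, of h] Cons.prems by auto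
    then show ?case using cs by (intro exI[of _ "(c, \<psi>) # cs"]) auto
  qed (auto intro: exI[of _ "[]"])
  then obtain cs where "\<forall>(c, \<psi>)\<in>set cs. dirichlet_char k \<psi>" "\<forall>n. (\<Sum>h\<leftarrow>hs. h n) = (\<Sum>(c, \<psi>)\<leftarrow>cs. c * \<psi> n)" by blast
  note cs = this
  show ?thesis
  proof (rule that[of cs])
    show "dirichlet_char k \<psi>" if "(c, \<psi>) \<in> set cs" for c \<psi>
      using bspec[OF cs(1) that] by simp
    show "(if [n = l] (mod k) then 1 else 0) = (\<Sum>(c, \<psi>)\<leftarrow>cs. c * \<psi> n)" for n
      using spec[OF cs(2), of n] spec[OF hs(2), of n] unfolding f_def by (rule trans[rotated])
  qed
qed

section \<open>Sums of values of a character\<close>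

context
  fixes k :: nat and \<psi> :: "nat \<Rightarrow> complex"
  assumes k: "k > 0" and \<psi>: "dirichlet_char k \<psi>"
begin

lemma char_1: "\<psi> 1 = 1" "\<psi> (Suc 0) = 1" and char_mult: "\<psi> (m * n) = \<psi> m * \<psi> n"
  and char_periodic: "\<psi> (n + k) = \<psi> n" and char_eq_0_iff: "\<psi> n = 0 \<longleftrightarrow> \<not> coprime n k"
  using \<psi> by (auto simp: dirichlet_char_def)

lemma char_cong: "[m = n] (mod k) \<Longrightarrow> \<psi> m = \<psi> n"
  by (rule periodic_cong[where f = \<psi> and k = k, OF char_periodic])

lemma char_power: "\<psi> (n ^ j) = \<psi> n ^ j"
  by (induction j) (auto simp: char_1 char_mult)

lemma norm_char: "norm (\<psi> n) = (if coprime n k then 1 else 0)"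
proof (cases "coprime n k")
  case True
  have "\<psi> n ^ totient k = 1"
    using char_cong[OF euler_theorem[OF True]] by (simp add: char_power char_1)
  then have "norm (\<psi> n) = 1" using power_eq_1_iff[of "\<psi> n" "totient k"] k by auto
  then show ?thesis using True by simp
qed (use char_eq_0_iff in auto)

lemma norm_char_le_1: "norm (\<psi> n) \<le> 1"
  by (simp add: norm_char)

text \<open>Multiplication by a g with \<psi>(g) different from 0 and 1 permutes the residues and
  multiplies the sum by \<psi>(g).\<close>

lemma sum_char_period:
  assumes "\<psi> \<noteq> principal_char k"
  shows "(\<Sum>n=1..k. \<psi> n) = 0"
proof -
  obtain g where "\<psi> g \<noteq> principal_char k g" using assms by auto
  then have g: "coprime g k" "\<psi> g \<noteq> 1" using char_eq_0_iff[of g] by (auto simp: principal_char_def split: if_splits)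
  have shift: "(\<Sum>n=1..k. \<psi> n) = (\<Sum>n<k. \<psi> n)"
  proof -
    have "(\<Sum>n<Suc k. \<psi> n) = \<psi> 0 + (\<Sum>n=1..k. \<psi> n)"
      by (simp add: sum.lessThan_Suc_shift sum.atLeast1_atMost_eq del: sum.lessThan_Suc)
    moreover have "\<psi> k = \<psi> 0" using char_periodic[of 0] by simp
    ultimately show ?thesis by simp
  qed
  have "(\<Sum>n<k. \<psi> n) = (\<Sum>n<k. \<psi> ((g * n) mod k))"
  proof (rule sum.reindex_bij_betw[symmetric])
    have inj: "inj_on (\<lambda>n. (g * n) mod k) {..<k}"
    proof (rule inj_onI)
      fix x y assume xy: "x \<in> {..<k}" "y \<in> {..<k}" "g * x mod k = g * y mod k"
      then have "[g * x = g * y] (mod k)" by (simp add: cong_def)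
      then have "[x = y] (mod k)" using g(1) by (simp add: cong_mult_lcancel_nat)
      then show "x = y" using xy by (simp add: cong_def)
    qed
    have "(\<lambda>n. (g * n) mod k) ` {..<k} = {..<k}"
      by (rule endo_inj_surj[OF _ _ inj]) (use k in auto)
    with inj show "bij_betw (\<lambda>n. (g * n) mod k) {..<k} {..<k}" by (simp add: bij_betw_def)
  qed
  also have "\<dots> = (\<Sum>n<k. \<psi> g * \<psi> n)"
    by (intro sum.cong) (auto simp: char_mult[symmetric] cong_def intro!: char_cong)
  also have "\<dots> = \<psi> g * (\<Sum>n<k. \<psi> n)" by (rule sum_distrib_left[symmetric])
  finally have "(\<Sum>n<k. \<psi> n) = \<psi> g * (\<Sum>n<k. \<psi> n)" .
  then have "(1 - \<psi> g) * (\<Sum>n<k. \<psi> n) = 0" by (simp add: algebra_simps)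
  then show ?thesis using g(2) shift by simp
qed

lemma sum_char_bounded:
  assumes "\<psi> \<noteq> principal_char k"
  shows "norm (\<Sum>n=1..N. \<psi> n) \<le> real k"
proof (induction N rule: less_induct)
  case (less N)
  have Y: "(\<Sum>n=1..M + k. \<psi> n) = (\<Sum>n=1..M. \<psi> n)" for M
  proof (induction M)
    case 0
    then show ?case using sum_char_period[OF assms] by simp
  next
    case (Suc M)
    then show ?case using char_periodic[of "Suc M"] by simp
  qed
  show ?case
  proof (cases "N < k")
    case True
    have "norm (\<Sum>n=1..N. \<psi> n) \<le> (\<Sum>n=1..N. 1)" using norm_char_le_1 by (rule sum_norm_le)
    then show ?thesis using True by simp
  next
    case False
    then show ?thesis using Y[of "N - k"] less[of "N - k"] k by simp
  qed
qed

lemma sum_char_interval_bounded: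
  assumes "\<psi> \<noteq> principal_char k" "a \<ge> 1"
  shows "norm (\<Sum>n=a..b. \<psi> n) \<le> 2 * real k"
proof (cases "a \<le> b")
  case True
  have "{1..b} = {1..a - 1} \<union> {a..b}" using True assms by auto
  then have "(\<Sum>n=1..b. \<psi> n) = (\<Sum>n=1..a - 1. \<psi> n) + (\<Sum>n=a..b. \<psi> n)"
    by (simp only:) (subst sum.union_disjoint, use assms in auto)
  then have "(\<Sum>n=a..b. \<psi> n) = (\<Sum>n=1..b. \<psi> n) - (\<Sum>n=1..a - 1. \<psi> n)" by simp
  then have "norm (\<Sum>n=a..b. \<psi> n) \<le> norm (\<Sum>n=1..b. \<psi> n) + norm (\<Sum>n=1..a - 1. \<psi> n)"
    by (simp only: norm_triangle_ineq4)
  also have "\<dots> \<le> real k + real k" by (intro add_mono sum_char_bounded assms)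
  finally show ?thesis by simp
qed simp

text \<open>Here L is L(1, \<psi>). The explicit rate, of order d / N at the argument N div d, is
  what makes the Mertens sums bounded.\<close>

lemma char_L1:
  assumes "\<psi> \<noteq> principal_char k"
  obtains L where "\<And>N. norm ((\<Sum>n=1..N. \<psi> n / of_nat n) - L) \<le> 2 * real k / real (Suc N)"
proof -
  let ?s = "\<lambda>N. \<Sum>n=1..N. \<psi> n / of_nat n"
  have diff: "norm (?s M - ?s N) \<le> 2 * real k / real (Suc N)" if "M \<ge> N" for M N
  proof (cases "Suc N \<le> M")
    case True
    have "{1..M} = {1..N} \<union> {Suc N..M}" using that by auto
    then have "?s M = ?s N + (\<Sum>n=Suc N..M. \<psi> n / of_nat n)"
      by (simp only:) (subst sum.union_disjoint, auto)
    then have "?s M - ?s N = (\<Sum>n=Suc N..M. (1 / real n) *\<^sub>R \<psi> n)" by (simp add: scaleR_conv_of_real)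
    also have "norm \<dots> \<le> 1 / real (Suc N) * (2 * real k)"
      using True sum_char_interval_bounded[OF assms] by (intro abel_inequality) (auto simp: field_simps)
    finally show ?thesis by simp
  next
    case False
    then have "M = N" using that by simp
    then show ?thesis by simp
  qed
  have "Cauchy ?s"
  proof (rule metric_CauchyI)
    fix e :: real assume e: "e > 0"
    obtain N0 where N0: "real N0 > 4 * real k / e" using reals_Archimedean2 by blast
    have close: "norm (?s m - ?s N0) < e / 2" if "m \<ge> N0" for m
    proof -
      have "2 * real k / real (Suc N0) < e / 2"
      proof -
        have "4 * real k / e < real (Suc N0)" using N0 by simp
        then show ?thesis using e by (simp add: field_simps)
      qed
      then show ?thesis using diff[OF that] by linarith
    qed
    have "dist (?s m) (?s n) < e" if "m \<ge> N0" "n \<ge> N0" for m n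
    proof -
      have "norm (a - b) \<le> norm (a - c) + norm (b - c)" for a b c :: complex
        using norm_triangle_ineq4[of "a - c" "b - c"] by simp
      from this[of "?s m" "?s n" "?s N0"] have "dist (?s m) (?s n) \<le> norm (?s m - ?s N0) + norm (?s n - ?s N0)"
        by (simp only: dist_norm)
      then show ?thesis using close[OF that(1)] close[OF that(2)] by linarith
    qed
    then show "\<exists>M. \<forall>m\<ge>M. \<forall>n\<ge>M. dist (?s m) (?s n) < e" by blast
  qed
  then obtain L where L: "?s \<longlonglongrightarrow> L" using Cauchy_convergent_iff convergent_def by metis
  have "norm (?s N - L) \<le> 2 * real k / real (Suc N)" for N
  proof -
    have "(\<lambda>M. norm (?s M - ?s N)) \<longlonglongrightarrow> norm (L - ?s N)" by (intro tendsto_intros L)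
    then have "norm (L - ?s N) \<le> 2 * real k / real (Suc N)"
      by (rule tendsto_upperbound) (use diff in \<open>auto simp: eventually_sequentially\<close>)
    then show ?thesis by (simp add: norm_minus_commute)
  qed
  then show ?thesis using that by blast
qed

end

section \<open>Non-vanishing of L(1)\<close>

text \<open>Moebius inversion gives \<Lambda>(n) as the sum of \<mu>(d) ln(n / d) over the divisors
  d; the part with ln n drops out, for n = 1 because ln 1 = 0.\<close>

lemma sum_moebius_ln_divisors:
  assumes n: "n > 0"
  shows "(\<Sum>d | d dvd n. real_of_int (moebius d) * ln (real d)) = - mangoldt n"
proof -
  have "(\<Sum>d | d dvd n. real_of_int (moebius d) * ln (real (n div d))) =
      (\<Sum>d | d dvd n. \<Sum>c | c dvd n div d. real_of_int (moebius d) * mangoldt c)"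
  proof (rule sum.cong)
    fix d assume "d \<in> {d. d dvd n}"
    then have "n div d > 0" using n by (auto elim!: dvdE)
    then have "ln (real (n div d)) = (\<Sum>c | c dvd n div d. mangoldt c)"
      using mangoldt_sum[of "n div d", where ?'a = real] by simp
    then show "real_of_int (moebius d) * ln (real (n div d)) = (\<Sum>c | c dvd n div d. real_of_int (moebius d) * mangoldt c)"
      by (simp only: sum_distrib_left)
  qed auto
  also have "\<dots> = (\<Sum>(d, c)\<in>Sigma {d. d dvd n} (\<lambda>d. {c. c dvd n div d}). real_of_int (moebius d) * mangoldt c)"
    using n by (intro sum.Sigma) (auto elim!: dvdE)
  also have "\<dots> = (\<Sum>(c, d)\<in>Sigma {c. c dvd n} (\<lambda>c. {d. d dvd n div c}). real_of_int (moebius d) * mangoldt c)"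
    using n by (intro sum.reindex_bij_witness[where i = "\<lambda>(c, d). (d, c)" and j = "\<lambda>(d, c). (c, d)"])
      (auto simp: dvd_div_iff_mult intro: dvd_mult_left dvd_mult_right elim!: dvdE)
  also have "\<dots> = (\<Sum>c | c dvd n. \<Sum>d | d dvd n div c. real_of_int (moebius d) * mangoldt c)"
    using n by (intro sum.Sigma[symmetric]) (auto elim!: dvdE)
  also have "\<dots> = (\<Sum>c | c dvd n. if c = n then mangoldt c else 0)"
  proof (rule sum.cong)
    fix c assume "c \<in> {c. c dvd n}"
    then obtain m where m: "n = c * m" by auto
    have m0: "m > 0" "c > 0" using n m by auto
    have "(\<Sum>d | d dvd n div c. real_of_int (moebius d) * mangoldt c) = real_of_int (\<Sum>d | d dvd m. moebius d) * mangoldt c"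
      using m m0 by (simp add: sum_distrib_right)
    also have "\<dots> = (if c = n then mangoldt c else 0)" using m m0 by (simp add: sum_moebius_divisors)
    finally show "(\<Sum>d | d dvd n div c. real_of_int (moebius d) * mangoldt c) = (if c = n then mangoldt c else 0)" .
  qed auto
  also have "\<dots> = mangoldt n" using n by (simp add: sum.delta)
  finally have 1: "(\<Sum>d | d dvd n. real_of_int (moebius d) * ln (real (n div d))) = mangoldt n" .
  have "(\<Sum>d | d dvd n. real_of_int (moebius d) * ln (real (n div d))) =
      (\<Sum>d | d dvd n. real_of_int (moebius d) * ln (real n) - real_of_int (moebius d) * ln (real d))"
  proof (rule sum.cong)
    fix d assume "d \<in> {d. d dvd n}"
    then obtain m where "n = d * m" by auto
    then show "real_of_int (moebius d) * ln (real (n div d)) = real_of_int (moebius d) * ln (real n) - real_of_int (moebius d) * ln (real d)"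
      using n by (simp add: ln_mult algebra_simps)
  qed auto
  also have "\<dots> = real_of_int (\<Sum>d | d dvd n. moebius d) * ln (real n) - (\<Sum>d | d dvd n. real_of_int (moebius d) * ln (real d))"
    by (simp add: sum_subtractf sum_distrib_right)
  also have "real_of_int (\<Sum>d | d dvd n. moebius d) * ln (real n) = 0" using n by (simp add: sum_moebius_divisors)
  finally show ?thesis using 1 by simp
qed

lemma inverse_mult_Suc_div_le:
  assumes "N \<ge> 1" "d \<ge> 1"
  shows "1 / (real d * real (Suc (N div d))) \<le> 1 / real N"
proof -
  have "N < d * Suc (N div d)" using assms dividend_less_times_div[of d N] by (simp add: algebra_simps)
  then have "real N \<le> real d * real (Suc (N div d))" by (metis less_imp_le of_nat_le_iff of_nat_mult)
  then show ?thesis using assms by (intro divide_left_mono) auto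
qed

text \<open>Mertens' dichotomy, where the partial sums s(M) of \<psi>(n) / n are L + O(1 / M).
  Summing \<psi>(n) ln n / n through the divisors of n produces the sum of s(N / d) \<psi>(d)
  \<Lambda>(d) / d, so L G is bounded by Chebyshev's bound. If L = 0, the weights \<mu>(d) ln(N / d)
  produce G + ln N in the same way, which is at most 2k / N times the sum of ln(N / d) over d \<le>
  N, and that sum is at most N.\<close>

lemma char_mangoldt_sums:
  assumes k: "k > 0" and ch: "dirichlet_char k \<psi>" and np: "\<psi> \<noteq> principal_char k"
  defines "G \<equiv> \<lambda>N. \<Sum>n=1..N. \<psi> n * mangoldt n / of_nat n"
  obtains L where "\<forall>N. norm ((\<Sum>n=1..N. \<psi> n / of_nat n) - L) \<le> 2 * real k / real (Suc N)"
    "L \<noteq> 0 \<longrightarrow> (\<exists>B. \<forall>N\<ge>1. norm (G N) \<le> B)"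
    "L = 0 \<longrightarrow> (\<forall>N\<ge>1. norm (G N + of_real (ln (real N))) \<le> 2 * real k)"
proof -
  note char_mult = char_mult[OF k ch] and norm_le = norm_char_le_1[OF k ch] and char_1 = char_1[OF k ch]
  obtain L where L: "\<And>N. norm ((\<Sum>n=1..N. \<psi> n / of_nat n) - L) \<le> 2 * real k / real (Suc N)"
    using char_L1[OF k ch np] by blast
  let ?s = "\<lambda>N. \<Sum>n=1..N. \<psi> n / of_nat n"
  \<comment> \<open>The weight ln n / n decreases only from n = 3 on; n = 1 and n = 2 contribute at
    most 1 each.\<close>
  have ln_sum: "norm (\<Sum>n=1..N. \<psi> n * of_real (ln (real n)) / of_nat n) \<le> 2 + 2 * real k" for N
  proof -
    let ?f = "\<lambda>n. (ln (real n) / real n) *\<^sub>R \<psi> n"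
    have "(\<Sum>n=1..N. \<psi> n * of_real (ln (real n)) / of_nat n) = (\<Sum>n=1..N. ?f n)"
      by (intro sum.cong) (auto simp: scaleR_conv_of_real)
    also have "\<dots> = (\<Sum>n\<in>{1..N} \<inter> {1,2}. ?f n) + (\<Sum>n=3..N. ?f n)"
      by (subst sum.union_disjoint[symmetric]) (auto intro!: sum.cong)
    also have "norm \<dots> \<le> norm (\<Sum>n\<in>{1..N} \<inter> {1,2}. ?f n) + norm (\<Sum>n=3..N. ?f n)" by (rule norm_triangle_ineq)
    also have "norm (\<Sum>n\<in>{1..N} \<inter> {1,2}. ?f n) \<le> (\<Sum>n\<in>{1..N} \<inter> {1,2}. 1)"
    proof (rule sum_norm_le)
      fix n
      have "norm (?f n) = ln (real n) / real n * norm (\<psi> n)"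
        by (simp only: norm_scaleR abs_of_nonneg[OF ln_div_nat_nonneg])
      also have "\<dots> \<le> 1 * 1" using ln_div_nat_nonneg[of n] ln_div_le_1[of n] norm_le[of n] by (intro mult_mono) auto
      finally show "norm (?f n) \<le> 1" by simp
    qed
    also have "\<dots> \<le> real (card {1, 2 :: nat})" using card_mono[of "{1, 2 :: nat}" "{1..N} \<inter> {1,2}"] by simp
    also have "norm (\<Sum>n=3..N. ?f n) \<le> 2 * real k"
    proof (cases "3 \<le> N")
      case True
      have "norm (\<Sum>n=3..N. ?f n) \<le> ln (real 3) / real 3 * (2 * real k)"
        using True sum_char_interval_bounded[OF k ch np]
        by (intro abel_inequality ln_div_decreasing ln_div_nat_nonneg) auto
      also have "\<dots> \<le> 1 * (2 * real k)" using ln_div_le_1[of 3] by (intro mult_right_mono) auto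
      finally show ?thesis by simp
    qed simp
    finally show ?thesis by simp
  qed
  have conv: "(\<Sum>n=1..N. \<psi> n * of_real (ln (real n)) / of_nat n) = (\<Sum>d=1..N. \<psi> d * mangoldt d / of_nat d * ?s (N div d))" for N
  proof -
    have "(\<Sum>n=1..N. \<psi> n * of_real (ln (real n)) / of_nat n) =
        (\<Sum>n=1..N. \<Sum>d | d dvd n. \<psi> d * mangoldt d / of_nat d * (\<psi> (n div d) / of_nat (n div d)))"
    proof (rule sum.cong)
      fix n assume n: "n \<in> {1..N}"
      have "\<psi> n * of_real (ln (real n)) / of_nat n = (\<Sum>d | d dvd n. \<psi> n * mangoldt d / of_nat n)"
        using n mangoldt_sum[of n, where ?'a = complex] by (simp flip: sum_distrib_left sum_divide_distrib)
      also have "\<dots> = (\<Sum>d | d dvd n. \<psi> d * mangoldt d / of_nat d * (\<psi> (n div d) / of_nat (n div d)))"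
      proof (rule sum.cong)
        fix d assume "d \<in> {d. d dvd n}"
        then obtain m where m: "n = d * m" by auto
        then show "\<psi> n * mangoldt d / of_nat n = \<psi> d * mangoldt d / of_nat d * (\<psi> (n div d) / of_nat (n div d))"
          using n by (auto simp: char_mult)
      qed auto
      finally show "\<psi> n * of_real (ln (real n)) / of_nat n = (\<Sum>d | d dvd n. \<psi> d * mangoldt d / of_nat d * (\<psi> (n div d) / of_nat (n div d)))" .
    qed auto
    also have "\<dots> = (\<Sum>d=1..N. \<Sum>t=1..N div d. \<psi> d * mangoldt d / of_nat d * (\<psi> t / of_nat t))"
      by (rule sum_divisors_swap)
    finally show ?thesis by (simp only: sum_distrib_left)
  qed
  have case1: "\<exists>B. \<forall>N\<ge>1. norm (G N) \<le> B" if "L \<noteq> 0"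
  proof (intro exI allI impI)
    fix N :: nat assume N: "N \<ge> 1"
    have "L * G N = (\<Sum>d=1..N. \<psi> d * mangoldt d / of_nat d * ?s (N div d)) - (\<Sum>d=1..N. \<psi> d * mangoldt d / of_nat d * (?s (N div d) - L))"
    proof -
      have "L * G N = (\<Sum>d=1..N. L * (\<psi> d * mangoldt d / of_nat d))" by (simp only: G_def sum_distrib_left)
      also have "\<dots> = (\<Sum>d=1..N. \<psi> d * mangoldt d / of_nat d * ?s (N div d) - \<psi> d * mangoldt d / of_nat d * (?s (N div d) - L))"
      proof (rule sum.cong)
        fix d
        have "L * a = a * s - a * (s - L)" for a s :: complex by (simp add: algebra_simps)
        then show "L * (\<psi> d * mangoldt d / of_nat d) = \<psi> d * mangoldt d / of_nat d * ?s (N div d) - \<psi> d * mangoldt d / of_nat d * (?s (N div d) - L)" .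
      qed auto
      finally show ?thesis by (simp only: sum_subtractf)
    qed
    also have "norm \<dots> \<le> (2 + 2 * real k) + (\<Sum>d=1..N. 2 * real k / real N * mangoldt d)"
    proof (rule order_trans[OF norm_triangle_ineq4 add_mono])
      show "norm (\<Sum>d=1..N. \<psi> d * mangoldt d / of_nat d * ?s (N div d)) \<le> 2 + 2 * real k"
        using ln_sum[of N] unfolding conv .
      show "norm (\<Sum>d=1..N. \<psi> d * mangoldt d / of_nat d * (?s (N div d) - L)) \<le> (\<Sum>d=1..N. 2 * real k / real N * mangoldt d)"
      proof (rule sum_norm_le)
        fix d assume d: "d \<in> {1..N}"
        have "norm (\<psi> d * mangoldt d / of_nat d * (?s (N div d) - L)) = norm (\<psi> d) * (mangoldt d / real d) * norm (?s (N div d) - L)"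
          by (simp add: norm_mult norm_divide)
        also have "\<dots> \<le> 1 * (mangoldt d / real d) * (2 * real k / real (Suc (N div d)))"
          using L[of "N div d"] norm_le[of d] mangoldt_nonneg[of d] by (intro mult_mono) auto
        also have "\<dots> = 2 * real k * mangoldt d * (1 / (real d * real (Suc (N div d))))" by simp
        also have "\<dots> \<le> 2 * real k * mangoldt d * (1 / real N)"
          using inverse_mult_Suc_div_le[OF N, of d] d mangoldt_nonneg[of d] by (intro mult_left_mono) auto
        finally show "norm (\<psi> d * mangoldt d / of_nat d * (?s (N div d) - L)) \<le> 2 * real k / real N * mangoldt d" by simp
      qed
    qed
    also have "(\<Sum>d=1..N. 2 * real k / real N * mangoldt d) = 2 * real k / real N * chebyshev_psi N"
      by (simp only: chebyshev_psi_def sum_distrib_left)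
    also have "\<dots> \<le> 2 * real k / real N * (4 * real N)" by (intro mult_left_mono chebyshev_psi_le) auto
    also have "\<dots> = 8 * real k" using N by simp
    finally have "norm L * norm (G N) \<le> 2 + 10 * real k" by (simp add: norm_mult)
    then show "norm (G N) \<le> (2 + 10 * real k) / norm L" using that by (simp add: field_simps)
  qed
  have case2: "\<forall>N\<ge>1. norm (G N + of_real (ln (real N))) \<le> 2 * real k" if L0: "L = 0"
  proof (intro allI impI)
    fix N :: nat assume N: "N \<ge> 1"
    have "G N + of_real (ln (real N)) = (\<Sum>n=1..N. \<Sum>d | d dvd n. \<psi> d * of_real (real_of_int (moebius d) * ln (real N / real d)) / of_nat d * (\<psi> (n div d) / of_nat (n div d)))"
    proof -
      have "(\<Sum>d | d dvd n. \<psi> d * of_real (real_of_int (moebius d) * ln (real N / real d)) / of_nat d * (\<psi> (n div d) / of_nat (n div d))) =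
          \<psi> n * mangoldt n / of_nat n + (if n = 1 then of_real (ln (real N)) else 0)" if n: "n \<in> {1..N}" for n
      proof -
        have "(\<Sum>d | d dvd n. \<psi> d * of_real (real_of_int (moebius d) * ln (real N / real d)) / of_nat d * (\<psi> (n div d) / of_nat (n div d))) =
            (\<Sum>d | d dvd n. \<psi> n / of_nat n * of_real (real_of_int (moebius d) * ln (real N) - real_of_int (moebius d) * ln (real d)))"
        proof (rule sum.cong)
          fix d assume "d \<in> {d. d dvd n}"
          then obtain m where m: "n = d * m" by auto
          then have d: "d > 0" "m > 0" using n by auto
          have r: "real_of_int (moebius d) * ln (real N / real d) = real_of_int (moebius d) * ln (real N) - real_of_int (moebius d) * ln (real d)"
            using N d by (simp add: ln_div right_diff_distrib)
          show "\<psi> d * of_real (real_of_int (moebius d) * ln (real N / real d)) / of_nat d * (\<psi> (n div d) / of_nat (n div d)) =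
              \<psi> n / of_nat n * of_real (real_of_int (moebius d) * ln (real N) - real_of_int (moebius d) * ln (real d))"
            unfolding r using m d by (simp add: char_mult del: of_real_diff)
        qed auto
        also have "\<dots> = \<psi> n / of_nat n * of_real (real_of_int (\<Sum>d | d dvd n. moebius d) * ln (real N) - (\<Sum>d | d dvd n. real_of_int (moebius d) * ln (real d)))"
          by (simp only: sum_distrib_left[symmetric] of_real_sum[symmetric] sum_subtractf sum_distrib_right[symmetric] of_int_sum[symmetric])
        also have "\<dots> = \<psi> n / of_nat n * of_real ((if n = 1 then ln (real N) else 0) + mangoldt n)"
          using n by (subst sum_moebius_ln_divisors, simp, subst sum_moebius_divisors) auto
        also have "\<dots> = \<psi> n * mangoldt n / of_nat n + (if n = 1 then of_real (ln (real N)) else 0)"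
          by (auto simp: char_1)
        finally show ?thesis .
      qed
      then have "(\<Sum>n=1..N. \<Sum>d | d dvd n. \<psi> d * of_real (real_of_int (moebius d) * ln (real N / real d)) / of_nat d * (\<psi> (n div d) / of_nat (n div d))) =
          (\<Sum>n=1..N. \<psi> n * mangoldt n / of_nat n + (if n = 1 then of_real (ln (real N)) else 0))"
        by (intro sum.cong) auto
      also have "\<dots> = G N + of_real (ln (real N))"
        unfolding sum.distrib G_def using N by (simp add: sum.delta)
      finally show ?thesis by simp
    qed
    also have "\<dots> = (\<Sum>d=1..N. \<Sum>t=1..N div d. \<psi> d * of_real (real_of_int (moebius d) * ln (real N / real d)) / of_nat d * (\<psi> t / of_nat t))"
      by (rule sum_divisors_swap)
    also have "\<dots> = (\<Sum>d=1..N. \<psi> d * of_real (real_of_int (moebius d) * ln (real N / real d)) / of_nat d * ?s (N div d))"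
      by (simp only: sum_distrib_left)
    also have "norm \<dots> \<le> (\<Sum>d=1..N. 2 * real k / real N * (ln (real N) - ln (real d)))"
    proof (rule sum_norm_le)
      fix d assume d: "d \<in> {1..N}"
      have ln0: "ln (real N / real d) = ln (real N) - ln (real d)" "ln (real N) - ln (real d) \<ge> 0" using d N by (auto simp: ln_div)
      have "norm (\<psi> d * of_real (real_of_int (moebius d) * ln (real N / real d)) / of_nat d * ?s (N div d)) =
          norm (\<psi> d) * (\<bar>real_of_int (moebius d)\<bar> * (ln (real N) - ln (real d)) / real d) * norm (?s (N div d))"
        using ln0 by (simp add: norm_mult norm_divide abs_mult del: of_real_diff)
      also have "\<dots> \<le> 1 * (1 * (ln (real N) - ln (real d)) / real d) * (2 * real k / real (Suc (N div d)))"
        using L[of "N div d"] L0 norm_le[of d] abs_real_moebius_le_1[of d] ln0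
        by (intro mult_mono divide_right_mono) auto
      also have "\<dots> = 2 * real k * (ln (real N) - ln (real d)) * (1 / (real d * real (Suc (N div d))))" by simp
      also have "\<dots> \<le> 2 * real k * (ln (real N) - ln (real d)) * (1 / real N)"
        using inverse_mult_Suc_div_le[OF N, of d] d ln0 by (intro mult_left_mono) auto
      finally show "norm (\<psi> d * of_real (real_of_int (moebius d) * ln (real N / real d)) / of_nat d * ?s (N div d)) \<le> 2 * real k / real N * (ln (real N) - ln (real d))"
        by simp
    qed
    also have "\<dots> = 2 * real k / real N * (real N * ln (real N) - (\<Sum>d=1..N. ln (real d)))"
      by (simp only: sum_distrib_left[symmetric] sum_subtractf) simp
    also have "\<dots> \<le> 2 * real k / real N * real N"
      using sum_ln_bounds(2)[OF N] by (intro mult_left_mono) auto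
    also have "\<dots> = 2 * real k" using N by simp
    finally show "norm (G N + of_real (ln (real N))) \<le> 2 * real k" .
  qed
  show ?thesis using that[of L] L case1 case2 by blast
qed

text \<open>The 3-4-1 inequality for the sums up to N: the three parts are at most 3 ln N + 12, 4 B
  - 4 ln N and a constant, so ln N would be bounded. The third part is bounded above whether or not
  L(1, \<psi>^2) vanishes, since vanishing only adds - ln N to it.\<close>

lemma char_L1_nonzero_of_square_nonprincipal:
  assumes k: "k > 0" and ch: "dirichlet_char k \<psi>" and np: "\<psi> \<noteq> principal_char k"
    and sq: "(\<lambda>n. \<psi> n ^ 2) \<noteq> principal_char k"
    and G: "\<forall>N\<ge>1. norm ((\<Sum>n=1..N. \<psi> n * mangoldt n / of_nat n) + of_real (ln (real N))) \<le> B"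
  shows False
proof -
  have ch2: "dirichlet_char k (\<lambda>n. \<psi> n ^ 2)"
    using ch by (auto simp: dirichlet_char_def power_mult_distrib)
  define G1 where "G1 N = (\<Sum>n=1..N. \<psi> n * mangoldt n / of_nat n)" for N
  define G2 where "G2 N = (\<Sum>n=1..N. \<psi> n ^ 2 * mangoldt n / of_nat n)" for N
  have "\<exists>B2. \<forall>N\<ge>1. Re (G2 N) \<le> B2"
  proof -
    obtain L where "\<forall>N. norm ((\<Sum>n=1..N. \<psi> n ^ 2 / of_nat n) - L) \<le> 2 * real k / real (Suc N)"
      and L: "L \<noteq> 0 \<longrightarrow> (\<exists>B. \<forall>N\<ge>1. norm (G2 N) \<le> B)"
      "L = 0 \<longrightarrow> (\<forall>N\<ge>1. norm (G2 N + of_real (ln (real N))) \<le> 2 * real k)"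
      unfolding G2_def by (rule char_mangoldt_sums[OF k ch2 sq])
    show ?thesis
    proof (cases "L = 0")
      case True
      have "Re (G2 N) \<le> 2 * real k" if N: "N \<ge> 1" for N
      proof -
        have "Re (G2 N + of_real (ln (real N))) \<le> 2 * real k"
          using L(2) True N complex_Re_le_cmod order_trans by blast
        moreover have "ln (real N) \<ge> 0" using N by simp
        ultimately show ?thesis by simp
      qed
      then show ?thesis by blast
    next
      case False
      then show ?thesis using L(1) complex_Re_le_cmod order_trans by meson
    qed
  qed
  then obtain B2 where B2: "\<And>N. N \<ge> 1 \<Longrightarrow> Re (G2 N) \<le> B2" by blast
  have pos: "0 \<le> 3 * (\<Sum>n=1..N. mangoldt n / real n) + 4 * Re (G1 N) + Re (G2 N)" for N
  proof -
    have "3 * (\<Sum>n=1..N. mangoldt n / real n) + 4 * Re (G1 N) + Re (G2 N) =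
      (\<Sum>n=1..N. mangoldt n / real n * (3 + 4 * Re (\<psi> n) + Re (\<psi> n ^ 2)))"
    proof -
      have Re: "Re (z * mangoldt n / of_nat n) = mangoldt n / real n * Re z" for z n
      proof -
        have "z * mangoldt n / of_nat n = of_real (mangoldt n / real n) * z" by simp
        then show ?thesis by (simp only: Re_complex_of_real_mult)
      qed
      show ?thesis
        unfolding G1_def G2_def Re_sum Re sum_distrib_left sum.distrib[symmetric]
        by (intro sum.cong) (auto simp: algebra_simps)
    qed
    also have "\<dots> \<ge> 0"
    proof (intro sum_nonneg mult_nonneg_nonneg)
      fix n
      show "0 \<le> mangoldt n / real n" using mangoldt_nonneg[of n] by simp
      \<comment> \<open>An inequality in place of \<psi>(n) = exp(i \<theta>), so that the n with
        \<psi>(n) = 0 are covered too.\<close>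
      have "(Re (\<psi> n))\<^sup>2 + (Im (\<psi> n))\<^sup>2 \<le> 1"
        using norm_char_le_1[OF k ch, of n] by (simp add: cmod_def)
      then have "Re (\<psi> n ^ 2) \<ge> 2 * (Re (\<psi> n))\<^sup>2 - 1"
        by (simp add: Re_power2)
      moreover have "3 + 4 * Re (\<psi> n) + (2 * (Re (\<psi> n))\<^sup>2 - 1) = 2 * (1 + Re (\<psi> n))\<^sup>2"
        by (simp add: power2_eq_square algebra_simps)
      moreover have "0 \<le> 2 * (1 + Re (\<psi> n))\<^sup>2" by simp
      ultimately show "0 \<le> 3 + 4 * Re (\<psi> n) + Re (\<psi> n ^ 2)" by linarith
    qed
    finally show ?thesis .
  qed
  have "ln (real N) \<le> 12 + 4 * B + B2" if N: "N \<ge> 1" for N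
  proof -
    have "Re (G1 N + of_real (ln (real N))) \<le> B"
      using G N complex_Re_le_cmod order_trans unfolding G1_def by blast
    then have "Re (G1 N) \<le> B - ln (real N)" by simp
    moreover have "(\<Sum>n=1..N. mangoldt n / real n) \<le> ln (real N) + 4" using mertens_mangoldt[OF N] by linarith
    ultimately show ?thesis using pos[of N] B2[OF N] by linarith
  qed
  moreover have "filterlim (\<lambda>N. ln (real N)) at_top sequentially" by real_asymp
  then have "\<forall>\<^sub>F N in sequentially. ln (real N) > 12 + 4 * B + B2" unfolding filterlim_at_top_dense by (rule spec)
  then obtain N where "N \<ge> 1" "ln (real N) > 12 + 4 * B + B2"
    by (metis eventually_sequentially linear)
  ultimately show False by fastforce
qed

section \<open>Weights of a Lambert series\<close>

lemma sum_power_ge: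
  fixes y :: real
  assumes "y \<ge> 0"
  shows "(\<Sum>i<Suc d. y ^ (2 * i)) \<ge> real (Suc d) * y ^ d"
proof -
  have "(\<Sum>i<Suc d. y ^ (2 * i)) = (\<Sum>i<Suc d. y ^ (2 * (d - i)))"
    using sum.nat_diff_reindex[of "\<lambda>i. y ^ (2 * i)" "Suc d"] by simp
  then have "2 * (\<Sum>i<Suc d. y ^ (2 * i)) = (\<Sum>i<Suc d. y ^ (2 * i) + y ^ (2 * (d - i)))"
    by (simp only: sum.distrib)
  \<comment> \<open>The terms i and d - i are paired by the inequality of arithmetic and geometric
    means.\<close>
  also have "\<dots> \<ge> (\<Sum>i<Suc d. 2 * y ^ d)"
  proof (rule sum_mono)
    fix i assume "i \<in> {..<Suc d}"
    then have "y ^ d = y ^ i * y ^ (d - i)" by (simp add: power_add[symmetric])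
    moreover have "0 \<le> (y ^ i - y ^ (d - i))\<^sup>2" by simp
    ultimately show "2 * y ^ d \<le> y ^ (2 * i) + y ^ (2 * (d - i))"
      unfolding power_even_eq by (simp add: power2_diff)
  qed
  finally show ?thesis by simp
qed

text \<open>As x tends to 1, x^d / (1 - x^d) behaves like 1 / (d (1 - x)); the weight is the error
  of this approximation. Its monotonicity in d allows summation by parts against bounded character
  sums.\<close>

definition lambert_weight :: "real \<Rightarrow> nat \<Rightarrow> real" where
  "lambert_weight x d = 1 / (real d * (1 - x)) - x ^ d / (1 - x ^ d)"

lemma geom_sum_nat: "(1 - x :: real) * (\<Sum>i<d. x ^ i) = 1 - x ^ d"
  by (simp add: one_diff_power_eq)

text \<open>Put S d = 1 + ... + x^(d-1). Since S (d + 1) = 1 + x S d, the fractions x^d / S d differ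
  by x^d / (S d S (d + 1)) from one d to the next, and this has to be at most 1 / (d (d + 1)). By
  \<open>sum_power_ge\<close> with y the square root of x, S d \<ge> d y^(d-1) and S (d + 1) \<ge>
  (d + 1) y^d, while y^(2d-1) \<ge> x^d.\<close>

lemma lambert_weight_decreasing:
  assumes x: "0 < x" "x < 1" and d: "d \<ge> 1"
  shows "lambert_weight x (Suc d) \<le> lambert_weight x d"
proof -
  define S where "S d = (\<Sum>i<d. x ^ i)" for d
  have Spos: "S n > 0" if "n \<ge> 1" for n
    unfolding S_def using x that by (intro sum_pos) (auto simp: lessThan_empty_iff)
  define y where "y = sqrt x"
  have y: "y \<ge> 0" "y \<le> 1" "y ^ 2 = x" using x by (auto simp: y_def)
  have Sy: "S n = (\<Sum>i<n. y ^ (2 * i))" for n unfolding S_def power_mult y(3) ..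
  obtain e where e: "d = Suc e" using d by (cases d) auto
  have "real d * real (Suc d) * x ^ d \<le> S d * S (Suc d)"
  proof -
    have "real d * real (Suc d) * x ^ d = real d * real (Suc d) * (y ^ d * y ^ d)"
      using y(3) by (simp add: power_mult_distrib[symmetric] power2_eq_square)
    also have "\<dots> \<le> real d * real (Suc d) * (y ^ e * y ^ d)"
      using y by (intro mult_left_mono mult_right_mono power_decreasing) (auto simp: e)
    also have "\<dots> = (real (Suc e) * y ^ e) * (real (Suc d) * y ^ d)" by (simp add: e mult_ac)
    also have "\<dots> \<le> S d * S (Suc d)"
      unfolding Sy using y sum_power_ge[OF y(1), of e] sum_power_ge[OF y(1), of d]
      by (intro mult_mono) (auto simp: e intro!: sum_nonneg mult_nonneg_nonneg simp del: sum.lessThan_Suc of_nat_Suc)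
    finally show ?thesis .
  qed
  moreover have "S (Suc d) = 1 + x * S d"
    unfolding S_def by (simp add: sum.lessThan_Suc_shift sum_distrib_left del: sum.lessThan_Suc)
  then have "x ^ d / S d - x ^ Suc d / S (Suc d) = x ^ d / (S d * S (Suc d))"
    using Spos[of d] Spos[of "Suc d"] d by (simp add: field_simps)
  moreover have "X / P \<le> 1 / q" if "q * X \<le> P" "q > 0" "P > 0" for q P X :: real
    using that by (simp add: field_simps)
  ultimately have "x ^ d / S d - x ^ Suc d / S (Suc d) \<le> 1 / (real d * real (Suc d))"
    using Spos[of d] Spos[of "Suc d"] d by simp
  also have "\<dots> = 1 / real d - 1 / real (Suc d)" using d by (simp add: field_simps)
  finally have main: "1 / real (Suc d) - x ^ Suc d / S (Suc d) \<le> 1 / real d - x ^ d / S d" by linarith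
  have w: "lambert_weight x n = (1 / real n - x ^ n / S n) / (1 - x)" if "n \<ge> 1" for n
  proof -
    have e: "1 - x ^ n = (1 - x) * S n" by (simp only: S_def geom_sum_nat)
    show ?thesis unfolding lambert_weight_def e diff_divide_distrib by (simp add: mult.commute)
  qed
  show ?thesis unfolding w[OF d] using w[of "Suc d"] main x by (simp add: divide_right_mono)
qed

lemma lambert_weight_nonneg:
  assumes x: "0 < x" "x < 1" and d: "d \<ge> 1"
  shows "0 \<le> lambert_weight x d"
proof -
  define S where "S = (\<Sum>i<d. x ^ i)"
  have "(\<Sum>i<d. x ^ d) \<le> S" unfolding S_def using x by (intro sum_mono power_decreasing) auto
  then have S: "real d * x ^ d \<le> S" by simp
  have Spos: "S > 0" unfolding S_def using x d by (intro sum_pos) (auto simp: lessThan_empty_iff)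
  have "x ^ d / (1 - x ^ d) = x ^ d / ((1 - x) * S)" by (simp only: S_def geom_sum_nat)
  also have "\<dots> = x ^ d / S / (1 - x)" by (simp add: mult.commute)
  also have "\<dots> \<le> 1 / real d / (1 - x)"
  proof (rule divide_right_mono)
    have "X / S \<le> 1 / q" if "q * X \<le> S" "q > 0" for q X :: real
      using that Spos by (simp add: field_simps)
    then show "x ^ d / S \<le> 1 / real d" using S d by simp
  qed (use x in auto)
  also have "\<dots> = 1 / (real d * (1 - x))" by simp
  finally show ?thesis by (simp add: lambert_weight_def)
qed

lemma sum_divisors_prime_power_mult:
  fixes c :: "nat \<Rightarrow> real"
  assumes mult: "\<And>m n. c (m * n) = c m * c n" and c1: "c 1 = 1"
    and p: "prime p" "\<not> p dvd y" and y: "y > 0"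
  shows "(\<Sum>d | d dvd p ^ a * y. c d) = (\<Sum>i\<le>a. c p ^ i) * (\<Sum>d | d dvd y. c d)"
proof -
  have cpow: "c (n ^ i) = c n ^ i" for n i by (induction i) (use mult c1 in auto)
  have p0: "p > 0" using p prime_gt_0_nat by auto
  have "(\<Sum>i\<le>a. c p ^ i) * (\<Sum>d | d dvd y. c d) = (\<Sum>(i, d)\<in>{..a} \<times> {d. d dvd y}. c (p ^ i * d))"
    by (simp add: sum_product sum.cartesian_product mult cpow)
  also have "\<dots> = (\<Sum>d | d dvd p ^ a * y. c d)"
  proof (rule sum.reindex_bij_betw[where h = "\<lambda>(i, d). p ^ i * d" and g = c, THEN trans[rotated]])
    show "(\<Sum>(i, d)\<in>{..a} \<times> {d. d dvd y}. c (p ^ i * d)) = (\<Sum>x\<in>{..a} \<times> {d. d dvd y}. c (case x of (i, d) \<Rightarrow> p ^ i * d))"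
      by (intro sum.cong) auto
    show "bij_betw (\<lambda>(i, d). p ^ i * d) ({..a} \<times> {d. d dvd y}) {d. d dvd p ^ a * y}"
      unfolding bij_betw_def
    proof
      show "inj_on (\<lambda>(i, d). p ^ i * d) ({..a} \<times> {d. d dvd y})"
      proof (rule inj_onI, clarify)
        fix i d i' d' assume d: "d dvd y" "d' dvd y" and eq: "p ^ i * d = p ^ i' * d'"
        have nd: "\<not> p dvd d" "\<not> p dvd d'" using d p dvd_trans by blast+
        have "multiplicity p (p ^ i * d) = i" "multiplicity p (p ^ i' * d') = i'"
          using nd p0 by (auto intro!: multiplicity_decomposeI[OF refl])
        then have "i = i'" using eq by simp
        then show "i = i' \<and> d = d'" using eq p0 by simp
      qed
      show "(\<lambda>(i, d). p ^ i * d) ` ({..a} \<times> {d. d dvd y}) = {d. d dvd p ^ a * y}"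
      proof (intro equalityI subsetI)
        fix e assume "e \<in> {d. d dvd p ^ a * y}"
        then obtain b d where "e = b * d" "b dvd p ^ a" "d dvd y" using division_decomp[of e "p ^ a" y] by auto
        moreover from this obtain i where "i \<le> a" "b = p ^ i" using divides_primepow_nat[OF p(1)] by auto
        ultimately show "e \<in> (\<lambda>(i, d). p ^ i * d) ` ({..a} \<times> {d. d dvd y})" by auto
      qed (auto intro!: mult_dvd_mono le_imp_power_dvd)
    qed
  qed
  finally show ?thesis ..
qed

section \<open>Divisor sums of completely multiplicative functions with values -1, 0, 1\<close>

context
  fixes c :: "nat \<Rightarrow> real"
  assumes mult: "\<And>m n. c (m * n) = c m * c n" and c1: "c 1 = 1" and vals: "\<And>n. c n \<in> {-1, 0, 1}"
begin

text \<open>For the values 0 and 1 the sum is at least 1; for -1 it alternates between 1 and 0 and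
  equals 1 at an even upper limit, which is the case of squares.\<close>

lemma sum_powers_nonneg: "0 \<le> (\<Sum>i\<le>a. c p ^ i)" and sum_powers_even: "1 \<le> (\<Sum>i\<le>2 * a. c p ^ i)"
proof -
  have alt: "(\<Sum>i\<le>b. (-1) ^ i) = (if even b then 1 else 0 :: real)" for b :: nat by (induction b) auto
  have zero: "(\<Sum>i\<le>b. 0 ^ i) = (1 :: real)" for b :: nat by (induction b) auto
  show "0 \<le> (\<Sum>i\<le>a. c p ^ i)" "1 \<le> (\<Sum>i\<le>2 * a. c p ^ i)"
    using vals[of p] by (auto simp: alt zero)
qed

lemma prime_power_split:
  assumes "n > (1::nat)"
  obtains p a y where "prime p" "n = p ^ a * y" "\<not> p dvd y" "y > 0" "y < n"
proof -
  obtain p where p: "prime p" "p dvd n" using prime_factor_nat[of n] assms by auto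
  have "n \<noteq> 0" "\<not> is_unit p" using assms p(1) not_prime_unit by auto
  then obtain y where y': "n = p ^ multiplicity p n * y" "\<not> p dvd y"
    by (rule multiplicity_decompose')
  define a where "a = multiplicity p n"
  note y = y'[folded a_def]
  have y0: "y > 0" using y(1) assms by (cases "y = 0") auto
  have "p ^ a \<noteq> 1"
  proof
    assume "p ^ a = 1"
    with y(1) have "n = y" by simp
    then show False using y(2) p(2) by simp
  qed
  moreover have "p ^ a > 0" using p(1) prime_gt_0_nat by simp
  ultimately have "p ^ a \<ge> 2" by linarith
  then have "2 * y \<le> p ^ a * y" by (rule mult_le_mono1)
  then have "2 * y \<le> n" by (simp only: y(1)[symmetric])
  then have yn: "y < n" using y0 by linarith
  show ?thesis by (rule that[OF p(1) y(1) y(2) y0 yn])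
qed

lemma divisor_sum_nonneg: "n > 0 \<Longrightarrow> 0 \<le> (\<Sum>d | d dvd n. c d)"
proof (induction n rule: less_induct)
  case (less n)
  show ?case
  proof (cases "n = 1")
    case True
    then show ?thesis using c1 by simp
  next
    case False
    then obtain p a y where "prime p" "n = p ^ a * y" "\<not> p dvd y" "y > 0" "y < n"
      using less.prems prime_power_split[of n] by auto
    then show ?thesis
      using less.IH[of y] sum_powers_nonneg[where p = p] sum_divisors_prime_power_mult[OF mult c1, of p y a] by simp
  qed
qed

lemma divisor_sum_square: "m > 0 \<Longrightarrow> 1 \<le> (\<Sum>d | d dvd m ^ 2. c d)"
proof (induction m rule: less_induct)
  case (less m)
  show ?case
  proof (cases "m = 1")
    case True
    then show ?thesis using c1 by simp
  next
    case False
    then obtain p a y where *: "prime p" "m = p ^ a * y" "\<not> p dvd y" "y > 0" "y < m"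
      using less.prems prime_power_split[of m] by auto
    have "m ^ 2 = p ^ (2 * a) * y ^ 2" using *(2) by (simp add: power_mult_distrib power_mult[symmetric] mult.commute)
    moreover have "\<not> p dvd y ^ 2" using * by (simp add: prime_dvd_power_iff)
    ultimately have "(\<Sum>d | d dvd m ^ 2. c d) = (\<Sum>i\<le>2 * a. c p ^ i) * (\<Sum>d | d dvd y ^ 2. c d)"
      using sum_divisors_prime_power_mult[OF mult c1, of p "y ^ 2" "2 * a"] * by simp
    also have "\<dots> \<ge> 1 * 1"
      using less.IH[of y] sum_powers_even[where p = p and a = a] * by (intro mult_mono) auto
    finally show ?thesis by simp
  qed
qed

text \<open>Comparing \<open>\<Sum>c(d) x^d / (1 - x^d)\<close> with \<open>\<Sum>c(d) / (d (1 - x))\<close>: their difference has monotone weights,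
  so it stays bounded as \<open>x \<rightarrow> 1\<close>, whereas the squares force the first sum to be unbounded.\<close>

lemma real_char_sum_not_null:
  assumes B: "\<And>N. \<bar>\<Sum>n=1..N. c n\<bar> \<le> B" and lim: "(\<lambda>N. \<Sum>n=1..N. c n / real n) \<longlonglongrightarrow> 0"
  shows False
proof -
  have B0: "B \<ge> 1" using B[of 1] c1 by simp
  have abs_c: "\<bar>c n\<bar> \<le> 1" for n using vals[of n] by auto
  define M where "M = nat \<lceil>B\<rceil> + 2"
  have M: "real M > B + 1" "M \<ge> 2" by (auto simp: M_def) linarith
  \<comment> \<open>The squares up to M^2 against 1 - x = M^(-3): Bernoulli's inequality gives
    x^(M^2) \<ge> 1 - 1 / M, so the M squares contribute at least M - 1 > B.\<close>
  define x where "x = 1 - 1 / real M ^ 3"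
  have M3: "real M ^ 3 > 1" using M(2) by (intro one_less_power) auto
  have x: "0 < x" "x < 1" using M3 M(2) by (auto simp: x_def field_simps)
  define A where "A N = (\<Sum>n=1..N. (\<Sum>d | d dvd n. c d) * x ^ n)" for N
  let ?s = "\<lambda>N. \<Sum>n=1..N. c n / real n"
  \<comment> \<open>N is finite throughout: each geometric series is cut at N div d, and the parts
    cut off add up to at most N x^N / (1 - x), which vanishes as N grows with x fixed.\<close>
  have upper: "A N \<le> B + \<bar>?s N\<bar> / (1 - x) + real N * x ^ N / (1 - x)" if N: "N \<ge> 1" for N
  proof -
    have "A N = (\<Sum>n=1..N. \<Sum>d | d dvd n. c d * x ^ (d * (n div d)))"
      unfolding A_def sum_distrib_right by (intro sum.cong) auto
    also have "\<dots> = (\<Sum>d=1..N. \<Sum>t=1..N div d. c d * x ^ (d * t))" by (rule sum_divisors_swap)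
    also have "\<dots> = (\<Sum>d=1..N. c d * (x ^ d / (1 - x ^ d)) - c d * (x ^ (d * Suc (N div d)) / (1 - x ^ d)))"
    proof (rule sum.cong)
      fix d assume d: "d \<in> {1..N}"
      have xd: "x ^ d < 1" using x d by (simp add: power_less_one_iff)
      have "(1 - x ^ d) * (\<Sum>t=1..N div d. (x ^ d) ^ t) = x ^ d - (x ^ d) ^ Suc (N div d)"
        using d by (subst sum_gp_multiplied) (auto simp: Suc_le_eq div_greater_zero_iff)
      then have "(\<Sum>t=1..N div d. x ^ (d * t)) = (x ^ d - x ^ (d * Suc (N div d))) / (1 - x ^ d)"
        using xd by (simp add: power_mult[symmetric] field_simps del: power_Suc)
      then show "(\<Sum>t=1..N div d. c d * x ^ (d * t)) = c d * (x ^ d / (1 - x ^ d)) - c d * (x ^ (d * Suc (N div d)) / (1 - x ^ d))"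
        by (simp only: sum_distrib_left[symmetric] diff_divide_distrib right_diff_distrib)
    qed auto
    also have "\<dots> = (\<Sum>d=1..N. c d * (x ^ d / (1 - x ^ d))) - (\<Sum>d=1..N. c d * (x ^ (d * Suc (N div d)) / (1 - x ^ d)))"
      by (rule sum_subtractf)
    also have "(\<Sum>d=1..N. c d * (x ^ d / (1 - x ^ d))) = ?s N / (1 - x) - (\<Sum>d=1..N. lambert_weight x d *\<^sub>R c d)"
      unfolding sum_divide_distrib sum_subtractf[symmetric]
      by (intro sum.cong) (auto simp: lambert_weight_def algebra_simps)
    finally have eq: "A N = ?s N / (1 - x) - (\<Sum>d=1..N. lambert_weight x d *\<^sub>R c d) - (\<Sum>d=1..N. c d * (x ^ (d * Suc (N div d)) / (1 - x ^ d)))" .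
    have "norm (\<Sum>d=1..N. lambert_weight x d *\<^sub>R c d) \<le> lambert_weight x 1 * B"
      using N B lambert_weight_nonneg[OF x] lambert_weight_decreasing[OF x] by (intro abel_inequality) auto
    also have "lambert_weight x 1 = 1" using x by (simp add: lambert_weight_def diff_divide_distrib[symmetric])
    finally have 1: "\<bar>\<Sum>d=1..N. lambert_weight x d *\<^sub>R c d\<bar> \<le> B" by simp
    have "\<bar>\<Sum>d=1..N. c d * (x ^ (d * Suc (N div d)) / (1 - x ^ d))\<bar> \<le> (\<Sum>d=1..N. x ^ N / (1 - x))"
    proof (rule order_trans[OF sum_abs sum_mono])
      fix d assume d: "d \<in> {1..N}"
      have "N < d * Suc (N div d)" using d dividend_less_times_div[of d N] by (simp add: algebra_simps)
      then have "x ^ (d * Suc (N div d)) \<le> x ^ N" using x by (intro power_decreasing) auto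
      moreover have "x ^ d \<le> x ^ 1" using x d by (intro power_decreasing) auto
      then have "1 - x \<le> 1 - x ^ d" by simp
      ultimately have *: "x ^ (d * Suc (N div d)) / (1 - x ^ d) \<le> x ^ N / (1 - x)" "0 \<le> x ^ (d * Suc (N div d)) / (1 - x ^ d)"
        using x by (auto intro!: frac_le divide_nonneg_nonneg)
      then have "\<bar>c d\<bar> * (x ^ (d * Suc (N div d)) / (1 - x ^ d)) \<le> 1 * (x ^ N / (1 - x))"
        using abs_c[of d] by (intro mult_mono) auto
      then show "\<bar>c d * (x ^ (d * Suc (N div d)) / (1 - x ^ d))\<bar> \<le> x ^ N / (1 - x)"
        using *(2) by (simp only: abs_mult abs_of_nonneg mult_1)
    qed
    also have "\<dots> = real N * x ^ N / (1 - x)" by simp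
    finally have 2: "\<bar>\<Sum>d=1..N. c d * (x ^ (d * Suc (N div d)) / (1 - x ^ d))\<bar> \<le> real N * x ^ N / (1 - x)" .
    have "?s N / (1 - x) \<le> \<bar>?s N\<bar> / (1 - x)" using x by (intro divide_right_mono) auto
    then show ?thesis using eq 1 2 by linarith
  qed
  have lower: "real M * x ^ (M ^ 2) \<le> A N" if N: "N \<ge> M ^ 2" for N
  proof -
    have "real M * x ^ (M ^ 2) = (\<Sum>m=1..M. x ^ (M ^ 2))" by simp
    also have "\<dots> \<le> (\<Sum>m=1..M. (\<Sum>d | d dvd m ^ 2. c d) * x ^ (m ^ 2))"
    proof (rule sum_mono)
      fix m assume m: "m \<in> {1..M}"
      have "1 * x ^ (M ^ 2) \<le> (\<Sum>d | d dvd m ^ 2. c d) * x ^ (m ^ 2)"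
        using divisor_sum_square[of m] m x by (intro mult_mono power_decreasing) auto
      then show "x ^ (M ^ 2) \<le> (\<Sum>d | d dvd m ^ 2. c d) * x ^ (m ^ 2)" by simp
    qed
    also have "\<dots> = (\<Sum>n\<in>(\<lambda>m. m ^ 2) ` {1..M}. (\<Sum>d | d dvd n. c d) * x ^ n)"
      by (subst sum.reindex) (auto simp: inj_on_def)
    also have "\<dots> \<le> A N" unfolding A_def
    proof (rule sum_mono2)
      have "m ^ 2 \<le> N" if "m \<le> M" for m by (rule order_trans[OF power_mono[OF that] N]) simp
      then show "(\<lambda>m. m ^ 2) ` {1..M} \<subseteq> {1..N}" by auto
    qed (use divisor_sum_nonneg x in auto)
    finally show ?thesis .
  qed
  have "(\<lambda>N. B + \<bar>?s N\<bar> / (1 - x) + real N * x ^ N / (1 - x)) \<longlonglongrightarrow> B + \<bar>0\<bar> / (1 - x) + 0 / (1 - x)"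
  proof (intro tendsto_intros lim)
    show "(\<lambda>N. real N * x ^ N) \<longlonglongrightarrow> 0" using x by (intro powser_times_n_limit_0) auto
  qed (use x in auto)
  then have "real M * x ^ (M ^ 2) \<le> B + \<bar>0\<bar> / (1 - x) + 0 / (1 - x)"
  proof (rule tendsto_lowerbound)
    show "\<forall>\<^sub>F N in sequentially. real M * x ^ (M ^ 2) \<le> B + \<bar>?s N\<bar> / (1 - x) + real N * x ^ N / (1 - x)"
      using eventually_ge_at_top[of "M ^ 2"] eventually_ge_at_top[of 1]
      by eventually_elim (rule order_trans[OF lower upper])
  qed auto
  moreover have "1 - 1 / real M \<le> x ^ (M ^ 2)"
  proof -
    have "1 + real (M ^ 2) * (- (1 / real M ^ 3)) \<le> (1 + (- (1 / real M ^ 3))) ^ (M ^ 2)"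
      using x by (intro Bernoulli_inequality) (simp add: x_def)
    moreover have "real (M ^ 2) * (- (1 / real M ^ 3)) = - (1 / real M)"
      using M(2) by (simp add: power2_eq_square power3_eq_cube field_simps)
    ultimately show ?thesis by (simp add: x_def)
  qed
  then have "real M * (1 - 1 / real M) \<le> real M * x ^ (M ^ 2)" by (intro mult_left_mono) auto
  then have "real M - 1 \<le> real M * x ^ (M ^ 2)" using M(2) by (simp add: right_diff_distrib)
  ultimately show False using M(1) by simp
qed

end

section \<open>Primes in residue classes\<close>

text \<open>It remains to exclude L = 0 in the dichotomy: by the 3-4-1 inequality if \<psi>^2 is not
  principal, and otherwise, as \<psi> then takes only the values -1, 0, 1, by the Lambert
  series.\<close>

theorem char_prime_sum_bounded:
  assumes k: "k > 0" and ch: "dirichlet_char k \<psi>" and np: "\<psi> \<noteq> principal_char k"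
  obtains B where "\<And>N. N \<ge> 1 \<Longrightarrow> norm (\<Sum>n=1..N. \<psi> n * mangoldt n / of_nat n) \<le> B"
proof -
  let ?G = "\<lambda>N. \<Sum>n=1..N. \<psi> n * mangoldt n / of_nat n"
  obtain L where L: "\<forall>N. norm ((\<Sum>n=1..N. \<psi> n / of_nat n) - L) \<le> 2 * real k / real (Suc N)"
    and L1: "L \<noteq> 0 \<longrightarrow> (\<exists>B. \<forall>N\<ge>1. norm (?G N) \<le> B)"
    and L2: "L = 0 \<longrightarrow> (\<forall>N\<ge>1. norm (?G N + of_real (ln (real N))) \<le> 2 * real k)"
    by (rule char_mangoldt_sums[OF k ch np])
  have "L \<noteq> 0"
  proof
    assume L0: "L = 0"
    show False
    proof (cases "(\<lambda>n. \<psi> n ^ 2) = principal_char k")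
      case False
      show False
        by (rule char_L1_nonzero_of_square_nonprincipal[OF k ch np False]) (rule mp[OF L2 L0])
    next
      case True
      define c where "c n = Re (\<psi> n)" for n
      have vals: "\<psi> n \<in> {-1, 0, 1}" for n
      proof -
        have "\<psi> n ^ 2 = principal_char k n" using True by (rule fun_cong)
        then show ?thesis by (auto simp: principal_char_def power2_eq_1_iff split: if_splits)
      qed
      have c: "\<psi> n = of_real (c n)" for n using vals[of n] by (auto simp: c_def)
      have cvals: "c n \<in> {-1, 0, 1}" for n using vals[of n] by (auto simp: c_def)
      have mult: "c (m * n) = c m * c n" for m n
      proof -
        have "complex_of_real (c (m * n)) = of_real (c m * c n)"
          using char_mult[OF k ch, of m n] by (simp add: c)
        then show ?thesis by (simp only: of_real_eq_iff)
      qed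
      have c1: "c 1 = 1" using char_1(1)[OF k ch] by (simp add: c_def)
      have bounded: "\<bar>\<Sum>n=1..N. c n\<bar> \<le> real k" for N
      proof -
        have "(\<Sum>n=1..N. \<psi> n) = of_real (\<Sum>n=1..N. c n)" by (simp add: c)
        then show ?thesis using sum_char_bounded[OF k ch np, of N] by (simp only: norm_of_real)
      qed
      have "(\<lambda>N. \<Sum>n=1..N. c n / real n) \<longlonglongrightarrow> 0"
      proof (rule Lim_null_comparison)
        show "(\<lambda>N. 2 * real k / real (Suc N)) \<longlonglongrightarrow> 0" by real_asymp
        have "norm (\<Sum>n=1..N. c n / real n) \<le> 2 * real k / real (Suc N)" for N
        proof -
          have "(\<Sum>n=1..N. \<psi> n / of_nat n) = of_real (\<Sum>n=1..N. c n / real n)" by (simp add: c)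
          then show ?thesis using L[rule_format, of N] L0 by (simp only: norm_of_real diff_zero real_norm_def)
        qed
        then show "\<forall>\<^sub>F N in sequentially. norm (\<Sum>n=1..N. c n / real n) \<le> 2 * real k / real (Suc N)"
          by (intro always_eventually allI)
      qed
      then show False by (rule real_char_sum_not_null[OF mult c1 cvals bounded])
    qed
  qed
  then obtain B where "\<forall>N\<ge>1. norm (?G N) \<le> B" using L1 by blast
  then show ?thesis using that by blast
qed

definition char_prime_sum :: "(nat \<Rightarrow> complex) \<Rightarrow> nat \<Rightarrow> complex" where
  "char_prime_sum \<psi> N = (\<Sum>p | prime p \<and> p \<le> N. \<psi> p * of_real (ln (real p) / real p))"

text \<open>Passing from \<Lambda> to primes costs a bounded sum over higher prime powers. For the
  principal character the primes dividing k are at most k and cost a constant against Mertens'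
  theorem.\<close>

lemma char_prime_sum_asymp:
  assumes k: "k > 0" and ch: "dirichlet_char k \<psi>"
  shows "\<exists>B. \<forall>N\<ge>1. norm (char_prime_sum \<psi> N - (if \<psi> = principal_char k then of_real (ln (real N)) else 0)) \<le> B"
proof (cases "\<psi> = principal_char k")
  case False
  obtain B where B: "\<And>N. N \<ge> 1 \<Longrightarrow> norm (\<Sum>n=1..N. \<psi> n * mangoldt n / of_nat n) \<le> B"
    using char_prime_sum_bounded[OF k ch False] by blast
  obtain C where C: "C \<ge> 0" "\<And>N. (\<Sum>n | n \<in> {1..N} \<and> \<not> prime n. mangoldt n / real n) \<le> C"
    using mangoldt_prime_powers_bound by blast
  have "norm (char_prime_sum \<psi> N) \<le> B + C" if N: "N \<ge> 1" for N
  proof -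
    have "(\<Sum>n=1..N. \<psi> n * mangoldt n / of_nat n) = (\<Sum>n | n \<in> {1..N} \<and> prime n. \<psi> n * mangoldt n / of_nat n) +
        (\<Sum>n | n \<in> {1..N} \<and> \<not> prime n. \<psi> n * mangoldt n / of_nat n)"
      by (subst sum.union_disjoint[symmetric]) (auto intro!: sum.cong)
    also have "(\<Sum>n | n \<in> {1..N} \<and> prime n. \<psi> n * mangoldt n / of_nat n) = char_prime_sum \<psi> N"
      unfolding char_prime_sum_def by (rule sum.cong) (auto simp: Suc_le_eq prime_gt_0_nat)
    finally have "char_prime_sum \<psi> N = (\<Sum>n=1..N. \<psi> n * mangoldt n / of_nat n) - (\<Sum>n | n \<in> {1..N} \<and> \<not> prime n. \<psi> n * mangoldt n / of_nat n)"
      by simp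
    also have "norm \<dots> \<le> norm (\<Sum>n=1..N. \<psi> n * mangoldt n / of_nat n) + norm (\<Sum>n | n \<in> {1..N} \<and> \<not> prime n. \<psi> n * mangoldt n / of_nat n)"
      by (rule norm_triangle_ineq4)
    also have "norm (\<Sum>n | n \<in> {1..N} \<and> \<not> prime n. \<psi> n * mangoldt n / of_nat n) \<le> (\<Sum>n | n \<in> {1..N} \<and> \<not> prime n. mangoldt n / real n)"
    proof (rule sum_norm_le)
      fix n
      have "norm (\<psi> n) * (mangoldt n / real n) \<le> 1 * (mangoldt n / real n)"
        using norm_char_le_1[OF k ch] mangoldt_nonneg[of n] by (intro mult_right_mono) auto
      then show "norm (\<psi> n * mangoldt n / of_nat n) \<le> mangoldt n / real n"
        by (simp add: norm_mult norm_divide)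
    qed
    also have "\<dots> \<le> C" by (rule C)
    finally show ?thesis using B[OF N] by simp
  qed
  then show ?thesis using False by auto
next
  case True
  obtain C where C: "C \<ge> 0" "\<And>N. N \<ge> 1 \<Longrightarrow> \<bar>(\<Sum>p | prime p \<and> p \<le> N. ln (real p) / real p) - ln (real N)\<bar> \<le> C"
    using mertens_first by blast
  define D where "D = (\<Sum>p\<le>k. ln (real p) / real p)"
  have "norm (char_prime_sum \<psi> N - of_real (ln (real N))) \<le> C + D" if N: "N \<ge> 1" for N
  proof -
    have eq: "char_prime_sum \<psi> N = of_real (\<Sum>p | prime p \<and> p \<le> N \<and> coprime p k. ln (real p) / real p)"
      unfolding char_prime_sum_def of_real_sum True
      by (rule sum.mono_neutral_cong_right) (auto simp: principal_char_def)
    have "(\<Sum>p | prime p \<and> p \<le> N. ln (real p) / real p) = (\<Sum>p | prime p \<and> p \<le> N \<and> coprime p k. ln (real p) / real p) +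
        (\<Sum>p | prime p \<and> p \<le> N \<and> \<not> coprime p k. ln (real p) / real p)"
      by (subst sum.union_disjoint[symmetric]) (auto intro!: sum.cong)
    moreover have "(\<Sum>p | prime p \<and> p \<le> N \<and> \<not> coprime p k. ln (real p) / real p) \<le> D"
      unfolding D_def
    proof (rule sum_mono2)
      have "p \<le> k" if "prime p" "\<not> coprime p k" for p
        using that k prime_imp_coprime[of p k] by (auto intro: dvd_imp_le)
      then show "{p. prime p \<and> p \<le> N \<and> \<not> coprime p k} \<subseteq> {..k}" by auto
    qed (auto intro: ln_div_nat_nonneg)
    moreover have "0 \<le> (\<Sum>p | prime p \<and> p \<le> N \<and> \<not> coprime p k. ln (real p) / real p)"
      by (intro sum_nonneg ln_div_nat_nonneg)
    ultimately have "\<bar>(\<Sum>p | prime p \<and> p \<le> N \<and> coprime p k. ln (real p) / real p) - ln (real N)\<bar> \<le> C + D"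
      using C(2)[OF N] by linarith
    then show ?thesis unfolding eq by (simp only: of_real_diff[symmetric] norm_of_real)
  qed
  then show ?thesis using True by auto
qed

lemma sum_residue_class_period:
  fixes k l :: nat
  assumes k: "k > 0"
  shows "(\<Sum>n=1..k. if [n = l] (mod k) then 1 else 0) = (1 :: complex)"
proof -
  \<comment> \<open>The representative of l in {1..k}; residue 0 is represented by k.\<close>
  define r where "r = (if l mod k = 0 then k else l mod k)"
  have r: "r \<in> {1..k}" using k mod_less_divisor[OF k, of l] by (auto simp: r_def)
  have iff: "[n = l] (mod k) \<longleftrightarrow> n = r" if n: "n \<in> {1..k}" for n
  proof (cases "n = k")
    case True
    then show ?thesis using k mod_less_divisor[OF k, of l] by (auto simp: r_def cong_def)
  next
    case False
    then have "n mod k = n" using n by simp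
    then show ?thesis using n False by (auto simp: r_def cong_def)
  qed
  have "(\<Sum>n=1..k. if [n = l] (mod k) then 1 else 0) = (\<Sum>n=1..k. if n = r then 1 else (0 :: complex))"
    by (intro sum.cong) (auto simp: iff)
  then show ?thesis using r by (simp add: sum.delta)
qed

text \<open>Only the principal character contributes a multiple of ln N; all others are O(1), so the
  deviation is even bounded.\<close>

theorem residue_class_log_density:
  assumes k: "k > 0" and l: "coprime l k"
  shows "has_log_density {p. prime p \<and> [p = l] (mod k)} (1 / real (totient k))"
proof -
  obtain cs where cs: "\<And>c \<psi>. (c, \<psi>) \<in> set cs \<Longrightarrow> dirichlet_char k \<psi>"
    "\<And>n. (if [n = l] (mod k) then 1 else 0) = (\<Sum>(c, \<psi>)\<leftarrow>cs. c * \<psi> n)"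
    using residue_class_char_expansion[OF k l] by blast
  \<comment> \<open>The total coefficient of the principal character, however often it occurs in the
    list. Summing the expansion over one period kills all other characters and leaves 1 = \<phi>(k)
    \<kappa>.\<close>
  define \<kappa> where "\<kappa> = (\<Sum>(c, \<psi>)\<leftarrow>cs. c * (if \<psi> = principal_char k then 1 else 0))"
  have sum_swap: "(\<Sum>n\<in>A. (\<Sum>(c, \<psi>)\<leftarrow>cs. c * \<psi> n) * w n) = (\<Sum>(c, \<psi>)\<leftarrow>cs. c * (\<Sum>n\<in>A. \<psi> n * w n))" for A :: "nat set" and w :: "nat \<Rightarrow> complex"
    by (induction cs) (auto simp: sum.distrib distrib_right sum_distrib_left mult.assoc)
  have \<kappa>: "\<kappa> = 1 / of_nat (totient k)"
  proof -
    have "(\<Sum>n=1..k. principal_char k n) = of_nat (totient k)"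
    proof -
      have "(\<Sum>n=1..k. principal_char k n) = (\<Sum>n\<in>totatives k. 1)"
        by (rule sum.mono_neutral_cong_right) (auto simp: principal_char_def totatives_def)
      then show ?thesis by (simp add: totient_def)
    qed
    then have per: "(\<Sum>n=1..k. \<psi> n) = of_nat (totient k) * (if \<psi> = principal_char k then 1 else 0)" if "dirichlet_char k \<psi>" for \<psi>
      using sum_char_period[OF k that] by auto
    have "1 = (\<Sum>n=1..k. (\<Sum>(c, \<psi>)\<leftarrow>cs. c * \<psi> n) * 1)"
      using sum_residue_class_period[OF k, of l] cs(2) by simp
    also have "\<dots> = (\<Sum>(c, \<psi>)\<leftarrow>cs. c * (\<Sum>n=1..k. \<psi> n * 1))" by (rule sum_swap)
    also have "\<dots> = (\<Sum>(c, \<psi>)\<leftarrow>cs. of_nat (totient k) * (c * (if \<psi> = principal_char k then 1 else 0)))"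
      using cs(1) by (intro arg_cong[of _ _ sum_list] map_cong) (auto simp: per[unfolded One_nat_def])
    also have "\<dots> = of_nat (totient k) * \<kappa>"
      unfolding \<kappa>_def sum_list_const_mult[symmetric] by (simp add: case_prod_unfold)
    finally show ?thesis using k by (simp add: field_simps)
  qed
  let ?S = "{p. prime p \<and> [p = l] (mod k)}"
  define T where "T N = (\<Sum>p | prime p \<and> p \<le> N. (if p \<in> ?S then 1 else 0) * (ln (real p) / real p))" for N
  have T_eq: "of_real (T N) = (\<Sum>(c, \<psi>)\<leftarrow>cs. c * char_prime_sum \<psi> N)" for N
  proof -
    have "complex_of_real (T N) = (\<Sum>p | prime p \<and> p \<le> N. (\<Sum>(c, \<psi>)\<leftarrow>cs. c * \<psi> p) * of_real (ln (real p) / real p))"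
      unfolding T_def of_real_sum by (intro sum.cong) (auto simp flip: cs(2))
    then show ?thesis unfolding char_prime_sum_def sum_swap .
  qed
  have "\<exists>B. \<forall>N\<ge>1. norm ((\<Sum>(c, \<psi>)\<leftarrow>cs. c * char_prime_sum \<psi> N) - (\<Sum>(c, \<psi>)\<leftarrow>cs. c * (if \<psi> = principal_char k then 1 else 0)) * of_real (ln (real N))) \<le> B"
    using cs(1)
  proof (induction cs)
    case Nil
    then show ?case by (intro exI[of _ 0]) auto
  next
    case (Cons a cs)
    obtain c \<psi> where a: "a = (c, \<psi>)" by (cases a)
    obtain B1 where B1: "\<forall>N\<ge>1. norm ((\<Sum>(c, \<psi>)\<leftarrow>cs. c * char_prime_sum \<psi> N) - (\<Sum>(c, \<psi>)\<leftarrow>cs. c * (if \<psi> = principal_char k then 1 else 0)) * of_real (ln (real N))) \<le> B1"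
      using Cons.IH Cons.prems by (meson list.set_intros(2))
    have "dirichlet_char k \<psi>" by (rule Cons.prems[of c \<psi>]) (simp add: a)
    then obtain B2 where B2: "\<forall>N\<ge>1. norm (char_prime_sum \<psi> N - (if \<psi> = principal_char k then of_real (ln (real N)) else 0)) \<le> B2"
      using char_prime_sum_asymp[OF k] by blast
    have "norm ((\<Sum>(c, \<psi>)\<leftarrow>a # cs. c * char_prime_sum \<psi> N) - (\<Sum>(c, \<psi>)\<leftarrow>a # cs. c * (if \<psi> = principal_char k then 1 else 0)) * of_real (ln (real N))) \<le> norm c * B2 + B1"
      if N: "N \<ge> 1" for N
    proof -
      define X where "X = (\<Sum>(c, \<psi>)\<leftarrow>cs. c * char_prime_sum \<psi> N)"
      define Y where "Y = (\<Sum>(c, \<psi>)\<leftarrow>cs. c * (if \<psi> = principal_char k then 1 else 0))"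
      have "(\<Sum>(c, \<psi>)\<leftarrow>a # cs. c * char_prime_sum \<psi> N) - (\<Sum>(c, \<psi>)\<leftarrow>a # cs. c * (if \<psi> = principal_char k then 1 else 0)) * of_real (ln (real N)) =
         c * (char_prime_sum \<psi> N - (if \<psi> = principal_char k then of_real (ln (real N)) else 0)) + (X - Y * of_real (ln (real N)))"
        by (simp add: a X_def Y_def algebra_simps)
      also have "norm \<dots> \<le> norm c * B2 + B1"
      proof (rule norm_triangle_mono)
        show "norm (c * (char_prime_sum \<psi> N - (if \<psi> = principal_char k then of_real (ln (real N)) else 0))) \<le> norm c * B2"
          unfolding norm_mult using B2 N by (intro mult_left_mono) auto
        show "norm (X - Y * of_real (ln (real N))) \<le> B1" using B1 N unfolding X_def Y_def by blast
      qed
      finally show ?thesis .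
    qed
    then show ?case by blast
  qed
  then obtain B where B: "\<And>N. N \<ge> 1 \<Longrightarrow> norm (complex_of_real (T N) - \<kappa> * of_real (ln (real N))) \<le> B"
    unfolding T_eq \<kappa>_def by blast
  obtain C where C: "C \<ge> 0" "\<And>N. N \<ge> 1 \<Longrightarrow> \<bar>(\<Sum>p | prime p \<and> p \<le> N. ln (real p) / real p) - ln (real N)\<bar> \<le> C"
    using mertens_first by blast
  let ?\<delta> = "1 / real (totient k)"
  have dev: "\<bar>log_prime_dev ?S ?\<delta> N\<bar> \<le> B + ?\<delta> * C" if N: "N \<ge> 1" for N
  proof -
    have "complex_of_real (T N) - \<kappa> * of_real (ln (real N)) = of_real (T N - ?\<delta> * ln (real N))" by (simp add: \<kappa>)
    then have 1: "\<bar>T N - ?\<delta> * ln (real N)\<bar> \<le> B" using B[OF N] by (simp only: norm_of_real)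
    have "\<bar>?\<delta> * ((\<Sum>p | prime p \<and> p \<le> N. ln (real p) / real p) - ln (real N))\<bar> \<le> ?\<delta> * C"
      unfolding abs_mult using C(2)[OF N] by (intro mult_mono) auto
    moreover have "log_prime_dev ?S ?\<delta> N = (T N - ?\<delta> * ln (real N)) - ?\<delta> * ((\<Sum>p | prime p \<and> p \<le> N. ln (real p) / real p) - ln (real N))"
    proof -
      have "log_prime_dev ?S ?\<delta> N = T N - ?\<delta> * (\<Sum>p | prime p \<and> p \<le> N. ln (real p) / real p)"
        unfolding log_prime_dev_def T_def sum_distrib_left sum_subtractf[symmetric]
        by (intro sum.cong) (auto simp: left_diff_distrib diff_divide_distrib)
      then show ?thesis by (simp add: right_diff_distrib)
    qed
    ultimately show ?thesis using 1 by linarith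
  qed
  show ?thesis unfolding has_log_density_def
  proof (rule Lim_null_comparison)
    show "(\<lambda>N. (B + ?\<delta> * C) / ln (real N)) \<longlonglongrightarrow> 0" by real_asymp
    show "\<forall>\<^sub>F N in sequentially. norm (log_prime_dev ?S ?\<delta> N / ln (real N)) \<le> (B + ?\<delta> * C) / ln (real N)"
      using eventually_ge_at_top[of 2]
    proof eventually_elim
      case (elim N)
      then have "ln (real N) > 0" by simp
      then show ?case using dev[of N] elim by (simp add: abs_divide divide_right_mono)
    qed
  qed
qed

section \<open>Ramanujan sums\<close>

lemma sum_roots_of_unity_powers:
  assumes e: "e > 0"
  shows "(\<Sum>t=1..e. exp (2 * of_real pi * \<i> * of_nat t * of_nat m / of_nat e)) = (if e dvd m then of_nat e else 0 :: complex)"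
proof -
  define z where "z = exp (2 * of_real pi * \<i> * of_nat m / of_nat e :: complex)"
  have pow: "exp (2 * of_real pi * \<i> * of_nat t * of_nat m / of_nat e) = z ^ t" for t
    by (simp add: z_def exp_of_nat_mult[symmetric] mult_ac)
  have ze: "z ^ e = 1" unfolding z_def using complex_root_unity[of e m] e by simp
  have z1: "z = 1 \<longleftrightarrow> e dvd m" unfolding z_def using complex_root_unity_eq_1[of e m] e by simp
  have "(1 - z) * (\<Sum>t=1..e. z ^ t) = z ^ 1 - z ^ Suc e" using e by (intro sum_gp_multiplied) auto
  also have "\<dots> = 0" by (simp add: ze)
  finally have "z \<noteq> 1 \<Longrightarrow> (\<Sum>t=1..e. z ^ t) = 0" by auto
  moreover have "z = 1 \<Longrightarrow> (\<Sum>t=1..e. z ^ t) = of_nat e" by simp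
  ultimately show ?thesis unfolding pow using z1 by auto
qed

text \<open>Coprimality is detected by the Moebius sum over the divisors d of gcd(q, n); for q = d t
  the inner sum runs over all (n / d)-th roots of unity. For fixed m \<ge> 1 the function convolved
  with \<mu> is supported on the divisors of m, so it decays faster than any power.\<close>

lemma ramanujan_sum_eq:
  assumes n: "n > 0"
  shows "ramanujan_sum n m = dirichlet_conv (\<lambda>d. of_int (moebius d)) (\<lambda>e. if e dvd m then of_nat e else 0) n"
proof -
  let ?E = "\<lambda>q. exp (2 * of_real pi * \<i> * of_nat q * of_nat m / of_nat n) :: complex"
  have "ramanujan_sum n m = (\<Sum>q=1..n. if coprime q n then ?E q else 0)"
    unfolding ramanujan_sum_def by (rule sum.mono_neutral_cong_left) auto
  also have "\<dots> = (\<Sum>q=1..n. \<Sum>d | d \<in> {d. d dvd n} \<and> d dvd q. of_int (moebius d) * ?E q)"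
  proof (rule sum.cong)
    fix q assume "q \<in> {1..n}"
    have "{d. d \<in> {d. d dvd n} \<and> d dvd q} = {d. d dvd gcd q n}" by auto
    then have "(\<Sum>d | d \<in> {d. d dvd n} \<and> d dvd q. of_int (moebius d) * ?E q) = of_int (\<Sum>d | d dvd gcd q n. moebius d) * ?E q"
      by (simp add: sum_distrib_right)
    also have "\<dots> = (if coprime q n then ?E q else 0)"
    proof -
      have s: "(\<Sum>d | d dvd gcd q n. moebius d) = (if gcd q n = 1 then 1 else 0)"
        using n by (intro sum_moebius_divisors) auto
      show ?thesis
      proof (cases "coprime q n")
        case True
        then have "gcd q n = 1" by (simp only: coprime_iff_gcd_eq_1)
        from trans[OF s if_P[OF this]] show ?thesis using True by simp
      next
        case False
        then have "gcd q n \<noteq> 1" by (simp only: coprime_iff_gcd_eq_1 not_False_eq_True)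
        from trans[OF s if_not_P[OF this]] show ?thesis using False by simp
      qed
    qed
    finally show "(if coprime q n then ?E q else 0) = (\<Sum>d | d \<in> {d. d dvd n} \<and> d dvd q. of_int (moebius d) * ?E q)" ..
  qed auto
  also have "\<dots> = (\<Sum>d | d dvd n. \<Sum>q | q \<in> {1..n} \<and> d dvd q. of_int (moebius d) * ?E q)"
    using n by (intro sum.swap_restrict) auto
  also have "\<dots> = (\<Sum>d | d dvd n. of_int (moebius d) * (if n div d dvd m then of_nat (n div d) else 0))"
  proof (rule sum.cong)
    fix d assume "d \<in> {d. d dvd n}"
    then obtain e where e: "n = d * e" by auto
    have de: "d > 0" "e > 0" using n e by auto
    have "(\<Sum>q | q \<in> {1..n} \<and> d dvd q. ?E q) = (\<Sum>t=1..e. exp (2 * of_real pi * \<i> * of_nat t * of_nat m / of_nat e))"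
      using de e by (intro sum.reindex_bij_witness[where i = "\<lambda>t. d * t" and j = "\<lambda>q. q div d"]) (auto elim!: dvdE simp: mult_ac)
    also have "\<dots> = (if n div d dvd m then of_nat (n div d) else 0)"
      using sum_roots_of_unity_powers[OF de(2), of m] e de by simp
    finally show "(\<Sum>q | q \<in> {1..n} \<and> d dvd q. of_int (moebius d) * ?E q) = of_int (moebius d) * (if n div d dvd m then of_nat (n div d) else 0)"
      by (simp only: sum_distrib_left[symmetric])
  qed auto
  finally show ?thesis by (simp add: dirichlet_conv_def)
qed

section \<open>From integer to real cut-offs\<close>

lemma filterlim_nat_floor_at_top: "filterlim (\<lambda>x :: real. nat \<lfloor>x\<rfloor>) at_top at_top"
  unfolding filterlim_at_top
proof
  fix Z :: nat
  show "\<forall>\<^sub>F x :: real in at_top. Z \<le> nat \<lfloor>x\<rfloor>"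
    using eventually_ge_at_top[of "real Z"] by eventually_elim (rule le_nat_floor)
qed

lemma real_le_iff_nat_floor: "n > 0 \<Longrightarrow> real n \<le> x \<longleftrightarrow> n \<le> nat \<lfloor>x\<rfloor>"
  by linarith

theorem dirichlet_conv_lpd_tendsto:
  fixes a :: "nat \<Rightarrow> complex"
  assumes "a 1 = 1" "\<alpha> > 0" "\<And>n. n \<ge> 1 \<Longrightarrow> norm (a n) \<le> C * real n powr (- \<alpha>)" "has_log_density S \<delta>"
  shows "((\<lambda>x :: real. - (\<Sum>n | 2 \<le> n \<and> real n \<le> x \<and> lpd n \<in> S.
            dirichlet_conv (\<lambda>d. of_int (moebius d)) a n / of_nat (totient n))) \<longlongrightarrow> complex_of_real \<delta>) at_top"
proof -
  have set_eq: "{n. 2 \<le> n \<and> real n \<le> x \<and> lpd n \<in> S} = {n. n \<in> {2..nat \<lfloor>x\<rfloor>} \<and> lpd n \<in> S}" for x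
    using real_le_iff_nat_floor[of _ x] by auto
  show ?thesis unfolding set_eq
    using filterlim_compose[OF dirichlet_conv_log_density[where a = a, OF assms] filterlim_nat_floor_at_top] .
qed

text \<open>For n \<ge> 2 the least prime divisor is prime, so the congruence condition is
  membership in a set of primes of known logarithmic density.\<close>

lemma residue_class_lpd_tendsto:
  fixes a :: "nat \<Rightarrow> complex"
  assumes "a 1 = 1" "\<alpha> > 0" "\<And>n. n \<ge> 1 \<Longrightarrow> norm (a n) \<le> C * real n powr (- \<alpha>)" and k: "k > 0" "coprime l k"
  shows "((\<lambda>x :: real. - (\<Sum>n | 2 \<le> n \<and> real n \<le> x \<and> [lpd n = l] (mod k).
            dirichlet_conv (\<lambda>d. of_int (moebius d)) a n / of_nat (totient n))) \<longlongrightarrow> of_real (1 / real (totient k))) at_top"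
proof -
  have "{n. 2 \<le> n \<and> real n \<le> x \<and> [lpd n = l] (mod k)} = {n. 2 \<le> n \<and> real n \<le> x \<and> lpd n \<in> {p. prime p \<and> [p = l] (mod k)}}" for x
    using lpd_prime by auto
  then show ?thesis
    using dirichlet_conv_lpd_tendsto[where a = a, OF assms(1-3) residue_class_log_density[OF k]] by simp
qed

theorem corollary1p2:
  shows "(\<forall>(a :: nat \<Rightarrow> complex) (\<alpha> :: real) (S :: nat set) (\<delta> :: real).
            a 1 = 1 \<longrightarrow>
            \<alpha> > 0 \<longrightarrow>
            (\<exists>C :: real. \<forall>n\<ge>1. norm (a n) \<le> C * real n powr (- \<alpha>)) \<longrightarrow>
            S \<subseteq> {p. prime p} \<longrightarrow>
            has_natural_density S \<delta> \<longrightarrow>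
            ((\<lambda>x :: real. - (\<Sum>n | 2 \<le> n \<and> real n \<le> x \<and> least_prime_divisor n \<in> S.
                dirichlet_conv (\<lambda>d. of_int (moebius d)) a n / of_nat (totient n)))
              \<longlongrightarrow> complex_of_real \<delta>) at_top)
       \<and> (\<forall>(m :: nat) (k :: nat) (l :: nat).
            m \<ge> 1 \<longrightarrow> k \<ge> 1 \<longrightarrow> l \<ge> 1 \<longrightarrow> coprime l k \<longrightarrow>
            ((\<lambda>x :: real. - (\<Sum>n | 2 \<le> n \<and> real n \<le> x \<and> [least_prime_divisor n = l] (mod k).
                real_of_int (moebius n) / real (totient n)))
              \<longlongrightarrow> 1 / real (totient k)) at_top
          \<and> ((\<lambda>x :: real. - (\<Sum>n | 2 \<le> n \<and> real n \<le> x \<and> [least_prime_divisor n = l] (mod k).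
                ramanujan_sum n m / of_nat (totient n)))
              \<longlongrightarrow> 1 / of_nat (totient k)) at_top)"
proof (intro conjI allI impI)
  fix a :: "nat \<Rightarrow> complex" and \<alpha> :: real and S :: "nat set" and \<delta> :: real
  assume a: "a 1 = 1" "\<alpha> > 0" and C: "\<exists>C :: real. \<forall>n\<ge>1. norm (a n) \<le> C * real n powr (- \<alpha>)"
    and dens: "has_natural_density S \<delta>"
  obtain C where C': "\<And>n. n \<ge> 1 \<Longrightarrow> norm (a n) \<le> C * real n powr (- \<alpha>)" using C by blast
  show "((\<lambda>x :: real. - (\<Sum>n | 2 \<le> n \<and> real n \<le> x \<and> least_prime_divisor n \<in> S.
                dirichlet_conv (\<lambda>d. of_int (moebius d)) a n / of_nat (totient n)))
              \<longlongrightarrow> complex_of_real \<delta>) at_top"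
    by (rule dirichlet_conv_lpd_tendsto[where a = a and \<alpha> = \<alpha> and C = C,
          OF a C' natural_density_imp_log_density[OF dens]])
next
  fix m k l :: nat
  assume m: "m \<ge> 1" and "k \<ge> 1" "l \<ge> 1" and l: "coprime l k"
  then have k: "k > 0" by simp
  \<comment> \<open>The unit of Dirichlet convolution, so that convolving it with \<mu> gives \<mu>
    back.\<close>
  define a where "a n = (if n = 1 then 1 else 0 :: complex)" for n :: nat
  have conv: "dirichlet_conv (\<lambda>d. of_int (moebius d)) a n = of_int (moebius n)" if "n > 0" for n
  proof -
    have "dirichlet_conv (\<lambda>d. of_int (moebius d)) a n = (\<Sum>d | d dvd n. if d = n then of_int (moebius d) else 0)"
      unfolding dirichlet_conv_def using that by (intro sum.cong) (auto simp: a_def elim!: dvdE)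
    then show ?thesis using that by (simp add: sum.delta)
  qed
  have lim: "((\<lambda>x :: real. - (\<Sum>n | 2 \<le> n \<and> real n \<le> x \<and> [lpd n = l] (mod k).
            dirichlet_conv (\<lambda>d. of_int (moebius d)) a n / of_nat (totient n))) \<longlongrightarrow> of_real (1 / real (totient k))) at_top"
    by (rule residue_class_lpd_tendsto[where a = a and \<alpha> = 1 and C = 1, OF _ _ _ k l]) (simp_all add: a_def)
  have eq: "(\<lambda>x :: real. - (\<Sum>n | 2 \<le> n \<and> real n \<le> x \<and> [lpd n = l] (mod k). dirichlet_conv (\<lambda>d. of_int (moebius d)) a n / of_nat (totient n))) =
     (\<lambda>x. complex_of_real (- (\<Sum>n | 2 \<le> n \<and> real n \<le> x \<and> [lpd n = l] (mod k). real_of_int (moebius n) / real (totient n))))"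
    by (simp add: conv)
  show "((\<lambda>x :: real. - (\<Sum>n | 2 \<le> n \<and> real n \<le> x \<and> [least_prime_divisor n = l] (mod k).
                real_of_int (moebius n) / real (totient n)))
              \<longlongrightarrow> 1 / real (totient k)) at_top"
    using lim unfolding eq tendsto_of_real_iff .
next
  fix m k l :: nat
  assume m: "m \<ge> 1" and "k \<ge> 1" "l \<ge> 1" and l: "coprime l k"
  then have k: "k > 0" by simp
  let ?a = "\<lambda>e. if e dvd m then of_nat e else 0 :: complex"
  \<comment> \<open>A divisor n of m satisfies n \<le> m, hence n \<le> m^2 / n; this is the decay
    with \<alpha> = 1.\<close>
  have bound: "norm (?a n) \<le> real m ^ 2 * real n powr (- 1)" if n: "n \<ge> 1" for n
  proof (cases "n dvd m")
    case True
    then have "real n \<le> real m" using m by (auto dest: dvd_imp_le)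
    then have "real n * real n \<le> real m * real m" by (intro mult_mono) auto
    then show ?thesis using True n by (simp add: powr_minus_divide field_simps power2_eq_square)
  qed auto
  have lim: "((\<lambda>x :: real. - (\<Sum>n | 2 \<le> n \<and> real n \<le> x \<and> [lpd n = l] (mod k).
            dirichlet_conv (\<lambda>d. of_int (moebius d)) ?a n / of_nat (totient n))) \<longlongrightarrow> of_real (1 / real (totient k))) at_top"
    by (rule residue_class_lpd_tendsto[where a = ?a and \<alpha> = 1 and C = "real m ^ 2", OF _ _ bound k l]) simp_all
  have eq: "- (\<Sum>n | 2 \<le> n \<and> real n \<le> x \<and> [lpd n = l] (mod k). dirichlet_conv (\<lambda>d. of_int (moebius d)) ?a n / of_nat (totient n)) =
     - (\<Sum>n | 2 \<le> n \<and> real n \<le> x \<and> [lpd n = l] (mod k). ramanujan_sum n m / of_nat (totient n))" for x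
    by (intro arg_cong[of _ _ uminus] sum.cong) (auto simp: ramanujan_sum_eq)
  have c: "of_real (1 / real (totient k)) = (1 / of_nat (totient k) :: complex)" by simp
  show "((\<lambda>x :: real. - (\<Sum>n | 2 \<le> n \<and> real n \<le> x \<and> [least_prime_divisor n = l] (mod k).
                ramanujan_sum n m / of_nat (totient n)))
              \<longlongrightarrow> 1 / of_nat (totient k)) at_top"
    by (rule Lim_transform_eventually[OF lim[unfolded c] always_eventually[OF allI[OF eq]]])
qed

end
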